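(* Let $n,k$ be integers with $k\ge2$ and $n>4k$, let $p_*=\frac{k(n+2)}{n-2k}$, and let $u\in C^2(\mathbb{R}^n)$ satisfy $$u\ge0,\qquad -D^2u\in\overline{\Gamma_k},\qquad \sigma_k(-D^2u)=u^{p_*}\quad\text{in }\mathbb{R}^n.$$ Suppose that, for some $C>0$ and all sufficiently large $R$, $$\int_{B_R}u^{\frac{n(k+1)-2k}{n-2k}}\,dx\le CR^2\log R.$$ Then either $u\equiv0$, or $$u(x)=\bigl(a_0+b_0|x-x_0|^2\bigr)^{-\frac{n-2k}{2k}}$$ for some $x_0\in\mathbb{R}^n$ and $a_0,b_0>0$ satisfying $\binom nk a_0\left(\frac{n-2k}{k}b_0\right)^k=1$.
   Context: For a real symmetric $n\times n$ matrix $A$, $\sigma_j(A)$ is the $j$-th elementary symmetric function of its eigenvalues; $\Gamma_k=\{A:\sigma_j(A)>0,\ 1\le j\le k\}$ and $\overline{\Gamma_k}=\{A:\sigma_j(A)\ge0,\ 1\le j\le k\}$. $B_R$ is the Euclidean ball of radius $R$ centered at the origin. *)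

theory Defs
  imports "HOL-Analysis.Analysis" "HOL-Computational_Algebra.Polynomial"
begin

definition charpoly :: "real^'n^'n \<Rightarrow> real poly" where
  "charpoly A = det (\<chi> i j. (if i = j then [:0, 1:] else 0) - [:A $ i $ j:])"

text \<open>
  The eigenvalues in ascending order, repeated according to algebraic multiplicity.  For a
  symmetric matrix this list has length \<open>CARD('n)\<close>; for other matrices only the real eigenvalues
  are listed, and the definition is not meant to be used there.
\<close>

definition eigenvals :: "real^'n^'n \<Rightarrow> real list" where
  "eigenvals A = sorted_list_of_multiset (proots (charpoly A))"

definition elem_sym :: "nat \<Rightarrow> real list \<Rightarrow> real" where
  "elem_sym j xs = (\<Sum>I | I \<subseteq> {..<length xs} \<and> card I = j. \<Prod>i\<in>I. xs ! i)"

definition \<sigma> :: "nat \<Rightarrow> real^'n^'n \<Rightarrow> real" where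
  "\<sigma> j A = elem_sym j (eigenvals A)"

definition closed_Gamma :: "nat \<Rightarrow> (real^'n^'n) set" where
  "closed_Gamma k = {A. transpose A = A \<and> (\<forall>j. 1 \<le> j \<and> j \<le> k \<longrightarrow> \<sigma> j A \<ge> 0)}"

definition grad :: "(real^'n \<Rightarrow> real) \<Rightarrow> real^'n \<Rightarrow> real^'n" where
  "grad u x = (\<chi> i. frechet_derivative u (at x) (axis i 1))"

definition hessian :: "(real^'n \<Rightarrow> real) \<Rightarrow> real^'n \<Rightarrow> real^'n^'n" where
  "hessian u x = jacobian (grad u) (at x)"

text \<open>\<open>C\<^sup>2\<close> on the whole space; the lower-order derivatives are continuous because they are
  differentiable.\<close>

definition C2 :: "(real^'n \<Rightarrow> real) \<Rightarrow> bool" where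
  "C2 u \<longleftrightarrow> (\<forall>x. u differentiable (at x)) \<and> (\<forall>x. grad u differentiable (at x))
     \<and> continuous_on UNIV (hessian u)"

end

theory Submission
  imports Defs "HOL-Computational_Algebra.Fundamental_Theorem_Algebra"
begin

text \<open>
  Write \<open>A = -D\<^sup>2u\<close>, \<open>\<kappa> = 2k / (n - 2k)\<close> and \<open>T\<^sub>j\<close> for the Newton transformations of \<open>A\<close>; these are weakly
  divergence free because \<open>A\<close> is a Hessian, even though \<open>u\<close> is only \<open>C\<^sup>2\<close>. The equation makes a
  combination of \<open>T\<^sub>k Du\<close>, \<open>\<sigma>\<^sub>k Du\<close> and \<open>|Du|\<^sup>2 T\<^sub>k\<^sub>-\<^sub>1 Du\<close>, weighted by powers of \<open>u\<close>, have divergence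
  \<open>u\<^sup>-\<^sup>\<kappa> Q\<close>, where \<open>Q\<close> is nonnegative by Newton's inequalities and controls the field itself. So
  \<open>\<integral> \<eta>\<^sup>2 u\<^sup>-\<^sup>\<kappa> Q \<le> C \<integral> |D\<eta>|\<^sup>2 u\<^sup>-\<^sup>\<kappa> |Du|\<^sup>2 \<sigma>\<^sub>k\<^sub>-\<^sub>1\<close> for every cutoff \<open>\<eta>\<close>. A Caccioppoli argument
  descending through \<open>\<sigma>\<^sub>k\<^sub>-\<^sub>1, \<sigma>\<^sub>k\<^sub>-\<^sub>2, \<dots>\<close> bounds the integral of \<open>u\<^sup>-\<^sup>\<kappa> |Du|\<^sup>2 \<sigma>\<^sub>k\<^sub>-\<^sub>1\<close> over \<open>B\<^sub>R\<close> by
  \<open>C R\<^sup>2 log R\<close>, which is exactly small enough for logarithmically averaged cutoffs to give \<open>Q = 0\<close>.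
  Equality in the pointwise inequality forces \<open>D\<^sup>2(u\<^sup>-\<^sup>\<kappa>)\<close> to be a multiple of the identity, hence
  \<open>u\<^sup>-\<^sup>\<kappa>\<close> to be a quadratic polynomial. Solutions with a zero vanish by Hopf's lemma.
\<close>

text \<open>The equation cannot be differentiated, because \<open>u\<close> has only two
  derivatives. It enters through the choice of test functions: \<open>u powr (p - \<kappa>)\<close>
  equals \<open>u powr (-\<kappa>)\<close> times the k-th symmetric function, so testing the
  identity for the trace of \<open>A\<close> with this weight produces the product of the first and
  the k-th symmetric functions in \<open>Q\<close>. Two more weighted identities are added, and
  \<kappa> is such that the leftover integrals cancel. The sign of \<open>Q\<close> becomes visible
  only after multiplication by |Du|^2: this spreads it over the eigendirections of \<open>A\<close>,
  where each summand is a completed square plus a defect of Newton and Maclaurin type for the other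
  eigenvalues. The hypothesis n > 4k says \<kappa> < 1. It is decisive at the start of the gradient
  estimates, where the term to be bounded has the coefficient 1 - \<kappa>. All intermediate
  integrals have the same scaling, so that Young's inequality can trade gradient factors for powers
  of u / R until only integrals of powers of \<open>u\<close> remain.\<close>

section \<open>Elementary symmetric functions of a finite family\<close>

text \<open>The generating polynomial gives the recursion under insertion at once and lets Newton's
  inequalities be read off its derivatives. The index set stays explicit so that a single eigenvalue
  can be removed.\<close>

definition esym :: "'a set \<Rightarrow> ('a \<Rightarrow> real) \<Rightarrow> nat \<Rightarrow> real" where
  "esym B l j = coeff (\<Prod>i\<in>B. [:1, l i:]) j"

lemma esym_0 [simp]: "esym B l 0 = 1"
proof -
  have "coeff (\<Prod>i\<in>B. [:1, l i:]) 0 = (\<Prod>i\<in>B. coeff [:1, l i:] 0)"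
    by (simp add: poly_prod flip: poly_0_coeff_0)
  then show ?thesis by (simp add: esym_def)
qed

lemma esym_empty: "esym {} l (Suc j) = 0"
  by (simp add: esym_def)

lemma esym_insert:
  assumes "finite B" "i \<notin> B"
  shows "esym (insert i B) l (Suc j) = esym B l (Suc j) + l i * esym B l j"
  using assms by (simp add: esym_def)

lemma esym_remove:
  assumes "finite B" "i \<in> B"
  shows "esym B l (Suc j) = esym (B - {i}) l (Suc j) + l i * esym (B - {i}) l j"
  using esym_insert[of "B - {i}" i l j] assms by (simp add: insert_absorb)

lemma esym_eq_0:
  assumes "finite B" "j > card B"
  shows "esym B l j = 0"
  using assms
proof (induction B arbitrary: j rule: finite_induct)
  case empty
  then show ?case by (cases j) (auto simp: esym_empty)
next
  case (insert i B)
  then show ?case by (cases j) (auto simp: esym_insert)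
qed

lemma esym_Suc_0: "finite B \<Longrightarrow> esym B l (Suc 0) = (\<Sum>i\<in>B. l i)"
  by (induction B rule: finite_induct) (auto simp: esym_empty esym_insert)

lemma esym_2: "finite B \<Longrightarrow> 2 * esym B l 2 = (\<Sum>i\<in>B. l i)\<^sup>2 - (\<Sum>i\<in>B. (l i)\<^sup>2)"
proof (induction B rule: finite_induct)
  case empty
  then show ?case by (simp add: numeral_2_eq_2 esym_empty)
next
  case (insert i B)
  have "esym (insert i B) l 2 = esym B l 2 + l i * (\<Sum>i\<in>B. l i)"
    using insert.hyps by (simp add: numeral_2_eq_2 esym_insert esym_Suc_0)
  then show ?case using insert by (simp add: power2_eq_square algebra_simps)
qed

lemma esym_cong: "(\<And>i. i \<in> B \<Longrightarrow> l i = m i) \<Longrightarrow> esym B l j = esym B m j"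
  unfolding esym_def by (metis (no_types, lifting) prod.cong)

lemma esym_const:
  assumes "finite B"
  shows "esym B (\<lambda>_. r) j = real (card B choose j) * r ^ j"
  using assms
proof (induction B arbitrary: j rule: finite_induct)
  case empty
  then show ?case by (cases j) (auto simp: esym_empty)
next
  case (insert i B)
  then show ?case by (cases j) (auto simp: esym_insert algebra_simps)
qed

lemma esym_of_real:
  assumes "finite B"
  shows "coeff (\<Prod>i\<in>B. [:1, complex_of_real (l i):]) j = complex_of_real (esym B l j)"
  using assms
proof (induction B arbitrary: j rule: finite_induct)
  case empty
  then show ?case by (cases j) (auto simp: esym_empty)
next
  case (insert i B)
  then show ?case by (cases j) (auto simp: esym_insert)
qed

subsection \<open>Newton's inequalities\<close>

definition real_rooted :: "complex poly \<Rightarrow> bool" where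
  "real_rooted p \<longleftrightarrow> p = 0 \<or> (\<forall>z. poly p z = 0 \<longrightarrow> z \<in> \<real>)"

text \<open>The logarithmic derivative of a real-rooted polynomial has nonzero imaginary part off the
  real axis.\<close>

lemma real_rooted_pderiv:
  assumes "real_rooted p"
  shows "real_rooted (pderiv p)"
proof (cases "degree p = 0")
  case True
  then show ?thesis by (simp add: real_rooted_def pderiv_eq_0_iff)
next
  case False
  then have p0: "p \<noteq> 0" by auto
  obtain r where r: "smult (lead_coeff p) (\<Prod>i<degree p. [:-r i, 1:]) = p"
    using complex_poly_decompose' by blast
  define d where "d = degree p"
  have eval: "poly p w = lead_coeff p * (\<Prod>i<d. w - r i)" for w
    by (subst r[symmetric]) (simp add: poly_prod d_def)
  have rR: "r i \<in> \<real>" if "i < d" for i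
  proof -
    have "poly p (r i) = 0" using that by (auto simp: eval)
    then show ?thesis using assms p0 by (auto simp: real_rooted_def)
  qed
  have "z \<in> \<real>" if z: "poly (pderiv p) z = 0" for z
  proof (rule ccontr)
    assume nz: "z \<notin> \<real>"
    then have Im: "Im z \<noteq> 0" by (simp add: complex_is_Real_iff)
    have ne: "z - r i \<noteq> 0" if "i < d" for i using rR[OF that] nz by auto
    have "poly (pderiv p) z = lead_coeff p * (\<Sum>i<d. \<Prod>j\<in>{..<d} - {i}. z - r j)"
      by (subst r[symmetric])
        (simp add: pderiv_smult pderiv_prod poly_sum poly_prod d_def pderiv_pCons)
    also have "(\<Sum>i<d. \<Prod>j\<in>{..<d} - {i}. z - r j) = (\<Sum>i<d. (\<Prod>j<d. z - r j) * inverse (z - r i))"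
    proof (intro sum.cong refl)
      fix i assume i: "i \<in> {..<d}"
      have "(\<Prod>j<d. z - r j) = (z - r i) * (\<Prod>j\<in>{..<d} - {i}. z - r j)"
        using i by (simp add: prod.remove)
      then show "(\<Prod>j\<in>{..<d} - {i}. z - r j) = (\<Prod>j<d. z - r j) * inverse (z - r i)"
        using ne i by simp
    qed
    also have "\<dots> = (\<Prod>j<d. z - r j) * (\<Sum>i<d. inverse (z - r i))"
      by (simp add: sum_distrib_left)
    finally have "(\<Sum>i<d. inverse (z - r i)) = 0"
      using z ne p0 by (auto simp: )
    then have "(\<Sum>i<d. Im (inverse (z - r i))) = 0"
      by (metis Im_sum zero_complex.simps(2))
    moreover have "Im (inverse (z - r i)) = - Im z * inverse ((Re (z - r i))\<^sup>2 + (Im (z - r i))\<^sup>2)"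
      if "i < d" for i
      using rR[OF that] by (auto simp: complex_is_Real_iff divide_inverse)
    ultimately have "(\<Sum>i<d. - Im z * inverse ((Re (z - r i))\<^sup>2 + (Im (z - r i))\<^sup>2)) = 0"
      by simp
    then have "- Im z * (\<Sum>i<d. inverse ((Re (z - r i))\<^sup>2 + (Im (z - r i))\<^sup>2)) = 0"
      by (simp add: sum_distrib_left)
    moreover have "(\<Sum>i<d. inverse ((Re (z - r i))\<^sup>2 + (Im (z - r i))\<^sup>2)) > 0"
    proof (rule sum_pos)
      show "{..<d} \<noteq> {}" using False by (auto simp: d_def)
      fix i assume "i \<in> {..<d}"
      then have "Im (z - r i) \<noteq> 0" using rR[of i] Im by (auto simp: complex_is_Real_iff)
      then show "0 < inverse ((Re (z - r i))\<^sup>2 + (Im (z - r i))\<^sup>2)"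
        by (simp add: add_nonneg_pos)
    qed simp
    ultimately show False using Im by simp
  qed
  then show ?thesis by (simp add: real_rooted_def)
qed

lemma real_rooted_higher_pderiv: "real_rooted p \<Longrightarrow> real_rooted ((pderiv ^^ m) p)"
  by (induction m) (auto intro: real_rooted_pderiv)

text \<open>Since zero is not a root, each factor X - r can be rescaled to 1 + y X with y = -1 / r,
  the shape whose coefficients are the symmetric functions of the \<open>y i\<close>.\<close>

lemma real_rooted_factor:
  assumes "real_rooted p" "coeff p 0 \<noteq> 0"
  obtains y :: "nat \<Rightarrow> real" where
    "p = smult (coeff p 0) (\<Prod>i<degree p. [:1, complex_of_real (y i):])"
proof -
  have p0: "p \<noteq> 0" using assms(2) by auto
  obtain r where r: "smult (lead_coeff p) (\<Prod>i<degree p. [:-r i, 1:]) = p"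
    using complex_poly_decompose' by blast
  define d where "d = degree p"
  have eval: "poly p w = lead_coeff p * (\<Prod>i<d. w - r i)" for w
    by (subst r[symmetric]) (simp add: poly_prod d_def)
  have rR: "r i \<in> \<real>" if "i < d" for i
  proof -
    have "poly p (r i) = 0" using that by (auto simp: eval)
    then show ?thesis using assms p0 by (auto simp: real_rooted_def)
  qed
  have r0: "r i \<noteq> 0" if "i < d" for i
    using assms(2) eval[of 0] that by (auto simp: poly_0_coeff_0)
  define y where "y i = Re (- inverse (r i))" for i
  have y: "complex_of_real (y i) = - inverse (r i)" if "i < d" for i
    using rR[OF that] by (simp add: y_def of_real_Re complex_is_Real_iff complex_eq_iff)
  have "p = smult (lead_coeff p) (\<Prod>i<d. [:-r i, 1:])" using r by (simp add: d_def)
  also have "(\<Prod>i<d. [:-r i, 1:]) = (\<Prod>i<d. smult (- r i) [:1, complex_of_real (y i):])"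
    using r0 y by (intro prod.cong) auto
  also have "\<dots> = smult (\<Prod>i<d. - r i) (\<Prod>i<d. [:1, complex_of_real (y i):])"
  proof -
    have "(\<Prod>i\<in>I. smult (- r i) [:1, complex_of_real (y i):]) =
      smult (\<Prod>i\<in>I. - r i) (\<Prod>i\<in>I. [:1, complex_of_real (y i):])" for I
      by (rule prod_smult)
    then show ?thesis .
  qed
  finally have "p = smult (lead_coeff p * (\<Prod>i<d. - r i)) (\<Prod>i<d. [:1, complex_of_real (y i):])"
    by simp
  moreover have "coeff p 0 = lead_coeff p * (\<Prod>i<d. - r i)"
    using eval[of 0] by (simp add: poly_0_coeff_0)
  ultimately show ?thesis using that[of y] by (simp add: d_def)
qed

text \<open>For p = q0 times the product of the factors 1 + y_i X, this is the Cauchy-Schwarz bound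
  (sum y_i)^2 \<le> d * (sum y_i^2). Here \<open>d\<close> is only an upper bound for the degree,
  because vanishing eigenvalues lower the degree of the generating polynomial.\<close>

lemma real_rooted_laguerre:
  assumes "real_rooted p" "degree p \<le> d" "d \<ge> 1"
    and c: "coeff p 0 = of_real q0" "coeff p 1 = of_real q1" "coeff p 2 = of_real q2"
  shows "2 * real d * q0 * q2 \<le> (real d - 1) * q1\<^sup>2"
proof (cases "q0 = 0")
  case True
  then show ?thesis using assms(3) by simp
next
  case False
  then have "coeff p 0 \<noteq> 0" using c by simp
  then obtain y :: "nat \<Rightarrow> real" where
    y: "p = smult (coeff p 0) (\<Prod>i<degree p. [:1, complex_of_real (y i):])"
    using real_rooted_factor assms(1) by blast
  let ?B = "{..<degree p}"
  have cj: "coeff p j = of_real (q0 * esym ?B y j)" for j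
    by (subst y) (simp add: esym_of_real c(1))
  have 1: "q1 = q0 * (\<Sum>i\<in>?B. y i)"
    using cj[of 1] c(2) by (simp only: of_real_eq_iff) (simp add: esym_Suc_0)
  have 2: "q2 = q0 * esym ?B y 2"
    using cj[of 2] c(3) by (simp only: of_real_eq_iff)
  define s t where "s = (\<Sum>i\<in>?B. y i)" and "t = (\<Sum>i\<in>?B. (y i)\<^sup>2)"
  have "s\<^sup>2 \<le> real (degree p) * t"
    using sum_squared_le_sum_of_squares[of y ?B] by (simp add: s_def t_def mult.commute)
  also have "\<dots> \<le> real d * t"
    using assms(2) by (intro mult_right_mono) (auto simp: t_def sum_nonneg)
  finally have st: "s\<^sup>2 \<le> real d * t" .
  have q2: "2 * q2 = q0 * (s\<^sup>2 - t)"
    using esym_2[of ?B y] by (simp add: 2 s_def t_def)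
  have "2 * real d * q0 * q2 = real d * q0 * (2 * q2)" by simp
  also have "\<dots> = q0\<^sup>2 * (real d * s\<^sup>2 - real d * t)"
    unfolding q2 by (simp add: power2_eq_square algebra_simps)
  also have "\<dots> \<le> q0\<^sup>2 * (real d * s\<^sup>2 - s\<^sup>2)" using st by (intro mult_left_mono) auto
  also have "\<dots> = (real d - 1) * q1\<^sup>2" by (simp add: 1 s_def power_mult_distrib algebra_simps)
  finally show ?thesis .
qed

text \<open>The three lowest coefficients of the \<open>j\<close>-th derivative of the generating
  polynomial are multiples of the symmetric functions of orders \<open>j\<close>,
  \<open>j + 1\<close> and \<open>j + 2\<close>, so \<open>real_rooted_laguerre\<close> applies with
  the degree bound \<open>card B - j\<close>.\<close>

lemma esym_newton:
  assumes B: "finite B" and j: "Suc j \<le> card B"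
  shows "(real j + 2) * (real (card B) - real j) * esym B l j * esym B l (j + 2)
    \<le> (real j + 1) * (real (card B) - real j - 1) * (esym B l (j + 1))\<^sup>2"
proof -
  define p where "p = (\<Prod>i\<in>B. [:1, complex_of_real (l i):])"
  define q where "q = (pderiv ^^ j) p"
  have "real_rooted p"
    unfolding real_rooted_def
  proof (intro disjI2 allI impI)
    fix z assume "poly p z = 0"
    then obtain i where "1 + z * complex_of_real (l i) = 0"
      using B by (auto simp: p_def poly_prod prod_zero_iff)
    then show "z \<in> \<real>" 
      by (metis Reals_divide Reals_minus Reals_of_real add.commute add_eq_0_iff mult_zero_right Reals_1
          nonzero_eq_divide_eq add.inverse_inverse mult_minus_left zero_neq_one neg_equal_0_iff_equal)
  qed
  then have q: "real_rooted q" unfolding q_def by (rule real_rooted_higher_pderiv)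
  have "degree p \<le> card B"
    unfolding p_def using degree_prod_sum_le[OF B, of "\<lambda>i. [:1, complex_of_real (l i):]"]
    by (rule order.trans) (use sum_mono[of B "\<lambda>i. degree [:1, complex_of_real (l i):]" "\<lambda>_. 1"] in auto)
  then have dq: "degree q \<le> card B - j" by (simp add: q_def degree_higher_pderiv)
  have cq: "coeff q m = of_real (pochhammer (real (Suc m)) j * esym B l (m + j))" for m
    by (simp add: q_def coeff_higher_pderiv p_def esym_of_real B pochhammer_of_nat flip: of_nat_Suc)
  have p1: "pochhammer (real (Suc 0)) j = fact j"
    by (simp add: pochhammer_fact)
  have f2: "fact j * pochhammer (real (Suc j)) m = fact (j + m)" for m
    by (metis of_nat_Suc pochhammer_fact pochhammer_product' add.commute of_nat_1 of_nat_add plus_1_eq_Suc)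
  have p2: "pochhammer (real (Suc 1)) j = fact (j + 1)"
  proof -
    have "pochhammer (1::real) (1 + j) = pochhammer 1 1 * pochhammer (1 + of_nat 1) j"
      by (rule pochhammer_product')
    then show ?thesis by (simp add: pochhammer_fact add.commute)
  qed
  have p3: "pochhammer (real (Suc 2)) j = fact (j + 2) / 2"
  proof -
    have "pochhammer (1::real) (2 + j) = pochhammer 1 2 * pochhammer (1 + of_nat 2) j"
      by (rule pochhammer_product')
    moreover have "pochhammer (1::real) 2 = 2" by (simp add: numeral_2_eq_2 pochhammer_rec)
    moreover have "pochhammer (1::real) (2 + j) = fact (j + 2)" by (simp only: pochhammer_fact add.commute)
    moreover have "(1 + of_nat 2 :: real) = real (Suc 2)" by simp
    ultimately show ?thesis by simp
  qed
  have "2 * real (card B - j) * (fact j * esym B l j) * (fact (j + 2) / 2 * esym B l (j + 2))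
    \<le> (real (card B - j) - 1) * (fact (j + 1) * esym B l (j + 1))\<^sup>2"
    using real_rooted_laguerre[OF q dq _ cq[of 0] cq[of 1] cq[of 2]] j
    unfolding p1 p2 p3 by (simp only: add_0 add.commute[of _ j]) simp
  also have "(fact (j + 2)::real) = (real j + 2) * (real j + 1) * fact j" by (simp add: algebra_simps)
  also have "(fact (j + 1)::real) = (real j + 1) * fact j" by simp
  also have "real (card B - j) = real (card B) - real j" using j by (simp add: of_nat_diff)
  also have "2 * d * (F * x) * ((a + 2) * (a + 1) * F / 2 * z) = F\<^sup>2 * (a + 1) * ((a + 2) * d * x * z)"
    for d F x z a :: real by (simp add: power2_eq_square)
  also have "(d - 1) * ((a + 1) * F * y)\<^sup>2 = F\<^sup>2 * (a + 1) * ((a + 1) * (d - 1) * y\<^sup>2)"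
    for d F y a :: real by (simp add: power2_eq_square)
  finally have "(fact j)\<^sup>2 * (real j + 1) * ((real j + 2) * (real (card B) - real j) * esym B l j * esym B l (j + 2))
    \<le> (fact j)\<^sup>2 * (real j + 1) * ((real j + 1) * (real (card B) - real j - 1) * (esym B l (j + 1))\<^sup>2)" .
  moreover have "(fact j :: real)\<^sup>2 * (real j + 1) > 0" by simp
  ultimately show ?thesis by (simp only: mult_le_cancel_left_pos)
qed

subsection \<open>Eigenvalue cones\<close>

text \<open>Here \<open>B\<close> is a family from which the eigenvalue \<open>a\<close> was
  removed. The last two assumptions make the product of the outer symmetric functions at least the
  square of the middle one, while Newton's inequality has a strictly larger constant on the side of
  that product.\<close>

lemma esym_newton_pos_contra:
  assumes B: "finite B" and s: "esym B l j \<ge> 0" "esym B l (Suc j) < 0"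
    and "esym B l (Suc j) + a * esym B l j \<ge> 0" "esym B l (Suc (Suc j)) + a * esym B l (Suc j) \<ge> 0"
  shows False
proof -
  have j: "Suc j \<le> card B"
    using esym_eq_0[OF B, of "Suc j" l] s(2) by (cases "Suc j \<le> card B") auto
  define x y z where "x = esym B l j" and "y = - esym B l (Suc j)" and "z = esym B l (Suc (Suc j))"
  have *: "x \<ge> 0" "y > 0" "a * x \<ge> y" "z \<ge> a * y" using assms by (auto simp: x_def y_def z_def)
  define p q where "p = (real j + 2) * (real (card B) - real j)"
    and "q = (real j + 1) * (real (card B) - real j - 1)"
  have "p * x * z \<le> q * y\<^sup>2"
    using esym_newton[OF B j, of l] by (simp add: x_def y_def z_def p_def q_def)
  moreover have pq: "p > q" using j by (simp add: p_def q_def algebra_simps)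
  moreover have "q \<ge> 0" using j by (simp add: q_def)
  moreover have "y * y \<le> x * z"
  proof -
    have "y * y \<le> (a * x) * y" using * by (intro mult_right_mono) auto
    also have "\<dots> = x * (a * y)" by simp
    also have "\<dots> \<le> x * z" using * by (intro mult_left_mono) auto
    finally show ?thesis .
  qed
  ultimately have "p * (y * y) \<le> q * (y * y)"
    by (smt (verit) mult_left_mono power2_eq_square mult.assoc)
  then show False using pq *(2) by (simp add: mult_le_cancel_right)
qed

text \<open>Removing a positive eigenvalue keeps all orders up to \<open>k - 1\<close> nonnegative,
  which allows induction on the number of eigenvalues. A weak sign below \<open>k\<close> and a
  strict one at \<open>k\<close> is what the closed cone and the equation provide together.\<close>

lemma esym_pos:
  assumes "finite B" "\<And>j. 1 \<le> j \<Longrightarrow> j \<le> k \<Longrightarrow> esym B l j \<ge> 0" "esym B l k > 0" "j \<le> k"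
  shows "esym B l j > 0"
  using assms
proof (induction "card B" arbitrary: B k j rule: less_induct)
  case less
  show ?case
  proof (cases "k = 0 \<or> j = 0")
    case True
    then show ?thesis using less.prems by auto
  next
    case False
    then obtain k' where k': "k = Suc k'" by (cases k) auto
    obtain j' where j': "j = Suc j'" using False by (cases j) auto
    have "\<exists>i\<in>B. l i > 0"
    proof (rule ccontr)
      assume "\<not> ?thesis"
      then have le: "l i \<le> 0" if "i \<in> B" for i using that by force
      have "(\<Sum>i\<in>B. l i) \<ge> 0" using less.prems(2)[of 1] less.prems(1) k' by (simp add: esym_Suc_0)
      then have "(\<Sum>i\<in>B. - l i) = 0" using sum_nonpos[of B l] le by (simp add: sum_negf)
      moreover have "(\<Sum>i\<in>B. - l i) = 0 \<longleftrightarrow> (\<forall>i\<in>B. - l i = 0)"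
        using less.prems(1) le by (intro sum_nonneg_eq_0_iff) auto
      ultimately have "l i = 0" if "i \<in> B" for i using that by simp
      then have "esym B l k = esym B (\<lambda>_. 0) k" by (intro esym_cong) auto
      then show False using less.prems(1,3) k' by (simp add: esym_const)
    qed
    then obtain i where i: "i \<in> B" "l i > 0" by blast
    define D where "D = B - {i}"
    have D: "finite D" "card D < card B" using less.prems(1) i card_Diff1_less[of B i] by (auto simp: D_def)
    have rec: "esym B l (Suc m) = esym D l (Suc m) + l i * esym D l m" for m
      unfolding D_def using less.prems(1) i(1) by (rule esym_remove)
    have nn: "esym D l m \<ge> 0" if "m \<le> k'" for m
      using that
    proof (induction m)
      case (Suc m)
      show ?case
      proof (rule ccontr)
        assume "\<not> ?case"
        then show False
          using esym_newton_pos_contra[OF D(1), of l m "l i"] Suc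
            less.prems(2)[of "Suc m"] less.prems(2)[of "Suc (Suc m)"] rec k' by simp
      qed
    qed simp
    \<comment> \<open>If this value were zero, the k-th function of \<open>B\<close> would come
      entirely from \<open>D\<close>, and the induction hypothesis at the full order
      \<open>k\<close> for the smaller set would make it positive.\<close>
    have "esym D l k' > 0"
    proof (rule ccontr)
      assume "\<not> ?thesis"
      then have z: "esym D l k' = 0" using nn[of k'] by simp
      then have "esym D l k > 0" using less.prems(3) rec[of k'] k' by simp
      moreover have "esym D l m \<ge> 0" if "m \<le> k" for m
        using that nn[of m] \<open>esym D l k > 0\<close> k' by (cases "m = k") auto
      ultimately show False using less.hyps[OF D(2) D(1), of k k'] z k' by auto
    qed
    then have dj': "esym D l j' > 0" using less.hyps[OF D(2) D(1), of k' j'] nn less.prems(4) j' k' by auto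
    show ?thesis
    proof (cases "j = k")
      case True
      then show ?thesis using less.prems(3) by simp
    next
      case False
      then have "esym D l j \<ge> 0" using nn[of j] less.prems(4) k' by simp
      then show ?thesis using rec[of j'] i(2) j' dj' by (simp add: add_nonneg_pos)
    qed
  qed
qed

text \<open>Dropping any single eigenvalue, whatever its sign, costs one order of the cone. This is
  the positivity of the Newton transformations of order below \<open>k\<close>.\<close>

lemma esym_remove_pos:
  assumes B: "finite B" "i \<in> B" and pos: "\<And>j. j \<le> k \<Longrightarrow> esym B l j > 0" and "j < k"
  shows "esym (B - {i}) l j > 0"
  using \<open>j < k\<close>
proof (induction j)
  case (Suc j)
  let ?D = "B - {i}"
  have D: "finite ?D" using B by auto
  have rec: "esym B l (Suc m) = esym ?D l (Suc m) + l i * esym ?D l m" for m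
    using B by (rule esym_remove)
  have sj: "esym ?D l j > 0" using Suc by simp
  have e: "esym B l (Suc j) > 0" "esym B l (Suc (Suc j)) > 0" using pos Suc.prems by auto
  show ?case
  proof (rule ccontr)
    assume "\<not> ?case"
    moreover have "\<not> esym ?D l (Suc j) < 0"
      using esym_newton_pos_contra[OF D, of l j "l i"] sj e rec by auto
    \<comment> \<open>The borderline value has to be excluded separately: the next function would
      then be positive, and Newton's inequality would bound a positive product by zero.\<close>
    ultimately have z: "esym ?D l (Suc j) = 0" by simp
    then have p: "esym ?D l (Suc (Suc j)) > 0" using e rec by simp
    then have j: "Suc (Suc j) \<le> card ?D"
      using esym_eq_0[OF D, of "Suc (Suc j)" l] by (cases "Suc (Suc j) \<le> card ?D") auto
    have "0 < (real j + 2) * (real (card ?D) - real j) * esym ?D l j * esym ?D l (j + 2)"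
      using p sj j by (intro mult_pos_pos) auto
    also have "\<dots> \<le> 0" using esym_newton[OF D, of j l] j z by auto
    finally show False by simp
  qed
qed simp

section \<open>Normalised symmetric functions and Maclaurin's inequality\<close>

text \<open>With this normalisation equal eigenvalues \<open>r\<close> give \<open>r ^ j\<close>,
  and Newton's inequality has constant one.\<close>

definition esymhat :: "'a set \<Rightarrow> ('a \<Rightarrow> real) \<Rightarrow> nat \<Rightarrow> real" where
  "esymhat B l j = esym B l j / real (card B choose j)"

lemma esymhat_0 [simp]: "esymhat B l 0 = 1"
  by (simp add: esymhat_def)

lemma choose_Suc_real:
  assumes "j \<le> m"
  shows "(real j + 1) * real (m choose Suc j) = (real m - real j) * real (m choose j)"
proof -
  have "Suc j * (m choose Suc j) = (m - j) * (m choose j)"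
    by (simp only: binomial_absorption binomial_absorb_comp)
  then have "real (Suc j) * real (m choose Suc j) = real (m - j) * real (m choose j)"
    by (metis of_nat_mult)
  then show ?thesis using assms by (simp add: of_nat_diff algebra_simps)
qed

lemma choose_minus_1_real:
  assumes "m \<ge> 1"
  shows "real m * real (m - 1 choose j) = (real m - real j) * real (m choose j)"
    and "real m * real (m - 1 choose j) = (real j + 1) * real (m choose Suc j)"
proof -
  have "Suc j * (m choose Suc j) = m * (m - 1 choose j)" by (rule binomial_absorption)
  then show "real m * real (m - 1 choose j) = (real j + 1) * real (m choose Suc j)"
    by (metis of_nat_mult of_nat_Suc add.commute)
  show "real m * real (m - 1 choose j) = (real m - real j) * real (m choose j)"
  proof (cases "j \<le> m")
    case True
    have "(m - j) * (m choose j) = m * (m - 1 choose j)" by (rule binomial_absorb_comp)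
    then have "real (m - j) * real (m choose j) = real m * real (m - 1 choose j)"
      by (metis of_nat_mult)
    then show ?thesis using True by (simp add: of_nat_diff)
  next
    case False
    then show ?thesis by (simp add: binomial_eq_0)
  qed
qed

lemma esymhat_newton:
  assumes B: "finite B" and j: "j + 2 \<le> card B"
  shows "esymhat B l j * esymhat B l (j + 2) \<le> (esymhat B l (j + 1))\<^sup>2"
proof -
  let ?N = "card B"
  define x y z where "x = esymhat B l j" and "y = esymhat B l (j + 1)" and "z = esymhat B l (j + 2)"
  define b where "b = real (?N choose j)"
  have b: "b > 0" using j by (simp add: b_def)
  define c d where "c = real (?N choose (j + 1))" and "d = real (?N choose (j + 2))"
  define m a where "m = real ?N - real j" and "a = real j"
  have pos: "b > 0" "c > 0" "d > 0" "m > 1" "a \<ge> 0"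
    using j by (auto simp: b_def c_def d_def m_def a_def)
  have bc: "(a + 1) * c = m * b" using choose_Suc_real[of j ?N] j by (simp add: a_def b_def c_def m_def)
  have cd: "(a + 2) * d = (m - 1) * c"
    using choose_Suc_real[of "Suc j" ?N] j by (simp add: a_def d_def c_def m_def algebra_simps)
  have "(real j + 2) * (real ?N - real j) * esym B l j * esym B l (j + 2)
    \<le> (real j + 1) * (real ?N - real j - 1) * (esym B l (j + 1))\<^sup>2"
    using esym_newton[OF B, of j l] j by simp
  moreover have "esym B l j = x * b" "esym B l (j + 1) = y * c" "esym B l (j + 2) = z * d"
    using pos by (simp_all add: x_def y_def z_def b_def c_def d_def esymhat_def)
  ultimately have "(a + 2) * m * (x * b) * (z * d) \<le> (a + 1) * (m - 1) * (y * c)\<^sup>2"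
    by (simp add: a_def m_def)
  also have "(a + 2) * m * (x * b) * (z * d) = ((m * b) * ((a + 2) * d)) * (x * z)" by simp
  also have "\<dots> = ((a + 1) * (m - 1) * c\<^sup>2) * (x * z)" by (simp add: bc[symmetric] cd power2_eq_square)
  also have "(a + 1) * (m - 1) * (y * c)\<^sup>2 = ((a + 1) * (m - 1) * c\<^sup>2) * y\<^sup>2" by (simp add: power_mult_distrib)
  finally show ?thesis using pos by (simp add: x_def y_def z_def mult_le_cancel_left_pos)
qed

lemma esymhat_remove:
  assumes B: "finite B" "i \<in> B" and j: "j + 2 \<le> card B"
  shows "real (card B) * esymhat B l (j + 1) =
    (real (card B) - real j - 1) * esymhat (B - {i}) l (j + 1) + (real j + 1) * l i * esymhat (B - {i}) l j"
proof -
  let ?D = "B - {i}"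
  define n where "n = real (card B)"
  have cD: "card ?D = card B - 1" using B by simp
  define b c d where "b = real (card ?D choose j)" and "c = real (card ?D choose (j + 1))"
    and "d = real (card B choose (j + 1))"
  have pos: "b > 0" "c > 0" "d > 0" "n > 0" "n - j - 1 > 0" using j by (auto simp: b_def c_def d_def cD n_def)
  have 1: "n * c = (n - real j - 1) * d"
    using choose_minus_1_real(1)[of "card B" "j + 1"] j by (simp add: n_def c_def d_def cD algebra_simps)
  have 2: "n * b = (real j + 1) * d"
    using choose_minus_1_real(2)[of "card B" j] j by (simp add: n_def b_def d_def cD)
  have "esym B l (j + 1) = esym ?D l (j + 1) + l i * esym ?D l j" using esym_remove[OF B] by simp
  then have "esymhat B l (j + 1) * d = esymhat ?D l (j + 1) * c + l i * (esymhat ?D l j * b)"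
    using pos by (simp add: esymhat_def b_def c_def d_def)
  then have "n * esymhat B l (j + 1) * d = esymhat ?D l (j + 1) * (n * c) + l i * (esymhat ?D l j * (n * b))"
    by (metis (no_types, opaque_lifting) distrib_left mult.assoc mult.left_commute)
  also have "\<dots> = ((n - real j - 1) * esymhat ?D l (j + 1) + (real j + 1) * l i * esymhat ?D l j) * d"
    unfolding 1 2 by (simp add: algebra_simps)
  finally show ?thesis using pos by (simp add: n_def)
qed

text \<open>By Newton's inequality the quotients of consecutive normalised functions do not
  increase, and the first of them is \<open>esymhat B l 1\<close>. Equality at \<open>j\<close>
  therefore propagates down to order two. The top value may have any sign.\<close>

lemma esymhat_Suc_le:
  assumes B: "finite B" "Suc j \<le> card B" and pos: "\<And>i. i \<le> j \<Longrightarrow> esym B l i > 0"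
  shows "esymhat B l (Suc j) \<le> esymhat B l 1 * esymhat B l j"
    and "j \<ge> 1 \<Longrightarrow> esymhat B l (Suc j) = esymhat B l 1 * esymhat B l j \<Longrightarrow>
      esymhat B l 2 = (esymhat B l 1)\<^sup>2"
proof -
  have p: "esymhat B l i > 0" if "i \<le> j" for i
    using pos[OF that] that B by (simp add: esymhat_def)
  have step: "esymhat B l i * esymhat B l (Suc (Suc i)) \<le> (esymhat B l (Suc i))\<^sup>2" if "i < j" for i
    using esymhat_newton[OF B(1), of i l] that B(2) by simp
  have main: "esymhat B l (Suc i) \<le> esymhat B l 1 * esymhat B l i" if "i \<le> j" for i
    using that
  proof (induction i)
    case (Suc i)
    have "esymhat B l i * esymhat B l (Suc (Suc i)) \<le> esymhat B l (Suc i) * esymhat B l (Suc i)"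
      using step[of i] Suc.prems by (simp add: power2_eq_square)
    also have "\<dots> \<le> esymhat B l (Suc i) * (esymhat B l 1 * esymhat B l i)"
      using Suc p[of "Suc i"] by (intro mult_left_mono) auto
    finally have "esymhat B l i * esymhat B l (Suc (Suc i))
      \<le> esymhat B l i * (esymhat B l 1 * esymhat B l (Suc i))" by (simp add: algebra_simps)
    then show ?case using p[of i] Suc.prems by (simp add: mult_le_cancel_left_pos)
  qed simp
  then show "esymhat B l (Suc j) \<le> esymhat B l 1 * esymhat B l j" by blast
  have "esymhat B l 2 = (esymhat B l 1)\<^sup>2"
    if "i \<le> j" "i \<ge> 1" "esymhat B l (Suc i) = esymhat B l 1 * esymhat B l i" for i
    using that
  proof (induction i)
    case (Suc i)
    show ?case
    proof (cases "i = 0")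
      case True
      then show ?thesis using Suc.prems by (simp add: numeral_2_eq_2 power2_eq_square)
    next
      case False
      have "esymhat B l i * esymhat B l (Suc (Suc i)) \<le> esymhat B l (Suc i) * esymhat B l (Suc i)"
        using step[of i] Suc.prems by (simp add: power2_eq_square)
      then have "esymhat B l (Suc i) * (esymhat B l 1 * esymhat B l i) \<le> esymhat B l (Suc i) * esymhat B l (Suc i)"
        using Suc.prems(3) by (simp add: algebra_simps)
      then have "esymhat B l 1 * esymhat B l i \<le> esymhat B l (Suc i)"
        using p[OF Suc.prems(1)] by (simp add: mult_le_cancel_left_pos)
      then have "esymhat B l (Suc i) = esymhat B l 1 * esymhat B l i"
        using main[of i] Suc.prems by simp
      then show ?thesis using Suc False by simp
    qed
  qed simp
  then show "j \<ge> 1 \<Longrightarrow> esymhat B l (Suc j) = esymhat B l 1 * esymhat B l j \<Longrightarrow>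
      esymhat B l 2 = (esymhat B l 1)\<^sup>2" by blast
qed

text \<open>The equality says that the variance of the values vanishes.\<close>

lemma esymhat_2_eq_const:
  assumes B: "finite B" "card B \<ge> 2" and eq: "esymhat B l 2 = (esymhat B l 1)\<^sup>2" and i: "i \<in> B"
  shows "l i = esymhat B l 1"
proof -
  define N s where "N = real (card B)" and "s = (\<Sum>i\<in>B. l i)"
  have N: "N > 1" using B by (simp add: N_def)
  have 1: "esymhat B l 1 = s / N" using B by (simp add: esymhat_def esym_Suc_0 s_def N_def)
  have ch: "real (card B choose 2) = N * (N - 1) / 2"
  proof -
    have "real (card B choose 1) * (N - 1) = 2 * real (card B choose 2)"
      using choose_Suc_real[of 1 "card B"] B by (simp add: N_def numeral_2_eq_2)
    then show ?thesis using N_def by simp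
  qed
  have "(s\<^sup>2 - (\<Sum>i\<in>B. (l i)\<^sup>2)) / 2 / (N * (N - 1) / 2) = (s / N)\<^sup>2"
  proof -
    have "esym B l 2 = (s\<^sup>2 - (\<Sum>i\<in>B. (l i)\<^sup>2)) / 2" using esym_2[OF B(1), of l] by (simp add: s_def)
    then show ?thesis using eq unfolding 1 by (simp only: esymhat_def ch)
  qed
  then have "s\<^sup>2 - (\<Sum>i\<in>B. (l i)\<^sup>2) = (s / N)\<^sup>2 * (N * (N - 1))"
    using N by (simp add: field_simps)
  also have "\<dots> = s\<^sup>2 - s\<^sup>2 / N" using N by (simp add: field_simps power2_eq_square)
  finally have *: "(\<Sum>i\<in>B. (l i)\<^sup>2) = s\<^sup>2 / N" by simp
  have "(\<Sum>i\<in>B. (l i - c)\<^sup>2) = (\<Sum>i\<in>B. (l i)\<^sup>2) - 2 * c * s + N * c\<^sup>2" for c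
  proof -
    have "(\<Sum>i\<in>B. 2 * l i * c) = 2 * c * s"
      unfolding s_def sum_distrib_left by (intro sum.cong) auto
    then show ?thesis by (simp add: power2_diff sum.distrib sum_subtractf N_def)
  qed
  then have "(\<Sum>i\<in>B. (l i - s / N)\<^sup>2) = (\<Sum>i\<in>B. (l i)\<^sup>2) - 2 * (s / N) * s + N * (s / N)\<^sup>2" .
  also have "\<dots> = 0" unfolding * using N by (simp add: field_simps power2_eq_square)
  finally have "(\<Sum>i\<in>B. (l i - s / N)\<^sup>2) = 0" .
  then have "(l i - s / N)\<^sup>2 = 0" using B(1) i by (subst (asm) sum_nonneg_eq_0_iff) auto
  then show ?thesis using 1 by simp
qed

text \<open>The difference of the two sides of the key inequality is a positive combination of the
  defects in Newton's and Maclaurin's inequalities for the remaining eigenvalues.\<close>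

lemma esymhat_key_identity:
  assumes B: "finite B" "i \<in> B" and k: "1 \<le> k" "k + 2 \<le> card B"
  defines "n \<equiv> real (card B)" and "D \<equiv> B - {i}"
  shows "real k * (esymhat B l 1 * esymhat B l k - esymhat B l (k + 1)) * esymhat D l (k - 1)
      - (esymhat D l k - esymhat B l k)\<^sup>2
    = real k / n\<^sup>2 * ((n - 1) * (esymhat D l 1 * esymhat D l (k - 1) - esymhat D l k) * n * esymhat B l k
      + n * (n - real k - 1) * ((esymhat D l k)\<^sup>2 - esymhat D l (k + 1) * esymhat D l (k - 1)))"
proof -
  define X Y V m a kk where "X = esymhat D l k" and "Y = esymhat D l (k - 1)"
    and "V = esymhat D l (k + 1)" and "m = esymhat D l 1" and "a = l i" and "kk = real k"
  have n: "n > 0" using k by (simp add: n_def)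
  have 1: "n * esymhat B l 1 = (n - 1) * m + a"
    using esymhat_remove[OF B, of 0 l] k by (simp add: n_def m_def a_def D_def)
  have 2: "n * esymhat B l k = (n - kk) * X + kk * a * Y"
    using esymhat_remove[OF B, of "k - 1" l] k by (simp add: n_def X_def Y_def a_def kk_def D_def of_nat_diff)
  have 3: "n * esymhat B l (k + 1) = (n - kk - 1) * V + (kk + 1) * a * X"
    using esymhat_remove[OF B, of k l] k by (simp add: n_def V_def X_def a_def kk_def D_def)
  \<comment> \<open>Substituting the three removal recursions leaves a polynomial identity in
    \<open>X\<close>, \<open>Y\<close>, \<open>V\<close>, \<open>m\<close> and the removed
    eigenvalue \<open>a\<close>.\<close>
  have e: "esymhat B l 1 = ((n - 1) * m + a) / n" "esymhat B l k = ((n - kk) * X + kk * a * Y) / n"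
    "esymhat B l (k + 1) = ((n - kk - 1) * V + (kk + 1) * a * X) / n"
    using n 1 2 3 by (auto simp: field_simps)
  show ?thesis
    unfolding e kk_def[symmetric] X_def[symmetric] Y_def[symmetric] V_def[symmetric] m_def[symmetric]
    using n by (simp add: field_simps power2_eq_square)
qed

subsection \<open>Newton transformations\<close>

interpretation matmul: bounded_bilinear "(**) :: real^'n^'m \<Rightarrow> real^'p^'n \<Rightarrow> real^'p^'m"
proof -
  have "bilinear ((**) :: real^'n^'m \<Rightarrow> real^'p^'n \<Rightarrow> real^'p^'m)"
    unfolding bilinear_def
    by (intro conjI allI linearI)
      (simp_all add: matrix_matrix_mult_def vec_eq_iff sum.distrib sum_distrib_left algebra_simps)
  then show "bounded_bilinear ((**) :: real^'n^'m \<Rightarrow> real^'p^'n \<Rightarrow> real^'p^'m)"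
    by (simp add: bilinear_conv_bounded_bilinear)
qed

interpretation matvec: bounded_bilinear "(*v) :: real^'n^'m \<Rightarrow> real^'n \<Rightarrow> real^'m"
proof -
  have "bilinear ((*v) :: real^'n^'m \<Rightarrow> real^'n \<Rightarrow> real^'m)"
    unfolding bilinear_def
    by (intro conjI allI linearI)
      (simp_all add: matrix_vector_mult_def vec_eq_iff sum.distrib sum_distrib_left algebra_simps)
  then show "bounded_bilinear ((*v) :: real^'n^'m \<Rightarrow> real^'n \<Rightarrow> real^'m)"
    by (simp add: bilinear_conv_bounded_bilinear)
qed

lemma bounded_linear_trace: "bounded_linear (trace :: real^'n^'n \<Rightarrow> real)"
proof -
  have "linear (trace :: real^'n^'n \<Rightarrow> real)"
    by (intro linearI) (simp_all add: trace_def sum.distrib sum_distrib_left)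
  then show "bounded_linear (trace :: real^'n^'n \<Rightarrow> real)" by (simp add: linear_conv_bounded_linear)
qed

lemmas trace_diff = linear_diff[OF bounded_linear.linear[OF bounded_linear_trace]]
lemmas trace_plus = linear_add[OF bounded_linear.linear[OF bounded_linear_trace]]
lemmas trace_scaleR = linear_scale[OF bounded_linear.linear[OF bounded_linear_trace]]

lemma trace_mat: "trace (mat c :: real^'n^'n) = real CARD('n) * c"
  by (simp add: trace_def mat_def)

lemma trace_matmul: "trace (A ** B) = (\<Sum>i\<in>UNIV. \<Sum>j\<in>UNIV. A $ i $ j * B $ j $ i)"
  by (simp add: trace_def matrix_matrix_mult_def)

text \<open>This is the Newton transformation, the alternating sum of the symmetric functions of
  order \<open>k - i\<close> times the i-th powers of \<open>A\<close>. The scalar coefficient is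
  Newton's trace identity, so the recursion produces matrices and symmetric functions together
  without eigenvalues.\<close>

primrec newt :: "real^'n^'n \<Rightarrow> nat \<Rightarrow> real^'n^'n" where
  "newt A 0 = mat 1"
| "newt A (Suc k) = (trace (newt A k ** A) / real (Suc k)) *\<^sub>R mat 1 - newt A k ** A"

text \<open>An eigenvalue-free counterpart of \<open>\<sigma>\<close>: it is a polynomial in the
  entries, hence continuous and differentiable along segments of matrices. On symmetric matrices the
  two agree by \<open>sigma_eq_sg\<close>.\<close>

definition sg :: "real^'n^'n \<Rightarrow> nat \<Rightarrow> real" where
  "sg A k = (case k of 0 \<Rightarrow> 1 | Suc j \<Rightarrow> trace (newt A j ** A) / real (Suc j))"

lemma sg_0 [simp]: "sg A 0 = 1"
  by (simp add: sg_def)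

lemma sg_Suc: "sg A (Suc k) = trace (newt A k ** A) / real (Suc k)"
  by (simp add: sg_def)

lemma newt_Suc: "newt A (Suc k) = sg A (Suc k) *\<^sub>R mat 1 - newt A k ** A"
  by (simp add: sg_Suc)

lemmas newt_simps = newt.simps(1) newt_Suc

declare newt.simps(2) [simp del]

lemma trace_newt_mult: "trace (newt A k ** A) = real (Suc k) * sg A (Suc k)"
  by (simp add: sg_Suc)

lemma trace_newt: "trace (newt (A::real^'n^'n) k) = (real CARD('n) - real k) * sg A k"
proof (cases k)
  case (Suc j)
  then show ?thesis
    by (simp add: newt_Suc trace_diff trace_scaleR trace_mat trace_newt_mult algebra_simps)
qed (simp add: trace_mat)

lemma newt_commute: "newt A k ** A = A ** newt A k"
proof (induction k)
  case (Suc k)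
  have "newt A (Suc k) ** A = sg A (Suc k) *\<^sub>R A - (newt A k ** A) ** A"
    by (simp add: newt_Suc matmul.diff_left matmul.scaleR_left)
  also have "(newt A k ** A) ** A = A ** (newt A k ** A)"
    by (subst Suc) (rule matrix_mul_assoc[symmetric])
  also have "sg A (Suc k) *\<^sub>R A - A ** (newt A k ** A) = A ** newt A (Suc k)"
    by (simp add: newt_Suc matmul.diff_right matmul.scaleR_right)
  finally show ?case .
qed simp

lemma transpose_newt:
  fixes A :: "real^'n^'n"
  shows "transpose A = A \<Longrightarrow> transpose (newt A k) = newt A k"
proof (induction k)
  case (Suc k)
  have "transpose (c *\<^sub>R mat 1 - B :: real^'n^'n) = c *\<^sub>R mat 1 - transpose B" for c B
    by (simp add: vec_eq_iff transpose_def mat_def)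
  moreover have "transpose (newt A k ** A) = newt A k ** A"
    using Suc by (metis matrix_transpose_mul newt_commute)
  ultimately show ?case by (simp add: newt_Suc)
qed (simp add: transpose_mat)

lemma continuous_on_newt [continuous_intros]:
  assumes "continuous_on S f"
  shows "continuous_on S (\<lambda>x. newt (f x) k)"
proof (induction k)
  case (Suc k)
  then show ?case
    unfolding newt.simps using assms
    by (intro continuous_intros matmul.continuous_on bounded_linear.continuous_on[OF bounded_linear_trace]) auto
qed simp

lemma continuous_on_sg [continuous_intros]:
  assumes "continuous_on S f"
  shows "continuous_on S (\<lambda>x. sg (f x) k)"
proof (cases k)
  case (Suc j)
  show ?thesis unfolding Suc sg_Suc using assms
    by (intro continuous_intros matmul.continuous_on bounded_linear.continuous_on[OF bounded_linear_trace]) auto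
qed simp

section \<open>Directional derivatives of the symmetric functions\<close>

primrec mpow :: "real^'n^'n \<Rightarrow> nat \<Rightarrow> real^'n^'n" where
  "mpow A 0 = mat 1"
| "mpow A (Suc k) = mpow A k ** A"

lemma mpow_Suc2: "mpow A (Suc k) = A ** mpow A k"
proof (induction k)
  case (Suc k)
  have "mpow A (Suc (Suc k)) = (A ** mpow A k) ** A" using Suc by simp
  then show ?case by (simp add: matrix_mul_assoc)
qed simp

lemma newt_mpow: "newt A k ** mpow A m = mpow A m ** newt A k"
proof (induction m)
  case (Suc m)
  have "newt A k ** mpow A (Suc m) = mpow A m ** (newt A k ** A)"
    by (simp add: Suc matrix_mul_assoc)
  then show ?case by (simp add: newt_commute matrix_mul_assoc)
qed simp

text \<open>The derivative of \<open>newt\<close> at \<open>A\<close> in the direction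
  \<open>B\<close>: the recursion differentiated, with \<open>trace (newt A k ** B)\<close> already
  inserted as the derivative of \<open>sg A (Suc k)\<close>. The order of factors matters, as
  \<open>B\<close> need not commute with \<open>A\<close>.\<close>

primrec newt_deriv :: "real^'n^'n \<Rightarrow> real^'n^'n \<Rightarrow> nat \<Rightarrow> real^'n^'n" where
  "newt_deriv A B 0 = 0"
| "newt_deriv A B (Suc k) = trace (newt A k ** B) *\<^sub>R mat 1 - newt_deriv A B k ** A - newt A k ** B"

text \<open>The adjoint of \<open>newt_deriv\<close> in its second argument, evaluated at a power of the matrix.\<close>

primrec newt_adj :: "real^'n^'n \<Rightarrow> nat \<Rightarrow> nat \<Rightarrow> real^'n^'n" where
  "newt_adj A m 0 = 0"
| "newt_adj A m (Suc k) = trace (newt A k ** mpow A m) *\<^sub>R mat 1 - newt_adj A m k ** A - newt A k ** mpow A m"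

text \<open>This converts a higher power of \<open>A\<close> into an extra factor \<open>A\<close>
  and two explicit terms. It answers the factor \<open>A\<close> that each step of
  \<open>newt_deriv\<close> introduces.\<close>

lemma newt_adj_Suc:
  "newt_adj A (Suc m) k =
    trace (mpow A m) *\<^sub>R newt A k - trace (newt A k ** mpow A m) *\<^sub>R mat 1 + newt_adj A m k ** A"
proof (induction k)
  case (Suc k)
  have 1: "newt A k ** mpow A (Suc m) = newt A k ** mpow A m ** A" by (simp add: matrix_mul_assoc)
  have 2: "trace (newt A (Suc k) ** mpow A m) =
      sg A (Suc k) * trace (mpow A m) - trace (newt A k ** mpow A m ** A)"
  proof -
    have "newt A k ** A ** mpow A m = newt A k ** mpow A m ** A"
      by (simp flip: matrix_mul_assoc mpow_Suc2)
    then show ?thesis by (simp add: newt_Suc matmul.diff_left matmul.scaleR_left trace_diff trace_scaleR)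
  qed
  show ?case
    unfolding newt_adj.simps(2) Suc.IH 1 2
    by (simp add: newt_Suc matmul.diff_left matmul.add_left matmul.scaleR_left algebra_simps)
qed simp

lemma newt_adj_1: "newt_adj A (Suc 0) k = real k *\<^sub>R newt A k"
proof (induction k)
  case (Suc k)
  have "newt_adj A (Suc 0) (Suc k) =
      (real (Suc k) * sg A (Suc k)) *\<^sub>R mat 1 - real k *\<^sub>R (newt A k ** A) - newt A k ** A"
    by (simp add: Suc.IH matmul.scaleR_left trace_newt_mult)
  also have "\<dots> = real (Suc k) *\<^sub>R newt A (Suc k)"
    by (simp add: newt_Suc algebra_simps)
  finally show ?case .
qed simp

text \<open>A step of the recursion multiplies by \<open>A\<close> and so raises the power, which is
  why all \<open>m\<close> are treated at once. The case of the first power is the purpose: by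
  \<open>newt_adj_1\<close> the trace of \<open>newt_deriv A B k ** A\<close> is \<open>k\<close>
  times that of \<open>newt A k ** B\<close>.\<close>

lemma trace_newt_deriv: "trace (newt_deriv A B k ** mpow A m) = trace (newt_adj A m k ** B)"
proof (induction k arbitrary: m)
  case (Suc k)
  have "newt_deriv A B k ** A ** mpow A m = newt_deriv A B k ** mpow A (Suc m)"
    by (metis matrix_mul_assoc mpow_Suc2)
  then have "trace (newt_deriv A B k ** A ** mpow A m) = trace (newt_adj A (Suc m) k ** B)"
    using Suc.IH[of "Suc m"] by metis
  then have "trace (newt_deriv A B (Suc k) ** mpow A m) = trace (newt A k ** B) * trace (mpow A m)
      - trace (newt_adj A (Suc m) k ** B) - trace (newt A k ** B ** mpow A m)"
    by (simp add: matmul.diff_left matmul.scaleR_left trace_diff trace_scaleR)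
  also have "trace (newt A k ** B ** mpow A m) = trace (newt A k ** mpow A m ** B)"
    by (metis matrix_mul_assoc newt_mpow trace_mul_sym)
  also have "trace (newt A k ** B) * trace (mpow A m) - trace (newt_adj A (Suc m) k ** B)
      - trace (newt A k ** mpow A m ** B) = trace (newt_adj A m (Suc k) ** B)"
    unfolding newt_adj_Suc
    by (simp add: matmul.diff_left matmul.add_left matmul.scaleR_left trace_diff trace_plus trace_scaleR)
  finally show ?case .
qed simp

text \<open>Differentiating \<open>trace (newt A k ** A)\<close> gives one copy of
  \<open>trace (newt A k ** B)\<close> from the outer factor and \<open>k\<close> copies from
  \<open>newt_deriv\<close>, which cancels the division by \<open>k + 1\<close> in
  \<open>sg\<close>. The derivative of the next \<open>newt\<close> needs this one of
  \<open>sg\<close>, so the two claims are proved together.\<close>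

lemma newt_has_derivative:
  fixes A B :: "real^'n^'n"
  shows "((\<lambda>t. newt (A + t *\<^sub>R B) k) has_vector_derivative newt_deriv (A + s *\<^sub>R B) B k) (at s)"
    and sg_has_derivative: "((\<lambda>t. sg (A + t *\<^sub>R B) (Suc k)) has_real_derivative
      trace (newt (A + s *\<^sub>R B) k ** B)) (at s)"
proof -
  have M: "((\<lambda>t. A + t *\<^sub>R B) has_vector_derivative B) (at s)"
    by (auto intro!: derivative_eq_intros)
  have step: "((\<lambda>t. sg (A + t *\<^sub>R B) (Suc k)) has_real_derivative trace (newt (A + s *\<^sub>R B) k ** B)) (at s)"
    if "((\<lambda>t. newt (A + t *\<^sub>R B) k) has_vector_derivative newt_deriv (A + s *\<^sub>R B) B k) (at s)" for k
  proof -
    let ?M = "A + s *\<^sub>R B"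
    have "((\<lambda>t. newt (A + t *\<^sub>R B) k ** (A + t *\<^sub>R B)) has_vector_derivative
        newt ?M k ** B + newt_deriv ?M B k ** ?M) (at s)"
      using matmul.has_vector_derivative[OF that M] by simp
    then have "((\<lambda>t. trace (newt (A + t *\<^sub>R B) k ** (A + t *\<^sub>R B))) has_vector_derivative
        trace (newt ?M k ** B + newt_deriv ?M B k ** ?M)) (at s)"
      by (rule bounded_linear.has_vector_derivative[OF bounded_linear_trace])
    moreover have "trace (newt ?M k ** B + newt_deriv ?M B k ** ?M) = real (Suc k) * trace (newt ?M k ** B)"
      using trace_newt_deriv[of ?M B k "Suc 0"]
      by (simp add: trace_plus newt_adj_1 matmul.scaleR_left trace_scaleR algebra_simps)
    ultimately have "((\<lambda>t. trace (newt (A + t *\<^sub>R B) k ** (A + t *\<^sub>R B))) has_real_derivative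
        real (Suc k) * trace (newt ?M k ** B)) (at s)"
      by (simp add: has_real_derivative_iff_has_vector_derivative)
    from DERIV_cdivide[OF this, of "real (Suc k)"] show ?thesis
      by (simp add: sg_Suc del: of_nat_Suc)
  qed
  have nd: "((\<lambda>t. newt (A + t *\<^sub>R B) k) has_vector_derivative newt_deriv (A + s *\<^sub>R B) B k) (at s)" for k
  proof (induction k)
    case (Suc k)
    let ?M = "A + s *\<^sub>R B"
    have 1: "((\<lambda>t. newt (A + t *\<^sub>R B) k ** (A + t *\<^sub>R B)) has_vector_derivative
        newt ?M k ** B + newt_deriv ?M B k ** ?M) (at s)"
      using matmul.has_vector_derivative[OF Suc M] by simp
    have 2: "((\<lambda>t. sg (A + t *\<^sub>R B) (Suc k) *\<^sub>R mat 1 :: real^'n^'n) has_vector_derivative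
        trace (newt ?M k ** B) *\<^sub>R mat 1) (at s)"
      using has_vector_derivative_scaleR[OF step[OF Suc] has_vector_derivative_const[of "mat 1 :: real^'n^'n"]]
      by simp
    show ?case
      using has_vector_derivative_diff[OF 2 1] by (simp add: newt_Suc algebra_simps)
  qed simp
  show "((\<lambda>t. newt (A + t *\<^sub>R B) k) has_vector_derivative newt_deriv (A + s *\<^sub>R B) B k) (at s)"
    by (rule nd)
  show "((\<lambda>t. sg (A + t *\<^sub>R B) (Suc k)) has_real_derivative trace (newt (A + s *\<^sub>R B) k ** B)) (at s)"
    by (rule step[OF nd])
qed

subsection \<open>Orthonormal eigenbases\<close>

definition eigbasis :: "real^'n^'n \<Rightarrow> ('n \<Rightarrow> real^'n) \<Rightarrow> ('n \<Rightarrow> real) \<Rightarrow> bool" where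
  "eigbasis A q l \<longleftrightarrow> (\<forall>i j. q i \<bullet> q j = (if i = j then 1 else 0)) \<and> (\<forall>i. A *v q i = l i *\<^sub>R q i)"

lemma symmetric_inner:
  fixes A :: "real^'n^'n"
  assumes "transpose A = A"
  shows "x \<bullet> (A *v y) = (A *v x) \<bullet> y"
  by (metis assms dot_lmul_matrix vector_transpose_matrix)

text \<open>A maximiser of the Rayleigh quotient on the unit sphere of the invariant subspace is an
  eigenvector: a nonzero residual \<open>w\<close> would be a direction of first-order
  increase.\<close>

lemma symmetric_eigenvector:
  fixes A :: "real^'n^'n"
  assumes A: "transpose A = A" and S: "subspace S" and inv: "\<And>x. x \<in> S \<Longrightarrow> A *v x \<in> S"
    and y: "y \<in> S" "y \<noteq> 0"
  obtains e \<mu> where "e \<in> S" "norm e = 1" "A *v e = \<mu> *\<^sub>R e"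
proof -
  let ?K = "S \<inter> sphere 0 1"
  have K1: "compact ?K" using S closed_subspace by (intro closed_Int_compact) auto
  have K2: "?K \<noteq> {}"
  proof -
    have "inverse (norm y) *\<^sub>R y \<in> ?K" using y S by (simp add: subspace_scale)
    then show ?thesis by blast
  qed
  have "continuous_on ?K (\<lambda>x. x \<bullet> (A *v x))"
    by (intro continuous_intros matvec.continuous_on)
  from continuous_attains_sup[OF K1 K2 this]
  obtain e where e: "e \<in> ?K" "\<And>x. x \<in> ?K \<Longrightarrow> x \<bullet> (A *v x) \<le> e \<bullet> (A *v e)" by blast
  define \<mu> where "\<mu> = e \<bullet> (A *v e)"
  have le: "x \<bullet> (A *v x) \<le> \<mu> * (x \<bullet> x)" if "x \<in> S" for x
  proof (cases "x = 0")
    case False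
    have "inverse (norm x) *\<^sub>R x \<in> ?K" using False that S by (simp add: subspace_scale)
    from e(2)[OF this] have "inverse (norm x) * (inverse (norm x) * (x \<bullet> (A *v x))) \<le> \<mu>"
      by (simp add: \<mu>_def matvec.scaleR_right)
    then show ?thesis using False by (simp add: dot_square_norm field_simps power2_eq_square)
  qed simp
  have e1: "e \<in> S" "norm e = 1" using e by auto
  define w where "w = A *v e - \<mu> *\<^sub>R e"
  have wS: "w \<in> S" using e1 inv S by (simp add: w_def subspace_diff subspace_scale)
  have "w \<bullet> w \<le> 0"
  proof (rule ccontr)
    assume "\<not> ?thesis"
    then have ww: "w \<bullet> w > 0" by (simp only: not_le)
    \<comment> \<open>\<open>C\<close> dominates the second-order coefficient and is positive by the
      added one. At t = (w \<bullet> w) / C the quadratic loss is then at most half of the linear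
      gain.\<close>
    define C where "C = \<bar>\<mu> * (w \<bullet> w) - w \<bullet> (A *v w)\<bar> + 1"
    have C: "C > 0" by (simp add: C_def)
    define t where "t = (w \<bullet> w) / C"
    have t: "t > 0" using ww C by (simp add: t_def)
    have "(e + t *\<^sub>R w) \<bullet> (A *v (e + t *\<^sub>R w)) \<le> \<mu> * ((e + t *\<^sub>R w) \<bullet> (e + t *\<^sub>R w))"
      using le e1 wS S by (simp add: subspace_add subspace_scale)
    moreover have "e \<bullet> (A *v w) = w \<bullet> (A *v e)"
      using symmetric_inner[OF A, of e w] by (simp add: inner_commute)
    moreover have "e \<bullet> e = 1" using e1 by (simp add: dot_square_norm)
    ultimately have "2 * t * (w \<bullet> (A *v e)) + t\<^sup>2 * (w \<bullet> (A *v w)) \<le> 2 * t * \<mu> * (e \<bullet> w) + t\<^sup>2 * \<mu> * (w \<bullet> w)"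
      by (simp add: matvec.add_right matvec.scaleR_right inner_add_left inner_add_right \<mu>_def[symmetric]
          inner_commute power2_eq_square algebra_simps)
    moreover have "w \<bullet> (A *v e) = w \<bullet> w + \<mu> * (e \<bullet> w)"
      using inner_diff_right[of w "A *v e" "\<mu> *\<^sub>R e", folded w_def] by (simp add: inner_commute)
    then have "2 * t * (w \<bullet> (A *v e)) = 2 * t * (w \<bullet> w) + 2 * t * \<mu> * (e \<bullet> w)"
      by (simp add: distrib_left)
    ultimately have "2 * t * (w \<bullet> w) \<le> t\<^sup>2 * (\<mu> * (w \<bullet> w) - w \<bullet> (A *v w))"
      by (simp add: right_diff_distrib mult.assoc)
    also have "\<dots> \<le> t\<^sup>2 * C" by (intro mult_left_mono) (auto simp: C_def)
    also have "\<dots> = t * (w \<bullet> w)" using C by (simp add: t_def power2_eq_square)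
    finally show False using t ww by simp
  qed
  then have "w = 0" by (simp add: dot_square_norm)
  then show ?thesis using that[of e \<mu>] e1 by (simp add: w_def)
qed

text \<open>Orthonormal eigenvectors are added one at a time; by symmetry the orthogonal complement
  of those already found is invariant, so it contains a further one until the dimension is
  exhausted.\<close>

lemma symmetric_eigbasis:
  fixes A :: "real^'n^'n"
  assumes A: "transpose A = A"
  obtains q l where "eigbasis A q l"
proof -
  define good where "good B \<longleftrightarrow> finite B \<and> pairwise orthogonal B \<and>
    (\<forall>b\<in>B. norm b = 1 \<and> (\<exists>\<mu>. A *v b = \<mu> *\<^sub>R b))" for B :: "(real^'n) set"
  have "\<exists>B. good B \<and> card B = d" if "d \<le> CARD('n)" for d
    using that
  proof (induction d)
    case 0
    have "good {}" by (simp add: good_def)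
    then show ?case by (intro exI[of _ "{}"]) simp
  next
    case (Suc d)
    then obtain B where "good B" and cB: "card B = d" using Suc_leD by blast
    then have B: "finite B" "card B = d" "pairwise orthogonal B"
      "\<forall>b\<in>B. norm b = 1 \<and> (\<exists>\<mu>. A *v b = \<mu> *\<^sub>R b)"
      unfolding good_def using cB by blast+
    define S where "S = {x. \<forall>b\<in>B. b \<bullet> x = 0}"
    have S: "subspace S" by (auto simp: S_def subspace_def inner_add_right)
    have inv: "A *v x \<in> S" if "x \<in> S" for x
    proof -
      have "b \<bullet> (A *v x) = 0" if "b \<in> B" for b
      proof -
        have "\<exists>\<mu>. A *v b = \<mu> *\<^sub>R b" using bspec[OF B(4) that] by (rule conjunct2)
        then obtain \<mu> where "A *v b = \<mu> *\<^sub>R b" ..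
        then have "b \<bullet> (A *v x) = \<mu> * (b \<bullet> x)" by (simp only: symmetric_inner[OF A] inner_scaleR_left)
        moreover have "b \<bullet> x = 0" using \<open>x \<in> S\<close> that by (simp add: S_def)
        ultimately show ?thesis by simp
      qed
      then show ?thesis by (simp add: S_def)
    qed
    have "dim B \<le> d" using dim_le_card'[OF B(1)] B(2) by simp
    then have "dim B < DIM(real^'n)" using Suc.prems by simp
    then obtain y where "y \<noteq> 0" "\<And>x. x \<in> span B \<Longrightarrow> orthogonal y x"
      using orthogonal_to_subspace_exists[of B] by blast
    then have "y \<in> S" by (auto simp: S_def orthogonal_def inner_commute span_base)
    then obtain e \<mu> where e: "e \<in> S" "norm e = 1" "A *v e = \<mu> *\<^sub>R e"
      using symmetric_eigenvector[OF A S inv _ \<open>y \<noteq> 0\<close>] by blast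
    have "e \<notin> B" using e by (auto simp: S_def dot_square_norm)
    moreover have "pairwise orthogonal (insert e B)"
      using B(3) e(1) by (auto simp: pairwise_insert orthogonal_def S_def inner_commute)
    moreover have "norm b = 1 \<and> (\<exists>\<mu>. A *v b = \<mu> *\<^sub>R b)" if "b \<in> insert e B" for b
    proof (cases "b = e")
      case True
      show ?thesis unfolding True by (intro conjI exI) (rule e)+
    next
      case False
      then have "b \<in> B" using that by simp
      then show ?thesis by (rule bspec[OF B(4)])
    qed
    ultimately have "good (insert e B)" unfolding good_def
      by (metis (no_types) B(1) finite.insertI)
    then show ?case using \<open>e \<notin> B\<close> B(1,2) by (intro exI[of _ "insert e B"]) simp
  qed
  from this[of "CARD('n)"] obtain B where "good B" and cB: "card B = CARD('n)" by blast
  then have B: "finite B" "card B = CARD('n)" "pairwise orthogonal B"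
      "\<forall>b\<in>B. norm b = 1 \<and> (\<exists>\<mu>. A *v b = \<mu> *\<^sub>R b)"
    unfolding good_def using cB by blast+
  then obtain q where q: "bij_betw q (UNIV :: 'n set) B"
    using finite_same_card_bij[of "UNIV :: 'n set" B] by auto
  have qB: "q i \<in> B" for i using q by (auto simp: bij_betw_def)
  have inj: "q i = q j \<longleftrightarrow> i = j" for i j using q by (auto simp: bij_betw_def inj_on_def)
  have "\<forall>i. \<exists>\<mu>. A *v q i = \<mu> *\<^sub>R q i" using B(4) qB by (intro allI conjunct2[OF bspec[OF B(4)]])
  then obtain l where "A *v q i = l i *\<^sub>R q i" for i by metis
  moreover have "q i \<bullet> q j = (if i = j then 1 else 0)" for i j
    using B(3,4) qB inj by (auto simp: pairwise_def orthogonal_def dot_square_norm)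
  ultimately show ?thesis using that[of q l] by (simp add: eigbasis_def)
qed

context
  fixes A :: "real^'n^'n" and q l
  assumes eb: "eigbasis A q l"
begin

lemma eb_inner: "q i \<bullet> q j = (if i = j then 1 else 0)"
  and eb_eigen: "A *v q i = l i *\<^sub>R q i"
  using eb by (auto simp: eigbasis_def)

lemma eb_inj: "inj q"
  by (rule injI) (metis eb_inner zero_neq_one)

lemma eb_expand: "(\<Sum>i\<in>UNIV. (q i \<bullet> x) *\<^sub>R q i) = x"
proof -
  have n1: "norm (q i) = 1" for i by (simp add: norm_eq_sqrt_inner eb_inner)
  have po: "pairwise orthogonal (range q)"
    by (auto simp: pairwise_def orthogonal_def eb_inner)
  moreover have "0 \<notin> range q" using n1 by (metis imageE norm_zero zero_neq_one)
  ultimately have "independent (range q)" by (rule pairwise_orthogonal_independent)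
  moreover have "card (range q) = CARD('n)" by (simp add: card_image eb_inj)
  ultimately have "span (range q) = UNIV"
    using card_ge_dim_independent[of "range q" UNIV] by auto
  then have "(\<Sum>b\<in>range q. (x \<bullet> b) *\<^sub>R b) = x"
    using n1 by (intro orthonormal_basis_expand[OF po]) auto
  then show ?thesis by (simp add: sum.reindex eb_inj o_def inner_commute)
qed

lemma eb_inner_expand: "x \<bullet> y = (\<Sum>i\<in>UNIV. (q i \<bullet> x) * (q i \<bullet> y))"
  by (subst (1) eb_expand[of x, symmetric]) (simp add: inner_sum_left)

lemma eb_trace: "trace M = (\<Sum>i\<in>UNIV. q i \<bullet> (M *v q i))"
proof -
  have d: "(\<Sum>i\<in>UNIV. q i $ a * q i $ b) = (if a = b then 1 else 0)" for a b
    using eb_inner_expand[of "axis a 1" "axis b 1"] by (simp add: inner_axis) (auto simp: axis_def)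
  have "(\<Sum>i\<in>UNIV. q i \<bullet> (M *v q i)) = (\<Sum>i\<in>UNIV. \<Sum>a\<in>UNIV. \<Sum>b\<in>UNIV. M $ a $ b * (q i $ a * q i $ b))"
    by (simp add: inner_vec_def matrix_vector_mult_def sum_distrib_left algebra_simps)
  also have "\<dots> = (\<Sum>a\<in>UNIV. \<Sum>b\<in>UNIV. \<Sum>i\<in>UNIV. M $ a $ b * (q i $ a * q i $ b))"
    by (subst sum.swap, rule sum.cong[OF refl], subst sum.swap, rule refl)
  also have "\<dots> = trace M"
    by (simp add: d trace_def if_distrib[of "\<lambda>c. _ * c"] flip: sum_distrib_left cong: if_cong)
  finally show ?thesis by simp
qed

end

lemma esym_sum:
  assumes "finite B"
  shows "(\<Sum>i\<in>B. l i * esym (B - {i}) l k) = real (Suc k) * esym B l (Suc k)"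
  using assms
proof (induction B arbitrary: k rule: finite_induct)
  case empty
  then show ?case by (simp add: esym_empty)
next
  case (insert a B)
  have rem: "insert a B - {i} = insert a (B - {i})" if "i \<in> B" for i using that insert.hyps by auto
  have "(\<Sum>i\<in>insert a B. l i * esym (insert a B - {i}) l k) =
      l a * esym B l k + (\<Sum>i\<in>B. l i * esym (insert a (B - {i})) l k)"
    using insert.hyps by (simp add: rem cong: sum.cong)
  also have "\<dots> = real (Suc k) * esym (insert a B) l (Suc k)"
  proof (cases k)
    case 0
    then show ?thesis using insert.hyps by (simp add: esym_Suc_0 esym_insert)
  next
    case (Suc m)
    have "(\<Sum>i\<in>B. l i * esym (insert a (B - {i})) l k) =
        (\<Sum>i\<in>B. l i * esym (B - {i}) l k + l a * (l i * esym (B - {i}) l m))"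
      using insert.hyps by (intro sum.cong) (auto simp: Suc esym_insert algebra_simps)
    also have "\<dots> = real (Suc k) * esym B l (Suc k) + l a * (real k * esym B l k)"
      using Suc by (simp only: sum.distrib insert.IH flip: sum_distrib_left)
    finally show ?thesis using insert.hyps by (simp add: esym_insert algebra_simps)
  qed
  finally show ?case .
qed

text \<open>The eigenvalue of \<open>newt A k\<close> on \<open>q i\<close> is the symmetric
  function of the other eigenvalues, because the recursion of \<open>newt\<close> on
  \<open>q i\<close> is \<open>esym_remove\<close> solved for the smaller set.\<close>

lemma eb_newt:
  fixes A :: "real^'n^'n"
  assumes eb: "eigbasis A q l"
  shows "newt A k *v q i = esym (UNIV - {i}) l k *\<^sub>R q i"
    and eb_sg: "sg A k = esym UNIV l k"
proof -
  have step: "sg A (Suc k) = esym UNIV l (Suc k)"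
    if "\<And>i. newt A k *v q i = esym (UNIV - {i}) l k *\<^sub>R q i" for k
  proof -
    have "trace (newt A k ** A) = (\<Sum>i\<in>UNIV. q i \<bullet> (newt A k *v (A *v q i)))"
      by (simp add: eb_trace[OF eb] matrix_vector_mul_assoc)
    also have "\<dots> = (\<Sum>i\<in>UNIV. l i * esym (UNIV - {i}) l k)"
      by (simp add: eb_eigen[OF eb] matvec.scaleR_right that eb_inner[OF eb])
    also have "\<dots> = real (Suc k) * esym UNIV l (Suc k)" by (rule esym_sum) simp
    finally show ?thesis by (simp add: sg_Suc del: of_nat_Suc)
  qed
  have main: "newt A k *v q i = esym (UNIV - {i}) l k *\<^sub>R q i" for k i
  proof (induction k arbitrary: i)
    case (Suc k)
    have "newt A (Suc k) *v q i = sg A (Suc k) *\<^sub>R q i - newt A k *v (A *v q i)"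
      by (simp add: newt_Suc matvec.diff_left matvec.scaleR_left matrix_vector_mul_assoc)
    also have "\<dots> = (esym UNIV l (Suc k) - l i * esym (UNIV - {i}) l k) *\<^sub>R q i"
      by (simp add: step[OF Suc] eb_eigen[OF eb] matvec.scaleR_right Suc scaleR_diff_left)
    also have "esym UNIV l (Suc k) - l i * esym (UNIV - {i}) l k = esym (UNIV - {i}) l (Suc k)"
      using esym_remove[of UNIV i l k] by simp
    finally show ?case .
  qed simp
  then show "newt A k *v q i = esym (UNIV - {i}) l k *\<^sub>R q i" .
  show "sg A k = esym UNIV l k"
    using step main by (cases k) auto
qed

lemma eb_newt_inner:
  fixes A :: "real^'n^'n"
  assumes eb: "eigbasis A q l"
  shows "x \<bullet> (newt A k *v y) = (\<Sum>i\<in>UNIV. esym (UNIV - {i}) l k * (q i \<bullet> x) * (q i \<bullet> y))"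
proof -
  have "newt A k *v y = newt A k *v (\<Sum>i\<in>UNIV. (q i \<bullet> y) *\<^sub>R q i)"
    by (simp add: eb_expand[OF eb])
  also have "\<dots> = (\<Sum>i\<in>UNIV. (esym (UNIV - {i}) l k * (q i \<bullet> y)) *\<^sub>R q i)"
    by (simp add: matvec.sum_right matvec.scaleR_right eb_newt[OF eb] mult.commute)
  finally show ?thesis by (simp add: inner_sum_right inner_commute mult_ac)
qed

subsection \<open>Agreement with the definition through the characteristic polynomial\<close>

text \<open>Comparing values at each real \<open>x\<close> replaces a determinant of polynomials by
  a real one, in which the matrix \<open>?Q\<close> with orthonormal columns diagonalises
  \<open>?M\<close>.\<close>

lemma charpoly_eb:
  fixes A :: "real^'n^'n"
  assumes eb: "eigbasis A q l"
  shows "charpoly A = (\<Prod>i\<in>UNIV. [:- l i, 1:])"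
proof (rule poly_eq_poly_eq_iff[THEN iffD1], rule ext)
  fix x
  let ?M = "\<chi> i j. (if i = j then x else 0) - A $ i $ j"
  let ?Q = "\<chi> a i. q i $ a"
  let ?D = "\<chi> i j. if i = j then x - l i else 0"
  have "poly (charpoly A) x = det ?M"
    unfolding charpoly_def det_def
    by (simp add: poly_sum poly_prod poly_of_int if_distribR if_distrib[of "\<lambda>p. poly p x"] cong: if_cong)
  moreover have "det ?M = (\<Prod>i\<in>UNIV. x - l i)"
  proof -
    have "?M ** ?Q = ?Q ** ?D"
    proof -
      have "(?M ** ?Q) $ a $ i = (?Q ** ?D) $ a $ i" for a i
      proof -
        have "(\<Sum>b\<in>UNIV. A $ a $ b * q i $ b) = l i * q i $ a"
          using arg_cong[OF eb_eigen[OF eb, of i], of "\<lambda>v. v $ a"] by (simp add: matrix_vector_mult_def)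
        then show ?thesis
          by (simp add: matrix_matrix_mult_def left_diff_distrib sum_subtractf if_distrib[of "\<lambda>c. c * _"]
              if_distrib[of "\<lambda>c. _ * c"] cong: if_cong) (simp add: algebra_simps)
      qed
      then show ?thesis by (simp add: vec_eq_iff)
    qed
    then have "det (?M ** ?Q) = det (?Q ** ?D)" by (rule arg_cong)
    then have "det ?M * det ?Q = det ?Q * det ?D" by (simp only: det_mul)
    moreover have "det ?D = (\<Prod>i\<in>UNIV. x - l i)"
      by (subst det_diagonal) auto
    moreover have "transpose ?Q ** ?Q = mat 1"
      using eb_inner[OF eb]
      by (simp add: vec_eq_iff matrix_matrix_mult_def transpose_def mat_def inner_vec_def)
    then have "det (transpose ?Q ** ?Q) = 1" by simp
    then have "det (transpose ?Q) * det ?Q = 1" by (simp only: det_mul)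
    then have "det ?Q \<noteq> 0" by auto
    ultimately show ?thesis by simp
  qed
  ultimately show "poly (charpoly A) x = poly (\<Prod>i\<in>UNIV. [:- l i, 1:]) x"
    by (simp add: poly_prod)
qed

lemma esym_subsets:
  assumes "finite B"
  shows "esym B l j = (\<Sum>I | I \<subseteq> B \<and> card I = j. \<Prod>i\<in>I. l i)"
proof -
  have m: "(\<Prod>i\<in>I. monom (l i) 1) = monom (\<Prod>i\<in>I. l i) (card I)" if "finite I" for I
    using that by (induction I rule: finite_induct) (auto simp: mult_monom)
  have "(\<Prod>i\<in>B. [:1, l i:]) = (\<Prod>i\<in>B. monom (l i) 1 + 1)"
    by (intro prod.cong) (auto simp: monom_Suc one_pCons monom_0)
  also have "\<dots> = (\<Sum>I\<in>Pow B. (\<Prod>i\<in>I. monom (l i) 1))"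
    using assms by (subst prod_add) auto
  also have "\<dots> = (\<Sum>I\<in>Pow B. monom (\<Prod>i\<in>I. l i) (card I))"
    using assms by (intro sum.cong refl m) (auto intro: finite_subset)
  finally have "esym B l j = (\<Sum>I\<in>Pow B. if card I = j then \<Prod>i\<in>I. l i else 0)"
    by (simp add: esym_def coeff_sum)
  also have "\<dots> = (\<Sum>I | I \<in> Pow B \<and> card I = j. \<Prod>i\<in>I. l i)"
    using assms by (intro sum.inter_filter[symmetric]) auto
  finally show ?thesis by simp
qed

text \<open>The sorted list of eigenvalues and the family \<open>l\<close> attached to an eigenbasis
  form the same multiset, and the product behind \<open>esym\<close> depends on nothing
  else.\<close>

lemma sigma_eq_sg:
  fixes A :: "real^'n^'n"
  assumes "transpose A = A"
  shows "\<sigma> j A = sg A j"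
proof -
  obtain q l where eb: "eigbasis A q l" using symmetric_eigbasis[OF assms] .
  define xs where "xs = eigenvals A"
  have "mset xs = proots (charpoly A)" by (simp add: xs_def eigenvals_def)
  also have "\<dots> = (\<Sum>i\<in>UNIV. proots [:- l i, 1:])"
    unfolding charpoly_eb[OF eb] by (rule proots_prod) auto
  also have "\<dots> = (\<Sum>i\<in>UNIV. {#l i#})" by simp
  also have "\<dots> = image_mset l (mset_set UNIV)"
    by (simp add: sum_unfold_sum_mset)
  finally have xs: "mset xs = image_mset l (mset_set UNIV)" .
  have "(\<Prod>i<length xs. [:1, xs ! i:]) = prod_list (map (\<lambda>x. [:1, x:]) xs)"
    by (simp add: prod.list_conv_set_nth atLeast0LessThan)
  also have "\<dots> = prod_mset (image_mset (\<lambda>x. [:1, x:]) (mset xs))"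
    by (simp add: prod_mset_prod_list[symmetric])
  also have "\<dots> = (\<Prod>i\<in>UNIV. [:1, l i:])"
    by (simp add: xs image_mset.compositionality o_def prod_unfold_prod_mset)
  finally have "esym {..<length xs} ((!) xs) j = esym UNIV l j" by (simp add: esym_def)
  then show ?thesis
    by (simp add: \<sigma>_def elem_sym_def esym_subsets eb_sg[OF eb] flip: xs_def)
qed

subsection \<open>Pointwise inequalities on the cone\<close>

definition cone :: "nat \<Rightarrow> (real^'n^'n) set" where
  "cone k = {A. transpose A = A \<and> (\<forall>j\<le>k. sg A j > 0)}"

text \<open>For a positive solution the equation supplies the strict sign at order \<open>k\<close>,
  and this moves a matrix from the closed cone into the open one.\<close>

lemma coneI:
  fixes A :: "real^'n^'n"
  assumes A: "transpose A = A" and nn: "\<And>j. 1 \<le> j \<Longrightarrow> j \<le> k \<Longrightarrow> sg A j \<ge> 0" and pos: "sg A k > 0"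
  shows "A \<in> cone k"
proof -
  obtain q l where eb: "eigbasis A q l" using symmetric_eigbasis[OF A] .
  have "sg A j > 0" if "j \<le> k" for j
    using esym_pos[of UNIV k l j] nn pos that by (simp add: eb_sg[OF eb])
  then show ?thesis using A by (simp add: cone_def)
qed

lemma cone_esym_pos:
  fixes A :: "real^'n^'n"
  assumes "A \<in> cone k" "eigbasis A q l" "j < k"
  shows "esym (UNIV - {i}) l j > 0"
  using assms by (intro esym_remove_pos[of UNIV i k]) (auto simp: cone_def eb_sg)

lemma cone_newt_nonneg:
  assumes "A \<in> cone k" "j < k"
  shows "x \<bullet> (newt A j *v x) \<ge> 0"
proof -
  obtain q l where eb: "eigbasis A q l" using symmetric_eigbasis[of A] assms(1) by (auto simp: cone_def)
  show ?thesis unfolding eb_newt_inner[OF eb]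
    by (intro sum_nonneg) (simp add: mult.assoc cone_esym_pos[OF assms(1) eb assms(2)] less_imp_le)
qed

lemma cone_newt_cauchy_schwarz:
  assumes "A \<in> cone k" "j < k"
  shows "(x \<bullet> (newt A j *v y))\<^sup>2 \<le> (x \<bullet> (newt A j *v x)) * (y \<bullet> (newt A j *v y))"
proof -
  obtain q l where eb: "eigbasis A q l" using symmetric_eigbasis[of A] assms(1) by (auto simp: cone_def)
  let ?s = "\<lambda>i. esym (UNIV - {i}) l j"
  have s: "?s i \<ge> 0" for i using cone_esym_pos[OF assms(1) eb assms(2)] by (rule less_imp_le)
  have "(\<Sum>i\<in>UNIV. ?s i * (q i \<bullet> x) * (q i \<bullet> y)) =
      (\<Sum>i\<in>UNIV. (sqrt (?s i) * (q i \<bullet> x)) * (sqrt (?s i) * (q i \<bullet> y)))"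
  proof (intro sum.cong refl)
    fix i
    have "(c * a) * (c * b) = (c * c) * a * b" for a b c :: real by simp
    then show "?s i * (q i \<bullet> x) * (q i \<bullet> y) = (sqrt (?s i) * (q i \<bullet> x)) * (sqrt (?s i) * (q i \<bullet> y))"
      using s[of i] by simp
  qed
  also have "\<dots>\<^sup>2 \<le> (\<Sum>i\<in>UNIV. (sqrt (?s i) * (q i \<bullet> x))\<^sup>2) * (\<Sum>i\<in>UNIV. (sqrt (?s i) * (q i \<bullet> y))\<^sup>2)"
    by (rule Cauchy_Schwarz_ineq_sum)
  finally show ?thesis
    unfolding eb_newt_inner[OF eb] using s by (simp add: power_mult_distrib power2_eq_square mult_ac)
qed

lemma cone_newt_le:
  fixes A :: "real^'n^'n"
  assumes "A \<in> cone k" "j < k"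
  shows "x \<bullet> (newt A j *v x) \<le> (real CARD('n) - real j) * sg A j * (x \<bullet> x)"
proof -
  obtain q l where eb: "eigbasis A q l" using symmetric_eigbasis[of A] assms(1) by (auto simp: cone_def)
  let ?s = "\<lambda>i. esym (UNIV - {i}) l j"
  have s: "?s i \<ge> 0" for i using cone_esym_pos[OF assms(1) eb assms(2)] by (rule less_imp_le)
  have tr: "(real CARD('n) - real j) * sg A j = (\<Sum>i\<in>UNIV. ?s i)"
    using trace_newt[of A j] by (simp add: eb_trace[OF eb] eb_newt[OF eb] eb_inner[OF eb])
  have le: "?s i \<le> (\<Sum>i\<in>UNIV. ?s i)" for i
    using s by (intro member_le_sum) auto
  have "x \<bullet> (newt A j *v x) = (\<Sum>i\<in>UNIV. ?s i * ((q i \<bullet> x) * (q i \<bullet> x)))"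
    unfolding eb_newt_inner[OF eb] by (simp add: mult.assoc)
  also have "\<dots> \<le> (\<Sum>i\<in>UNIV. (\<Sum>i\<in>UNIV. ?s i) * ((q i \<bullet> x) * (q i \<bullet> x)))"
    by (intro sum_mono mult_right_mono le) auto
  also have "\<dots> = (\<Sum>i\<in>UNIV. ?s i) * (x \<bullet> x)"
    by (simp add: eb_inner_expand[OF eb, of x x] sum_distrib_left)
  finally show ?thesis by (simp add: tr)
qed

section \<open>The defect and the flux at a single point\<close>

definition sgh :: "real^'n^'n \<Rightarrow> nat \<Rightarrow> real" where
  "sgh A j = sg A j / real (CARD('n) choose j)"

text \<open>The binomial has \<open>n - 1\<close> on top because the eigenvalues of this matrix are
  the values \<open>esymhat\<close> of the \<open>n - 1\<close> other eigenvalues of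
  \<open>A\<close>.\<close>

definition newth :: "real^'n^'n \<Rightarrow> nat \<Rightarrow> real^'n^'n" where
  "newth A j = (1 / real (CARD('n) - 1 choose j)) *\<^sub>R newt A j"

text \<open>For a solution \<open>u\<close>, with \<open>A = -D\<^sup>2u\<close>, \<open>g = Du\<close> and \<open>\<theta> = \<kappa> / u\<close>, the divergence of
  \<open>u\<^sup>-\<^sup>\<kappa> flux\<close> is \<open>u\<^sup>-\<^sup>\<kappa> defect\<close>.\<close>

definition defect :: "nat \<Rightarrow> real^'n^'n \<Rightarrow> real^'n \<Rightarrow> real \<Rightarrow> real" where
  "defect k A g \<theta> = real CARD('n) * (sgh A 1 * sgh A k - sgh A (k + 1))
    - real CARD('n) * \<theta> / real k * (g \<bullet> (newth A k *v g) - sgh A k * (g \<bullet> g))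
    + real CARD('n) * \<theta>\<^sup>2 / (4 * real k) * (g \<bullet> g) * (g \<bullet> (newth A (k - 1) *v g))"

definition flux :: "nat \<Rightarrow> real^'n^'n \<Rightarrow> real^'n \<Rightarrow> real \<Rightarrow> real^'n" where
  "flux k A g \<theta> = newth A k *v g - sgh A k *\<^sub>R g - (\<theta> / 2 * (g \<bullet> g)) *\<^sub>R (newth A (k - 1) *v g)"

lemma eb_newth_inner:
  fixes A :: "real^'n^'n"
  assumes eb: "eigbasis A q l"
  shows "x \<bullet> (newth A k *v y) = (\<Sum>i\<in>UNIV. esymhat (UNIV - {i}) l k * (q i \<bullet> x) * (q i \<bullet> y))"
  by (simp add: newth_def matvec.scaleR_left eb_newt_inner[OF eb] esymhat_def sum_divide_distrib)

lemma eb_sgh: "eigbasis (A::real^'n^'n) q l \<Longrightarrow> sgh A k = esymhat UNIV l k"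
  by (simp add: sgh_def esymhat_def eb_sg)

text \<open>A diagonalising basis is fixed so that \<open>defect\<close> and \<open>flux\<close>
  become sums over eigendirections. The bound \<open>k + 2 \<le> CARD('n)\<close> leaves
  \<open>k + 1\<close> eigenvalues after one is removed, as Newton's inequality at the orders
  \<open>k - 1\<close>, \<open>k\<close>, \<open>k + 1\<close> requires.\<close>

locale cone_point =
  fixes A :: "real^'n^'n" and k :: nat and q :: "'n \<Rightarrow> real^'n" and l :: "'n \<Rightarrow> real"
  assumes A: "A \<in> cone k" and k: "k \<ge> 2" "k + 2 \<le> CARD('n)" and eb: "eigbasis A q l"
begin

definition X where "X i = esymhat (UNIV - {i}) l k"
definition Y where "Y i = esymhat (UNIV - {i}) l (k - 1)"
definition S where "S = real CARD('n) * (sgh A 1 * sgh A k - sgh A (k + 1))"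
text \<open>The part of the i-th summand of \<open>defect_expand\<close>, before division by
  \<open>Y i\<close>, that remains once its square has been completed.\<close>

definition slack where "slack i = S * Y i - real CARD('n) / real k * (X i - sgh A k)\<^sup>2"

lemma Y_pos: "Y i > 0"
  using cone_esym_pos[OF A eb, of "k - 1" i] k by (simp add: Y_def esymhat_def)

lemma sgh_pos: "sgh A k > 0"
  using A k by (simp add: cone_def sgh_def)

lemma slack_eq:
  "slack i = (real CARD('n) - 1) * (esymhat (UNIV - {i}) l 1 * Y i - X i) * sgh A k
    + (real CARD('n) - real k - 1) * ((X i)\<^sup>2 - esymhat (UNIV - {i}) l (k + 1) * Y i)"
proof -
  define n where "n = real CARD('n)"
  have n: "n > 0" by (simp add: n_def)
  have "real k * (S / n) * Y i - (X i - sgh A k)\<^sup>2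
    = real k / n\<^sup>2 * ((n - 1) * (esymhat (UNIV - {i}) l 1 * Y i - X i) * n * sgh A k
      + n * (n - real k - 1) * ((X i)\<^sup>2 - esymhat (UNIV - {i}) l (k + 1) * Y i))"
    using esymhat_key_identity[of "UNIV :: 'n set" i k l] k n
    by (simp add: eb_sgh[OF eb] S_def X_def Y_def n_def)
  then have "n / real k * (real k * (S / n) * Y i - (X i - sgh A k)\<^sup>2)
    = n / real k * (real k / n\<^sup>2 * ((n - 1) * (esymhat (UNIV - {i}) l 1 * Y i - X i) * n * sgh A k
      + n * (n - real k - 1) * ((X i)\<^sup>2 - esymhat (UNIV - {i}) l (k + 1) * Y i)))" by simp
  moreover have "n / real k * (real k * (S / n) * Y i - (X i - sgh A k)\<^sup>2) = slack i"
    using n k by (simp add: slack_def n_def[symmetric] right_diff_distrib)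
  moreover have "n / real k * (real k / n\<^sup>2 * (a * n * b + n * c * d)) = a * b + c * d" for a b c d
    using n k by (simp add: power2_eq_square field_simps)
  ultimately show ?thesis by (simp add: n_def[symmetric])
qed

lemma maclaurin: "X i \<le> esymhat (UNIV - {i}) l 1 * Y i"
  using esymhat_Suc_le(1)[of "UNIV - {i}" "k - 1" l] cone_esym_pos[OF A eb] k
  by (simp add: X_def Y_def)

lemma newton: "esymhat (UNIV - {i}) l (k + 1) * Y i \<le> (X i)\<^sup>2"
  using esymhat_newton[of "UNIV - {i}" "k - 1" l] k
  by (simp add: X_def Y_def mult.commute)

lemma slack_nonneg: "slack i \<ge> 0"
  unfolding slack_eq using maclaurin[of i] newton[of i] sgh_pos k
  by (intro add_nonneg_nonneg mult_nonneg_nonneg) (auto simp: less_imp_le)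

lemma S_nonneg: "S \<ge> 0"
proof -
  have "S * Y i \<ge> 0" for i
  proof -
    have "0 \<le> real CARD('n) / real k * (X i - sgh A k)\<^sup>2" by simp
    then show ?thesis using slack_nonneg[of i] unfolding slack_def by linarith
  qed
  then show ?thesis using Y_pos by (simp add: zero_le_mult_iff) (meson linorder_not_less)
qed

text \<open>Both terms of \<open>slack_eq\<close> are nonnegative, so the Maclaurin term vanishes.
  That is an equality at order \<open>k\<close>, and \<open>k \<ge> 2\<close> lets it descend to
  order two, where it means that the other eigenvalues coincide.\<close>

lemma slack_eq_0_const:
  assumes "slack i = 0" "j \<noteq> i"
  shows "l j = esymhat (UNIV - {i}) l 1"
proof -
  have "(real CARD('n) - 1) * (esymhat (UNIV - {i}) l 1 * Y i - X i) * sgh A k \<ge> 0"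
    using maclaurin[of i] sgh_pos k by (intro mult_nonneg_nonneg) (auto simp: less_imp_le)
  moreover have "(real CARD('n) - real k - 1) * ((X i)\<^sup>2 - esymhat (UNIV - {i}) l (k + 1) * Y i) \<ge> 0"
    using newton[of i] k by (intro mult_nonneg_nonneg) auto
  ultimately have "(real CARD('n) - 1) * (esymhat (UNIV - {i}) l 1 * Y i - X i) * sgh A k = 0"
    using assms(1) unfolding slack_eq by linarith
  then have "esymhat (UNIV - {i}) l (Suc (k - 1)) = esymhat (UNIV - {i}) l 1 * esymhat (UNIV - {i}) l (k - 1)"
    using sgh_pos k by (simp add: X_def Y_def)
  then have "esymhat (UNIV - {i}) l 2 = (esymhat (UNIV - {i}) l 1)\<^sup>2"
    using cone_esym_pos[OF A eb] k by (intro esymhat_Suc_le(2)[of _ "k - 1"]) auto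
  then show ?thesis using assms(2) k by (intro esymhat_2_eq_const) auto
qed

text \<open>The factor \<open>g \<bullet> g\<close> is the sum of the squares
  \<open>(q i \<bullet> g)\<^sup>2\<close>, so it distributes the term \<open>S\<close> over the
  eigendirections. Each summand is then quadratic in \<theta>, and completing the square leaves
  \<open>slack i\<close>.\<close>

lemma defect_expand:
  "(g \<bullet> g) * defect k A g \<theta> = (\<Sum>i\<in>UNIV. (q i \<bullet> g)\<^sup>2 *
    ((slack i + real CARD('n) / real k * (X i - sgh A k - \<theta> / 2 * (g \<bullet> g) * Y i)\<^sup>2) / Y i))"
proof -
  define n G where "n = real CARD('n)" and "G = g \<bullet> g"
  have G: "G = (\<Sum>i\<in>UNIV. (q i \<bullet> g)\<^sup>2)"
    unfolding G_def eb_inner_expand[OF eb, of g g] by (simp add: power2_eq_square)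
  have 1: "g \<bullet> (newth A k *v g) = (\<Sum>i\<in>UNIV. (q i \<bullet> g)\<^sup>2 * X i)"
    unfolding eb_newth_inner[OF eb] X_def by (simp add: power2_eq_square mult_ac)
  have 2: "g \<bullet> (newth A (k - 1) *v g) = (\<Sum>i\<in>UNIV. (q i \<bullet> g)\<^sup>2 * Y i)"
    unfolding eb_newth_inner[OF eb] Y_def by (simp add: power2_eq_square mult_ac)
  have summand: "(slack i + n / real k * (X i - sgh A k - \<theta> / 2 * G * Y i)\<^sup>2) / Y i =
      S - n * \<theta> / real k * G * (X i - sgh A k) + n * \<theta>\<^sup>2 / (4 * real k) * G\<^sup>2 * Y i" for i
    using Y_pos[of i] k unfolding slack_def n_def[symmetric]
    by (simp add: field_simps power2_eq_square)
  have "(\<Sum>i\<in>UNIV. (q i \<bullet> g)\<^sup>2 * ((slack i + n / real k * (X i - sgh A k - \<theta> / 2 * G * Y i)\<^sup>2) / Y i))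
    = (\<Sum>i\<in>UNIV. S * (q i \<bullet> g)\<^sup>2 - n * \<theta> / real k * G * ((q i \<bullet> g)\<^sup>2 * X i)
        + n * \<theta> / real k * G * sgh A k * (q i \<bullet> g)\<^sup>2
        + n * \<theta>\<^sup>2 / (4 * real k) * G\<^sup>2 * ((q i \<bullet> g)\<^sup>2 * Y i))"
    unfolding summand by (intro sum.cong refl) (simp add: algebra_simps diff_divide_distrib)
  also have "\<dots> = S * G - n * \<theta> / real k * G * (g \<bullet> (newth A k *v g))
        + n * \<theta> / real k * G * sgh A k * G + n * \<theta>\<^sup>2 / (4 * real k) * G\<^sup>2 * (g \<bullet> (newth A (k - 1) *v g))"
    unfolding 1 2 sum.distrib sum_subtractf by (simp only: sum_distrib_left[symmetric] G[symmetric])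
  also have "\<dots> = G * defect k A g \<theta>"
    unfolding defect_def S_def n_def[symmetric] G_def[symmetric] by (simp add: algebra_simps power2_eq_square)
  finally show ?thesis by (simp add: G_def n_def)
qed

lemma defect_nonneg: "defect k A g \<theta> \<ge> 0"
proof (cases "g = 0")
  case True
  then show ?thesis using S_nonneg by (simp add: defect_def S_def)
next
  case False
  have "(g \<bullet> g) * defect k A g \<theta> \<ge> 0"
    unfolding defect_expand
  proof (intro sum_nonneg mult_nonneg_nonneg divide_nonneg_nonneg add_nonneg_nonneg)
    fix i show "slack i \<ge> 0" by (rule slack_nonneg)
    show "Y i \<ge> 0" using Y_pos[of i] by simp
  qed auto
  moreover have "g \<bullet> g > 0" using False by simp
  ultimately show ?thesis by (simp add: zero_le_mult_iff)
qed

text \<open>Along \<open>q i\<close> the flux is \<open>p i * (q i \<bullet> g)\<close>, where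
  \<open>p i\<close> is exactly the quantity squared in \<open>defect_expand\<close>. Cauchy-Schwarz
  with the weights \<open>sqrt (Y i)\<close> pairs these squares with the quadratic form of
  \<open>newth A (k - 1)\<close>.\<close>

lemma flux_le:
  "(\<xi> \<bullet> flux k A g \<theta>)\<^sup>2 \<le> real k / real CARD('n) * (g \<bullet> g) * defect k A g \<theta> * (\<xi> \<bullet> (newth A (k - 1) *v \<xi>))"
proof -
  define n G where "n = real CARD('n)" and "G = g \<bullet> g"
  define p where "p i = X i - sgh A k - \<theta> / 2 * G * Y i" for i
  define s where "s i = sqrt (Y i)" for i
  have s: "s i > 0" "(s i)\<^sup>2 = Y i" for i using Y_pos[of i] by (auto simp: s_def)
  have "\<xi> \<bullet> flux k A g \<theta> = \<xi> \<bullet> (newth A k *v g) - sgh A k * (\<xi> \<bullet> g) - \<theta> / 2 * G * (\<xi> \<bullet> (newth A (k - 1) *v g))"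
    by (simp add: flux_def inner_diff_right G_def)
  also have "\<dots> = (\<Sum>i\<in>UNIV. p i * (q i \<bullet> \<xi>) * (q i \<bullet> g))"
    unfolding eb_newth_inner[OF eb] eb_inner_expand[OF eb, of \<xi> g] X_def[symmetric] Y_def[symmetric]
    by (simp add: sum_distrib_left p_def sum_subtractf[symmetric] algebra_simps)
  also have "\<dots> = (\<Sum>i\<in>UNIV. (p i * (q i \<bullet> g) / s i) * (s i * (q i \<bullet> \<xi>)))"
    using s(1) by (intro sum.cong refl) (simp add: less_imp_neq[symmetric] less_imp_neq)
  finally have "(\<xi> \<bullet> flux k A g \<theta>)\<^sup>2 \<le> (\<Sum>i\<in>UNIV. (p i * (q i \<bullet> g) / s i)\<^sup>2) * (\<Sum>i\<in>UNIV. (s i * (q i \<bullet> \<xi>))\<^sup>2)"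
    by (simp only: Cauchy_Schwarz_ineq_sum)
  also have "(\<Sum>i\<in>UNIV. (s i * (q i \<bullet> \<xi>))\<^sup>2) = \<xi> \<bullet> (newth A (k - 1) *v \<xi>)"
    unfolding eb_newth_inner[OF eb] Y_def[symmetric]
    by (intro sum.cong refl) (simp add: power_mult_distrib s, simp add: power2_eq_square)
  also have "(\<Sum>i\<in>UNIV. (p i * (q i \<bullet> g) / s i)\<^sup>2) \<le> real k / n * (G * defect k A g \<theta>)"
  proof -
    have "(p i * (q i \<bullet> g) / s i)\<^sup>2 \<le> real k / n * ((q i \<bullet> g)\<^sup>2 * ((slack i + n / real k * (p i)\<^sup>2) / Y i))" for i
    proof -
      have "(p i * (q i \<bullet> g) / s i)\<^sup>2 = real k / n * ((q i \<bullet> g)\<^sup>2 * ((n / real k * (p i)\<^sup>2) / Y i))"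
        using k by (simp add: n_def power_divide power_mult_distrib s)
      also have "\<dots> \<le> real k / n * ((q i \<bullet> g)\<^sup>2 * ((slack i + n / real k * (p i)\<^sup>2) / Y i))"
        using slack_nonneg[of i] Y_pos[of i]
        by (intro mult_left_mono divide_right_mono) (auto simp: n_def)
      finally show ?thesis .
    qed
    then have "(\<Sum>i\<in>UNIV. (p i * (q i \<bullet> g) / s i)\<^sup>2)
      \<le> (\<Sum>i\<in>UNIV. real k / n * ((q i \<bullet> g)\<^sup>2 * ((slack i + n / real k * (p i)\<^sup>2) / Y i)))"
      by (intro sum_mono)
    also have "\<dots> = real k / n * (G * defect k A g \<theta>)"
      using defect_expand[of g \<theta>] by (simp add: G_def n_def p_def sum_distrib_left)
    finally show ?thesis .
  qed
  then have "(\<Sum>i\<in>UNIV. (p i * (q i \<bullet> g) / s i)\<^sup>2) * (\<xi> \<bullet> (newth A (k - 1) *v \<xi>))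
    \<le> real k / n * (G * defect k A g \<theta>) * (\<xi> \<bullet> (newth A (k - 1) *v \<xi>))"
    using cone_newt_nonneg[OF A, of "k - 1" \<xi>] k
    by (intro mult_right_mono) (auto simp: newth_def matvec.scaleR_left)
  finally show ?thesis by (simp add: n_def G_def mult_ac)
qed

text \<open>Equality lets \<open>A\<close> differ from a multiple of the identity only in the
  direction of \<open>g\<close>. The coefficient of this rank-one term is determined, and it is the
  one that cancels in the Hessian of \<open>u powr (-\<kappa>)\<close>.\<close>

lemma defect_eq_0:
  assumes 0: "defect k A g \<theta> = 0" and \<theta>: "\<theta> > 0"
  shows "\<exists>r. \<forall>x. A *v x = r *\<^sub>R x - (real CARD('n) * \<theta> / (2 * real k) * (g \<bullet> x)) *\<^sub>R g"
proof -
  define n where "n = real CARD('n)"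
  have n: "n > 0" by (simp add: n_def)
  have Aexp: "A *v x = (\<Sum>i\<in>UNIV. (l i * (q i \<bullet> x)) *\<^sub>R q i)" for x
  proof -
    have "A *v x = A *v (\<Sum>i\<in>UNIV. (q i \<bullet> x) *\<^sub>R q i)" by (simp add: eb_expand[OF eb])
    then show ?thesis by (simp add: matvec.sum_right matvec.scaleR_right eb_eigen[OF eb] mult.commute)
  qed
  have all_const: "A *v x = r *\<^sub>R x" if "\<And>i. l i = r" for r x
    unfolding Aexp that by (simp add: eb_expand[OF eb] flip: scaleR_scaleR scaleR_sum_right)
  show ?thesis
  proof (cases "g = 0")
    case True
    then have S0: "S = 0" using 0 by (simp add: defect_def S_def)
    have "slack i = 0" for i
    proof -
      have "0 \<le> real CARD('n) / real k * (X i - sgh A k)\<^sup>2" by simp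
      then show ?thesis using slack_nonneg[of i] unfolding slack_def S0 mult_zero_left by linarith
    qed
    then have c: "l j = esymhat (UNIV - {i}) l 1" if "j \<noteq> i" for i j using slack_eq_0_const that by blast
    have "l i = l j" for i j
    proof -
      \<comment> \<open>Since n \<ge> 4, there is an index \<open>m\<close> outside \<open>i\<close>
        and \<open>j\<close>; both eigenvalues agree with the common value of the others as seen
        from \<open>m\<close>.\<close>
      have "card {i, j} < CARD('n)" using k card_insert_le_m1[of 2 "{j}" i] by (simp add: card_insert_if)
      then obtain m where "m \<notin> {i, j}" by (metis UNIV_I less_irrefl subsetI subset_antisym top_greatest)
      then have "i \<noteq> m" "j \<noteq> m" by auto
      then show ?thesis using c[of i m] c[of j m] by simp
    qed
    then show ?thesis using all_const[of "l undefined"] True by (intro exI[of _ "l undefined"]) auto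
  next
    case False
    define G where "G = g \<bullet> g"
    have G: "G > 0" using False by (simp add: G_def)
    define T where "T i = (q i \<bullet> g)\<^sup>2 * ((slack i + n / real k * (X i - sgh A k - \<theta> / 2 * G * Y i)\<^sup>2) / Y i)" for i
    have Tnn: "T i \<ge> 0" for i
      unfolding T_def using slack_nonneg[of i] Y_pos[of i] n
      by (intro mult_nonneg_nonneg divide_nonneg_nonneg add_nonneg_nonneg) auto
    have "(\<Sum>i\<in>UNIV. T i) = 0"
      using defect_expand[of g \<theta>] 0 by (simp add: T_def n_def G_def)
    then have T0: "T i = 0" for i using Tnn by (subst (asm) sum_nonneg_eq_0_iff) auto
    have *: "slack i = 0 \<and> X i - sgh A k = \<theta> / 2 * G * Y i" if "q i \<bullet> g \<noteq> 0" for i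
    proof -
      have "slack i + n / real k * (X i - sgh A k - \<theta> / 2 * G * Y i)\<^sup>2 = 0"
        using T0[of i] that Y_pos[of i] by (simp add: T_def)
      moreover have "n / real k * (X i - sgh A k - \<theta> / 2 * G * Y i)\<^sup>2 \<ge> 0" using n by simp
      ultimately have "slack i = 0" "n / real k * (X i - sgh A k - \<theta> / 2 * G * Y i)\<^sup>2 = 0"
        using slack_nonneg[of i] by linarith+
      then show ?thesis using n k by simp
    qed
    have "\<exists>i. q i \<bullet> g \<noteq> 0" using eb_expand[OF eb, of g] False by (metis (no_types, lifting) scaleR_zero_left sum.neutral)
    then obtain i where i: "q i \<bullet> g \<noteq> 0" by blast
    define r where "r = esymhat (UNIV - {i}) l 1"
    have lr: "l j = r" if "j \<noteq> i" for j using slack_eq_0_const[of i j] * i that by (simp add: r_def)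
    have es: "esymhat (UNIV - {i}) l j = r ^ j" if "j \<le> CARD('n) - 1" for j
    proof -
      have "esym (UNIV - {i}) l j = esym (UNIV - {i}) (\<lambda>_. r) j" by (intro esym_cong) (auto simp: lr)
      then show ?thesis using that by (simp add: esymhat_def esym_const)
    qed
    have XY: "X i = r * Y i" using k by (simp add: X_def Y_def es flip: power_Suc)
    have sk: "n * sgh A k = (n - real k) * X i + real k * l i * Y i"
      using esymhat_remove[of "UNIV :: 'n set" i "k - 1" l] k
      by (simp add: eb_sgh[OF eb] X_def Y_def n_def of_nat_diff)
    \<comment> \<open>The vanishing square determines the gap between \<open>l i\<close> and the
      common value \<open>r\<close>. The gap is nonzero, so \<open>g\<close> has no component in a
      second eigendirection: that would force \<open>l i\<close> to be equal to another
      eigenvalue.\<close>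
    have "n * (X i - sgh A k) = real k * (r - l i) * Y i"
      using sk XY by (simp add: algebra_simps)
    then have "n * (\<theta> / 2 * G) * Y i = real k * (r - l i) * Y i" using * i by simp
    then have rl: "n * (\<theta> / 2 * G) = real k * (r - l i)" using Y_pos[of i] by simp
    have ne: "r \<noteq> l i" using rl n G \<theta> by auto
    have z: "q j \<bullet> g = 0" if "j \<noteq> i" for j
    proof (rule ccontr)
      assume j: "q j \<bullet> g \<noteq> 0"
      have "card {i, j} < CARD('n)" using k card_insert_le_m1[of 2 "{j}" i] by (simp add: card_insert_if)
      then obtain m where "m \<notin> {i, j}" by (metis UNIV_I less_irrefl subsetI subset_antisym top_greatest)
      then have "l i = l m" using slack_eq_0_const[of j] * j that by (metis insertCI)
      then show False using ne lr[of m] \<open>m \<notin> {i, j}\<close> by simp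
    qed
    have g: "g = (q i \<bullet> g) *\<^sub>R q i"
    proof -
      have "g = (\<Sum>j\<in>UNIV. (q j \<bullet> g) *\<^sub>R q j)" by (simp add: eb_expand[OF eb])
      also have "\<dots> = (\<Sum>j\<in>{i}. (q j \<bullet> g) *\<^sub>R q j)" by (rule sum.mono_neutral_right) (auto simp: z)
      finally show ?thesis by simp
    qed
    have G2: "G = (q i \<bullet> g)\<^sup>2"
      unfolding G_def by (subst (1 2) g) (simp add: eb_inner[OF eb] power2_eq_square)
    have "A *v x = r *\<^sub>R x - (n * \<theta> / (2 * real k) * (g \<bullet> x)) *\<^sub>R g" for x
    proof -
      have "A *v x = (\<Sum>j\<in>UNIV. r *\<^sub>R ((q j \<bullet> x) *\<^sub>R q j) + (if j = i then ((l i - r) * (q i \<bullet> x)) *\<^sub>R q i else 0))"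
        unfolding Aexp by (intro sum.cong refl) (auto simp: lr algebra_simps)
      also have "\<dots> = r *\<^sub>R x + ((l i - r) * (q i \<bullet> x)) *\<^sub>R q i"
      proof -
        have "(\<Sum>j\<in>UNIV. r *\<^sub>R ((q j \<bullet> x) *\<^sub>R q j)) = r *\<^sub>R x"
          by (simp only: scaleR_sum_right[symmetric] eb_expand[OF eb])
        then show ?thesis unfolding sum.distrib by simp
      qed
      also have "((l i - r) * (q i \<bullet> x)) *\<^sub>R q i = - (n * \<theta> / (2 * real k) * (g \<bullet> x)) *\<^sub>R g"
      proof -
        have "l i - r = - (n * \<theta> / (2 * real k)) * (q i \<bullet> g)\<^sup>2"
          using rl k by (simp add: G2[symmetric] field_simps)
        moreover have "(n * \<theta> / (2 * real k) * (g \<bullet> x)) *\<^sub>R g =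
            (n * \<theta> / (2 * real k) * ((q i \<bullet> g) * (q i \<bullet> x))) *\<^sub>R ((q i \<bullet> g) *\<^sub>R q i)"
          using g by (metis inner_scaleR_left)
        ultimately show ?thesis by (simp add: power2_eq_square mult_ac)
      qed
      finally show ?thesis by simp
    qed
    then show ?thesis by (auto simp: n_def)
  qed
qed

end

subsection \<open>Newton transformations of a Hessian are divergence free\<close>

definition C1c :: "(real^'n \<Rightarrow> real) \<Rightarrow> (real^'n \<Rightarrow> real^'n) \<Rightarrow> bool" where
  "C1c z Z \<longleftrightarrow> (\<forall>x. (z has_derivative (\<lambda>h. Z x \<bullet> h)) (at x)) \<and> continuous_on UNIV Z
    \<and> (\<exists>R. \<forall>x. norm x > R \<longrightarrow> z x = 0)"

text \<open>A symmetric Jacobian expresses that \<open>g\<close> is a gradient field. No potential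
  is recorded, and interpolations between a field and its translate stay in the class.\<close>

definition C1f :: "(real^'n \<Rightarrow> real^'n) \<Rightarrow> (real^'n \<Rightarrow> real^'n^'n) \<Rightarrow> bool" where
  "C1f g A \<longleftrightarrow> (\<forall>x. (g has_derivative (\<lambda>h. A x *v h)) (at x)) \<and> continuous_on UNIV A
    \<and> (\<forall>x. transpose (A x) = A x)"

lemma integrable_compact_support:
  fixes f :: "real^'n \<Rightarrow> 'b::{banach, second_countable_topology}"
  assumes "continuous_on UNIV f" "\<And>x. norm x > R \<Longrightarrow> f x = 0"
  shows "integrable lborel f"
proof -
  have "integrable lborel (\<lambda>x. indicator (cball 0 R) x *\<^sub>R f x)"
    by (rule borel_integrable_compact) (auto intro: continuous_on_subset[OF assms(1)])
  moreover have "(\<lambda>x. indicator (cball 0 R) x *\<^sub>R f x) = f"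
    using assms(2) by (auto simp: fun_eq_iff indicator_def not_le)
  ultimately show ?thesis by simp
qed

lemma borel_measurable_lborel_continuous:
  fixes f :: "real^'n \<Rightarrow> 'b::topological_space"
  shows "continuous_on UNIV f \<Longrightarrow> f \<in> borel_measurable lborel"
  by (simp add: borel_measurable_continuous_onI)

lemma C1c_continuous: "C1c z Z \<Longrightarrow> continuous_on UNIV z"
  unfolding C1c_def by (meson continuous_at_imp_continuous_on has_derivative_continuous)

lemma C1f_continuous: "C1f g A \<Longrightarrow> continuous_on UNIV g"
  unfolding C1f_def by (meson continuous_at_imp_continuous_on has_derivative_continuous)

lemma C1c_support:
  assumes "C1c z Z"
  obtains R where "R > 0" "\<And>x. norm x > R \<Longrightarrow> z x = 0" "\<And>x. norm x > R \<Longrightarrow> Z x = 0"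
proof -
  obtain R0 where R0: "\<And>x. norm x > R0 \<Longrightarrow> z x = 0" using assms by (auto simp: C1c_def)
  define R where "R = max R0 1"
  have R: "z x = 0" if "norm x > R" for x using R0 that by (simp add: R_def)
  have "Z x = 0" if "norm x > R" for x
  proof -
    have "open {x::real^'n. norm x > R}"
      by (intro open_Collect_less continuous_intros)
    moreover have "((\<lambda>_. 0) has_derivative (\<lambda>h. 0)) (at x)" by simp
    ultimately have "(z has_derivative (\<lambda>h. 0)) (at x)"
      using has_derivative_transform_within_open[of "\<lambda>_. 0" "\<lambda>h. 0" x UNIV "{x. norm x > R}" z] that R
      by auto
    moreover have "(z has_derivative (\<lambda>h. Z x \<bullet> h)) (at x)" using assms by (simp add: C1c_def)
    ultimately have "(\<lambda>h. Z x \<bullet> h) = (\<lambda>h. 0)" by (rule has_derivative_unique[rotated])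
    then have "Z x \<bullet> Z x = 0" by (rule fun_cong)
    then show ?thesis by simp
  qed
  then show ?thesis using that[of R] R by (auto simp: R_def)
qed

lemma continuous_compact_support_bounded:
  fixes f :: "real^'n \<Rightarrow> 'b::real_normed_vector"
  assumes "continuous_on UNIV f"
  obtains B where "B > 0" "\<And>x. norm x \<le> R \<Longrightarrow> norm (f x) \<le> B"
proof -
  have "compact (f ` cball 0 R)"
    by (intro compact_continuous_image continuous_on_subset[OF assms]) auto
  then obtain B where "B > 0" "\<And>y. y \<in> f ` cball 0 R \<Longrightarrow> norm y \<le> B"
    using compact_imp_bounded bounded_pos by metis
  then show ?thesis using that[of B] by auto
qed

lemma lborel_integral_translate:
  fixes f :: "real^'n \<Rightarrow> 'b::{banach, second_countable_topology}"
  assumes "continuous_on UNIV f"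
  shows "(LINT x|lborel. f (x + h)) = (LINT x|lborel. f x)"
proof -
  have "f \<in> borel_measurable borel" using assms by (rule borel_measurable_continuous_onI)
  then have "integral\<^sup>L (distr lborel borel ((+) h)) f = (LINT x|lborel. f (h + x))"
    by (intro integral_distr) auto
  then show ?thesis by (simp add: lborel_distr_plus add.commute)
qed

lemma C1c_lipschitz:
  assumes "C1c z Z"
  obtains B where "B > 0" "\<And>x y. \<bar>z x - z y\<bar> \<le> B * norm (x - y)"
proof -
  obtain R where R: "\<And>x. norm x > R \<Longrightarrow> Z x = 0" using C1c_support[OF assms] by metis
  obtain B where B: "B > 0" "\<And>x. norm x \<le> R \<Longrightarrow> norm (Z x) \<le> B"
    using continuous_compact_support_bounded[of Z R] assms by (auto simp: C1c_def)
  have ZB: "norm (Z x) \<le> B" for x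
    using B R by (cases "norm x \<le> R") auto
  have "norm (z x - z y) \<le> B * norm (x - y)" for x y
  proof (rule differentiable_bound[of UNIV z "\<lambda>x h. Z x \<bullet> h"])
    fix x
    show "(z has_derivative (\<lambda>h. Z x \<bullet> h)) (at x within UNIV)" using assms by (simp add: C1c_def)
    have "norm (Z x \<bullet> h) \<le> B * norm h" for h
      using Cauchy_Schwarz_ineq2[of "Z x" h] mult_right_mono[OF ZB[of x], of "norm h"] by simp
    then show "onorm (\<lambda>h. Z x \<bullet> h) \<le> B" by (intro onorm_le)
  qed auto
  then show ?thesis using that[of B] B by simp
qed

lemma seq_h: "(\<lambda>m. inverse (real (Suc m))) \<longlonglongrightarrow> 0"
  using LIMSEQ_inverse_real_of_nat by simp

lemma has_derivative_sequence:
  fixes f :: "'a::real_normed_vector \<Rightarrow> 'b::real_normed_vector"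
  assumes "(f has_derivative D) (at x)" "h \<longlonglongrightarrow> 0" "\<And>m. h m \<noteq> (0::real)"
  shows "(\<lambda>m. (f (x + h m *\<^sub>R e) - f x) /\<^sub>R h m) \<longlonglongrightarrow> D e"
proof -
  have lin: "linear D" using assms(1) has_derivative_linear by blast
  show ?thesis
  proof (cases "e = 0")
    case True
    then show ?thesis by (simp add: linear_0[OF lin])
  next
    case False
    have "(\<lambda>y. norm (f (x + y) - f x - D y) / norm y) \<midarrow>0\<rightarrow> 0"
      using assms(1) by (simp add: has_derivative_at)
    moreover have "filterlim (\<lambda>m. h m *\<^sub>R e) (at 0) sequentially"
      using assms(2,3) False tendsto_scaleR[OF assms(2) tendsto_const[of e]] by (simp add: filterlim_at)
    ultimately have "(\<lambda>m. norm (f (x + h m *\<^sub>R e) - f x - D (h m *\<^sub>R e)) / norm (h m *\<^sub>R e)) \<longlonglongrightarrow> 0"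
      by (rule filterlim_compose)
    then have "(\<lambda>m. norm (f (x + h m *\<^sub>R e) - f x - D (h m *\<^sub>R e)) / norm (h m *\<^sub>R e) * norm e) \<longlonglongrightarrow> 0 * norm e"
      by (rule tendsto_mult_right)
    moreover have "norm (f (x + h m *\<^sub>R e) - f x - D (h m *\<^sub>R e)) / norm (h m *\<^sub>R e) * norm e
        = norm ((f (x + h m *\<^sub>R e) - f x) /\<^sub>R h m - D e)" for m
    proof -
      have "(f (x + h m *\<^sub>R e) - f x) /\<^sub>R h m - D e = inverse (h m) *\<^sub>R (f (x + h m *\<^sub>R e) - f x - D (h m *\<^sub>R e))"
        using assms(3)[of m] by (simp add: linear_scale[OF lin] scaleR_diff_right)
      then have "norm ((f (x + h m *\<^sub>R e) - f x) /\<^sub>R h m - D e)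
          = inverse \<bar>h m\<bar> * norm (f (x + h m *\<^sub>R e) - f x - D (h m *\<^sub>R e))" by simp
      then show ?thesis using False by (simp add: divide_inverse)
    qed
    ultimately have "(\<lambda>m. norm ((f (x + h m *\<^sub>R e) - f x) /\<^sub>R h m - D e)) \<longlonglongrightarrow> 0" by simp
    then have "(\<lambda>m. (f (x + h m *\<^sub>R e) - f x) /\<^sub>R h m - D e) \<longlonglongrightarrow> 0"
      by (rule tendsto_norm_zero_cancel)
    then show ?thesis by (rule LIM_zero_cancel)
  qed
qed

text \<open>The Lipschitz bound of \<open>z\<close> provides the dominating function, while
  \<open>F\<close> is merely continuous. The translate is backward because a change of variables
  moves a forward shift from \<open>F\<close> to \<open>z\<close>; this explains the minus
  sign.\<close>

lemma difference_quotient_integral: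
  fixes F :: "real^'n \<Rightarrow> real"
  assumes z: "C1c z Z" and F: "continuous_on UNIV F"
  defines "h \<equiv> \<lambda>m. inverse (real (Suc m))"
  shows "(\<lambda>m. LINT x|lborel. F x * ((z (x - h m *\<^sub>R e) - z x) / h m)) \<longlonglongrightarrow> (LINT x|lborel. - (F x * (Z x \<bullet> e)))"
proof -
  obtain R where R: "R > 0" "\<And>x. norm x > R \<Longrightarrow> z x = 0" using C1c_support[OF z] by metis
  obtain B where B: "B > 0" "\<And>x y. \<bar>z x - z y\<bar> \<le> B * norm (x - y)" using C1c_lipschitz[OF z] by metis
  have cz: "continuous_on UNIV z" using C1c_continuous[OF z] .
  have cZ: "continuous_on UNIV Z" using z by (simp add: C1c_def)
  have h: "h m > 0" "h m \<le> 1" for m by (auto simp: h_def inverse_le_1_iff)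
  define w where "w x = indicator (cball 0 (R + norm e)) x *\<^sub>R (\<bar>F x\<bar> * (B * norm e))" for x
  show ?thesis
  proof (rule integral_dominated_convergence)
    show "integrable lborel w"
      unfolding w_def by (intro borel_integrable_compact) (auto intro!: continuous_intros continuous_on_subset[OF F])
    show "(\<lambda>x. - (F x * (Z x \<bullet> e))) \<in> borel_measurable lborel"
      by (intro borel_measurable_lborel_continuous continuous_intros F cZ)
    show "(\<lambda>x. F x * ((z (x - h m *\<^sub>R e) - z x) / h m)) \<in> borel_measurable lborel" for m
      by (intro borel_measurable_lborel_continuous continuous_intros F cz
          continuous_on_compose2[OF cz, of UNIV "\<lambda>x. x - h m *\<^sub>R e"]) (use h(1)[of m] in auto)
    show "AE x in lborel. (\<lambda>m. F x * ((z (x - h m *\<^sub>R e) - z x) / h m)) \<longlonglongrightarrow> - (F x * (Z x \<bullet> e))"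
    proof (rule AE_I2)
      fix x
      have "(\<lambda>m. (z (x + h m *\<^sub>R (- e)) - z x) /\<^sub>R h m) \<longlonglongrightarrow> Z x \<bullet> (- e)"
        by (rule has_derivative_sequence) (use z seq_h in \<open>auto simp: C1c_def h_def\<close>)
      then have "(\<lambda>m. F x * ((z (x + h m *\<^sub>R (- e)) - z x) /\<^sub>R h m)) \<longlonglongrightarrow> F x * (Z x \<bullet> (- e))"
        by (rule tendsto_mult_left)
      then show "(\<lambda>m. F x * ((z (x - h m *\<^sub>R e) - z x) / h m)) \<longlonglongrightarrow> - (F x * (Z x \<bullet> e))"
        by (simp add: divide_inverse mult.commute)
    qed
    show "AE x in lborel. norm (F x * ((z (x - h m *\<^sub>R e) - z x) / h m)) \<le> w x" for m
    proof (rule AE_I2)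
      fix x
      show "norm (F x * ((z (x - h m *\<^sub>R e) - z x) / h m)) \<le> w x"
      proof (cases "norm x \<le> R + norm e")
        case True
        have "\<bar>z (x - h m *\<^sub>R e) - z x\<bar> \<le> B * (h m * norm e)"
          using B(2)[of "x - h m *\<^sub>R e" x] h(1)[of m] by simp
        then have "\<bar>(z (x - h m *\<^sub>R e) - z x) / h m\<bar> \<le> B * norm e"
          using h(1)[of m] by (simp add: abs_divide field_simps)
        then have "\<bar>F x\<bar> * \<bar>(z (x - h m *\<^sub>R e) - z x) / h m\<bar> \<le> \<bar>F x\<bar> * (B * norm e)"
          by (intro mult_left_mono) auto
        then show ?thesis using True by (simp add: w_def abs_mult)
      next
        case False
        have "norm (x - h m *\<^sub>R e) \<ge> norm x - h m * norm e"
          using norm_triangle_ineq2[of x "h m *\<^sub>R e"] h(1)[of m] by simp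
        moreover have "h m * norm e \<le> norm e" using h[of m] mult_right_mono[of "h m" 1 "norm e"] by simp
        ultimately have "z (x - h m *\<^sub>R e) = 0" "z x = 0"
          using False R(2)[of "x - h m *\<^sub>R e"] R(2)[of x] norm_ge_zero[of e] by linarith+
        then show ?thesis using B(1) by (simp add: w_def zero_le_mult_iff)
      qed
    qed
  qed
qed

text \<open>Translation invariance makes the integral of every difference quotient of
  \<open>z\<close> vanish.\<close>

lemma integral_gradient_eq_0:
  fixes Z :: "real^'n \<Rightarrow> real^'n"
  assumes z: "C1c z Z"
  shows "(LINT x|lborel. Z x) = 0"
proof -
  obtain R where R: "\<And>x. norm x > R \<Longrightarrow> z x = 0" "\<And>x. norm x > R \<Longrightarrow> Z x = 0"
    using C1c_support[OF z] by metis
  have cz: "continuous_on UNIV z" using C1c_continuous[OF z] .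
  have iz: "integrable lborel z" by (rule integrable_compact_support[OF cz R(1)])
  have iZ: "integrable lborel Z"
    using z by (intro integrable_compact_support[OF _ R(2)]) (auto simp: C1c_def)
  have "(LINT x|lborel. Z x) \<bullet> e = 0" for e
  proof -
    let ?h = "\<lambda>m. inverse (real (Suc m))"
    have "(LINT x|lborel. 1 * ((z (x - ?h m *\<^sub>R e) - z x) / ?h m)) = 0" for m
    proof -
      have "integrable lborel (\<lambda>x. z (x - ?h m *\<^sub>R e))"
      proof (rule integrable_compact_support[of _ "R + norm (?h m *\<^sub>R e)"])
        show "continuous_on UNIV (\<lambda>x. z (x - ?h m *\<^sub>R e))"
          by (rule continuous_on_compose2[OF cz]) (auto intro!: continuous_intros)
        fix x :: "real^'n" assume "norm x > R + norm (?h m *\<^sub>R e)"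
        then show "z (x - ?h m *\<^sub>R e) = 0"
          using norm_triangle_ineq2[of x "?h m *\<^sub>R e"] by (intro R(1)) linarith
      qed
      moreover have "(LINT x|lborel. z (x - ?h m *\<^sub>R e)) = (LINT x|lborel. z x)"
        using lborel_integral_translate[OF cz, of "- (?h m *\<^sub>R e)"] by simp
      ultimately show ?thesis using iz by simp
    qed
    then have "(\<lambda>m::nat. 0::real) \<longlonglongrightarrow> (LINT x|lborel. - (1 * (Z x \<bullet> e)))"
      using difference_quotient_integral[OF z, of "\<lambda>_. 1" e] by simp
    then have "(LINT x|lborel. - (1 * (Z x \<bullet> e))) = 0" using LIMSEQ_unique tendsto_const by blast
    then show ?thesis using iZ by simp
  qed
  then show ?thesis using inner_eq_zero_iff by blast
qed

lemma C1c_mult_component: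
  assumes z: "C1c z Z" and b: "\<And>x. (b has_derivative (\<lambda>h. B x *v h)) (at x)" "continuous_on UNIV B"
  shows "C1c (\<lambda>x. b x $ i * z x) (\<lambda>x. b x $ i *\<^sub>R Z x + z x *\<^sub>R (B x $ i))"
  unfolding C1c_def
proof (intro conjI allI)
  fix x
  have "((\<lambda>x. b x $ i) has_derivative (\<lambda>h. (B x *v h) $ i)) (at x)"
    by (rule bounded_linear.has_derivative[OF bounded_linear_vec_nth b(1)])
  moreover have "(z has_derivative (\<lambda>h. Z x \<bullet> h)) (at x)" using z by (simp add: C1c_def)
  ultimately show "((\<lambda>x. b x $ i * z x) has_derivative (\<lambda>h. (b x $ i *\<^sub>R Z x + z x *\<^sub>R B x $ i) \<bullet> h)) (at x)"
    by (auto intro!: derivative_eq_intros simp: matrix_mult_dot inner_add_left)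
next
  have "continuous_on UNIV b"
    using b(1) by (meson continuous_at_imp_continuous_on has_derivative_continuous)
  then show "continuous_on UNIV (\<lambda>x. b x $ i *\<^sub>R Z x + z x *\<^sub>R B x $ i)"
    using z b(2) C1c_continuous[OF z] by (intro continuous_intros) (auto simp: C1c_def)
  show "\<exists>R. \<forall>x. R < norm x \<longrightarrow> b x $ i * z x = 0" using z unfolding C1c_def by fastforce
qed

lemma has_derivative_translate:
  fixes g :: "'a::real_normed_vector \<Rightarrow> 'b::real_normed_vector"
  assumes "(g has_derivative D) (at (x + v))"
  shows "((\<lambda>x. g (x + v)) has_derivative D) (at x)"
  using has_derivative_compose[OF has_derivative_add_const[OF has_derivative_ident] assms] by simp

lemma C1f_segment:
  assumes g: "C1f g A"
  shows "C1f (\<lambda>x. g x + t *\<^sub>R (g (x + v) - g x)) (\<lambda>x. A x + t *\<^sub>R (A (x + v) - A x))"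
  unfolding C1f_def
proof (intro conjI allI)
  fix x
  have 1: "(g has_derivative (\<lambda>h. A x *v h)) (at x)" for x using g by (simp add: C1f_def)
  have 2: "((\<lambda>x. g (x + v)) has_derivative (\<lambda>h. A (x + v) *v h)) (at x)"
    by (rule has_derivative_translate[OF 1])
  show "((\<lambda>x. g x + t *\<^sub>R (g (x + v) - g x)) has_derivative
      (\<lambda>h. (A x + t *\<^sub>R (A (x + v) - A x)) *v h)) (at x)"
    by (auto intro!: derivative_eq_intros 1 2 simp: matvec.add_left matvec.diff_left matvec.scaleR_left)
next
  have cA: "continuous_on UNIV A" using g by (simp add: C1f_def)
  then show "continuous_on UNIV (\<lambda>x. A x + t *\<^sub>R (A (x + v) - A x))"
    by (intro continuous_intros continuous_on_compose2[OF cA, of UNIV "\<lambda>x. x + v"]) auto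
next
  fix x
  have "transpose (A x) = A x" for x using g by (simp add: C1f_def)
  then show "transpose (A x + t *\<^sub>R (A (x + v) - A x)) = A x + t *\<^sub>R (A (x + v) - A x)"
    by (simp add: vec_eq_iff transpose_def)
qed

text \<open>For each coordinate \<open>i\<close> the divergence identity is tested with
  \<open>b x $ i * z x\<close>, and its i-th component is kept. Summing over \<open>i\<close>, the
  product rule yields the two integrals, the trace by symmetry of \<open>B\<close>.\<close>

lemma newt_segment_by_parts:
  fixes g b :: "real^'n \<Rightarrow> real^'n"
  assumes IH: "\<And>z Z. C1c z Z \<Longrightarrow> (LINT x|lborel. newt (M x) k *v Z x) = 0"
    and M: "continuous_on UNIV M"
    and z: "C1c z Z" and b: "\<And>x. (b has_derivative (\<lambda>h. B x *v h)) (at x)" "continuous_on UNIV B"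
    and B: "\<And>x. transpose (B x) = B x"
  shows "(LINT x|lborel. z x * trace (newt (M x) k ** B x)) = - (LINT x|lborel. b x \<bullet> (newt (M x) k *v Z x))"
proof -
  obtain R where R: "\<And>x. norm x > R \<Longrightarrow> z x = 0" "\<And>x. norm x > R \<Longrightarrow> Z x = 0"
    using C1c_support[OF z] by metis
  have cz: "continuous_on UNIV z" "continuous_on UNIV Z" using C1c_continuous[OF z] z by (auto simp: C1c_def)
  have cb: "continuous_on UNIV b"
    using b(1) by (meson continuous_at_imp_continuous_on has_derivative_continuous)
  define W where "W i x = b x $ i *\<^sub>R Z x + z x *\<^sub>R (B x $ i)" for i x
  have W: "C1c (\<lambda>x. b x $ i * z x) (W i)" for i
    unfolding W_def by (rule C1c_mult_component[OF z b])
  have iW: "integrable lborel (\<lambda>x. newt (M x) k *v W i x)" for i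
    unfolding W_def
    by (rule integrable_compact_support[of _ R])
      (auto intro!: continuous_intros matvec.continuous_on M cz cb b(2) simp: R)
  have "(\<Sum>i\<in>UNIV. (LINT x|lborel. (newt (M x) k *v W i x) $ i)) = 0"
  proof (intro sum.neutral ballI)
    fix i
    have "(LINT x|lborel. (newt (M x) k *v W i x) $ i) = (LINT x|lborel. newt (M x) k *v W i x) $ i"
      by (rule integral_bounded_linear[OF bounded_linear_vec_nth iW])
    then show "(LINT x|lborel. (newt (M x) k *v W i x) $ i) = 0" using IH[OF W] by simp
  qed
  moreover have "(\<Sum>i\<in>UNIV. (LINT x|lborel. (newt (M x) k *v W i x) $ i))
      = (LINT x|lborel. (\<Sum>i\<in>UNIV. (newt (M x) k *v W i x) $ i))"
    by (rule Bochner_Integration.integral_sum[symmetric])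
      (rule integrable_bounded_linear[OF bounded_linear_vec_nth iW])
  moreover have "(\<Sum>i\<in>UNIV. (newt (M x) k *v W i x) $ i) =
      b x \<bullet> (newt (M x) k *v Z x) + z x * trace (newt (M x) k ** B x)" for x
  proof -
    have "(newt (M x) k *v W i x) $ i = b x $ i * (newt (M x) k *v Z x) $ i
        + z x * (\<Sum>j\<in>UNIV. newt (M x) k $ i $ j * B x $ j $ i)" for i
    proof -
      have "B x $ i $ j = B x $ j $ i" for j using arg_cong[OF B[of x], of "\<lambda>T. T $ j $ i"] by (simp add: transpose_def)
      then have "(newt (M x) k *v (B x $ i)) $ i = (\<Sum>j\<in>UNIV. newt (M x) k $ i $ j * B x $ j $ i)"
        by (simp add: matrix_vector_mult_def)
      then show ?thesis by (simp add: W_def matvec.add_right matvec.scaleR_right)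
    qed
    then show ?thesis by (simp add: sum.distrib inner_vec_def trace_matmul sum_distrib_left)
  qed
  moreover have "integrable lborel (\<lambda>x. b x \<bullet> (newt (M x) k *v Z x))"
    by (rule integrable_compact_support[of _ R])
      (auto intro!: continuous_intros matvec.continuous_on M cz cb simp: R)
  moreover have "integrable lborel (\<lambda>x. z x * trace (newt (M x) k ** B x))"
    by (rule integrable_compact_support[of _ R])
      (auto intro!: continuous_intros matmul.continuous_on bounded_linear.continuous_on[OF bounded_linear_trace]
        M cz b(2) simp: R)
  ultimately show ?thesis by simp
qed

text \<open>Compact support reduces the integral to one over a box, where the Leibniz rule
  applies.\<close>

lemma sg_segment_integral_deriv:
  fixes M B :: "real^'n \<Rightarrow> real^'n^'n"
  assumes M: "continuous_on UNIV M" and B: "continuous_on UNIV B" and z: "C1c z Z"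
  shows "((\<lambda>t. LINT x|lborel. z x * sg (M x + t *\<^sub>R B x) (Suc k)) has_real_derivative
    (LINT x|lborel. z x * trace (newt (M x + s *\<^sub>R B x) k ** B x))) (at s)"
proof -
  obtain R where R: "\<And>x. norm x > R \<Longrightarrow> z x = 0" using C1c_support[OF z] by metis
  have cz: "continuous_on UNIV z" using C1c_continuous[OF z] .
  obtain a c where ac: "cball (0 :: real^'n) R \<subseteq> cbox a c"
    using bounded_cball bounded_subset_cbox_symmetric by metis
  have eq: "(LINT x|lborel. f x) = integral (cbox a c) f"
    if f: "continuous_on UNIV f" "\<And>x. norm x > R \<Longrightarrow> f x = 0" for f :: "real^'n \<Rightarrow> real"
  proof -
    have "(f has_integral (LINT x|lborel. f x)) UNIV"
      by (rule has_integral_integral_lborel[OF integrable_compact_support[OF f]])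
    then have "integral UNIV f = (LINT x|lborel. f x)" by (rule integral_unique)
    moreover have "(\<lambda>x. if x \<in> cbox a c then f x else 0) = f"
      using f(2) ac by (auto simp: fun_eq_iff subset_iff not_le[symmetric])
    ultimately show ?thesis by (metis integral_restrict_UNIV)
  qed
  have c1: "continuous_on UNIV (\<lambda>x. z x * sg (M x + t *\<^sub>R B x) (Suc k))" for t
    by (intro continuous_intros cz M B)
  have c2: "continuous_on UNIV (\<lambda>x. z x * trace (newt (M x + t *\<^sub>R B x) k ** B x))" for t
    by (intro continuous_intros matmul.continuous_on bounded_linear.continuous_on[OF bounded_linear_trace] cz M B)
  have "((\<lambda>t. integral (cbox a c) (\<lambda>x. z x * sg (M x + t *\<^sub>R B x) (Suc k))) has_field_derivative
    integral (cbox a c) (\<lambda>x. z x * trace (newt (M x + s *\<^sub>R B x) k ** B x))) (at s within UNIV)"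
  proof (rule leibniz_rule_field_derivative)
    fix t x
    show "((\<lambda>t. z x * sg (M x + t *\<^sub>R B x) (Suc k)) has_field_derivative
        z x * trace (newt (M x + t *\<^sub>R B x) k ** B x)) (at t within UNIV)"
      using DERIV_cmult[OF sg_has_derivative[of "M x" "B x" k t], of "z x"] by simp
    show "(\<lambda>x. z x * sg (M x + t *\<^sub>R B x) (Suc k)) integrable_on cbox a c"
      by (rule integrable_continuous) (rule continuous_on_subset[OF c1], simp)
    show "continuous_on (UNIV \<times> cbox a c) (\<lambda>(t, x). z x * trace (newt (M x + t *\<^sub>R B x) k ** B x))"
      unfolding split_beta
      by (intro continuous_intros matmul.continuous_on bounded_linear.continuous_on[OF bounded_linear_trace]
          continuous_on_compose2[OF cz] continuous_on_compose2[OF M] continuous_on_compose2[OF B]) auto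
  qed auto
  then show ?thesis
    using eq[OF c1] eq[OF c2] R by simp
qed

text \<open>The Hessian need not be differentiable, so the induction step takes a difference quotient in
  place of a derivative. The mean value theorem along the segment between \<open>g\<close> and its translate
  meets only further gradient fields, to which the induction hypothesis applies.\<close>

lemma newt_divergence_free:
  fixes g :: "real^'n \<Rightarrow> real^'n"
  assumes "C1f g A" "C1c z Z"
  shows "(LINT x|lborel. newt (A x) k *v Z x) = 0"
  using assms
proof (induction k arbitrary: g A z Z)
  case 0
  then show ?case using integral_gradient_eq_0 by simp
next
  case (Suc k)
  note g = Suc.prems(1) and z = Suc.prems(2)
  obtain R where R: "R > 0" "\<And>x. norm x > R \<Longrightarrow> z x = 0" "\<And>x. norm x > R \<Longrightarrow> Z x = 0"
    using C1c_support[OF z] by metis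
  have cz: "continuous_on UNIV z" "continuous_on UNIV Z" using C1c_continuous[OF z] z by (auto simp: C1c_def)
  have cA: "continuous_on UNIV A" and symA: "\<And>x. transpose (A x) = A x"
    and dg: "\<And>x. (g has_derivative (\<lambda>h. A x *v h)) (at x)" using g by (auto simp: C1f_def)
  have cg: "continuous_on UNIV g" by (rule C1f_continuous[OF g])
  define h where "h m = inverse (real (Suc m))" for m
  have h: "h m > 0" "h m \<le> 1" for m by (auto simp: h_def inverse_le_1_iff)
  have iN: "integrable lborel (\<lambda>x. newt (A x) j *v Z x)" for j
    by (rule integrable_compact_support[of _ R]) (auto intro!: continuous_intros matvec.continuous_on cA cz simp: R)
  have "(LINT x|lborel. newt (A x) (Suc k) *v Z x) \<bullet> e = 0" for e
  proof -
    define b where "b m x = g (x + h m *\<^sub>R e) - g x" for m x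
    define B where "B m x = A (x + h m *\<^sub>R e) - A x" for m x
    have cB: "continuous_on UNIV (B m)" for m
      unfolding B_def by (intro continuous_intros cA continuous_on_compose2[OF cA, of UNIV "\<lambda>x. x + h m *\<^sub>R e"]) auto
    have cb: "continuous_on UNIV (b m)" for m
      unfolding b_def by (intro continuous_intros cg continuous_on_compose2[OF cg, of UNIV "\<lambda>x. x + h m *\<^sub>R e"]) auto
    have seg: "C1f (\<lambda>x. g x + t *\<^sub>R b m x) (\<lambda>x. A x + t *\<^sub>R B m x)" for t m
      unfolding b_def B_def by (rule C1f_segment[OF g])
    have db: "(b m has_derivative (\<lambda>v. B m x *v v)) (at x)" for m x
    proof -
      have "((\<lambda>x. g (x + h m *\<^sub>R e)) has_derivative (\<lambda>v. A (x + h m *\<^sub>R e) *v v)) (at x)"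
        by (rule has_derivative_translate[OF dg])
      then show ?thesis unfolding b_def B_def matvec.diff_left by (rule has_derivative_diff[OF _ dg])
    qed
    have symB: "transpose (B m x) = B m x" for m x
      using symA[of x] symA[of "x + h m *\<^sub>R e"] by (simp add: B_def vec_eq_iff transpose_def)
    \<comment> \<open>The mean value theorem is applied to the integral \<open>G\<close>, not
      pointwise, so that one \<open>t\<close> serves all \<open>x\<close> and
      \<open>g x + t *\<^sub>R b m x\<close> is again a gradient field. Translation turns the
      increment of \<open>G\<close> into a difference quotient of \<open>z\<close>.\<close>
    have "\<exists>t. 0 < t \<and> t < 1 \<and> (LINT x|lborel. sg (A x) (Suc k) * ((z (x - h m *\<^sub>R e) - z x) / h m))
        = - (LINT x|lborel. ((1 / h m) *\<^sub>R b m x) \<bullet> (newt (A x + t *\<^sub>R B m x) k *v Z x))" for m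
    proof -
      define G where "G t = (LINT x|lborel. z x * sg (A x + t *\<^sub>R B m x) (Suc k))" for t
      define G' where "G' t = (LINT x|lborel. z x * trace (newt (A x + t *\<^sub>R B m x) k ** B m x))" for t
      have "(G has_real_derivative G' t) (at t)" for t
        unfolding G_def G'_def by (rule sg_segment_integral_deriv[OF cA cB z])
      then obtain t where t: "0 < t" "t < 1" "G 1 - G 0 = (1 - 0) * G' t"
        using MVT2[of 0 1 G G'] by auto
      have "G' t = - (LINT x|lborel. b m x \<bullet> (newt (A x + t *\<^sub>R B m x) k *v Z x))"
        unfolding G'_def
        by (rule newt_segment_by_parts[OF Suc.IH[OF seg] _ z db cB symB]) (auto intro!: continuous_intros cA cB)
      moreover have "G 1 - G 0 = (LINT x|lborel. sg (A x) (Suc k) * (z (x - h m *\<^sub>R e) - z x))"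
      proof -
        have c1: "continuous_on UNIV (\<lambda>x. sg (A x) (Suc k) * z (x - h m *\<^sub>R e))"
          by (intro continuous_intros cA continuous_on_compose2[OF cz(1), of UNIV "\<lambda>x. x - h m *\<^sub>R e"]) auto
        have "G 1 = (LINT x|lborel. (\<lambda>x. sg (A x) (Suc k) * z (x - h m *\<^sub>R e)) (x + h m *\<^sub>R e))"
          by (simp add: G_def B_def mult.commute)
        also have "\<dots> = (LINT x|lborel. sg (A x) (Suc k) * z (x - h m *\<^sub>R e))"
          by (rule lborel_integral_translate[OF c1])
        finally have "G 1 = (LINT x|lborel. sg (A x) (Suc k) * z (x - h m *\<^sub>R e))" .
        moreover have "integrable lborel (\<lambda>x. sg (A x) (Suc k) * z (x - h m *\<^sub>R e))"
        proof (rule integrable_compact_support[of _ "R + norm (h m *\<^sub>R e)"])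
          fix x :: "real^'n" assume "norm x > R + norm (h m *\<^sub>R e)"
          then have "norm (x - h m *\<^sub>R e) > R"
            using norm_triangle_ineq2[of x "h m *\<^sub>R e"] by linarith
          then show "sg (A x) (Suc k) * z (x - h m *\<^sub>R e) = 0" by (simp add: R)
        qed (rule c1)
        moreover have "integrable lborel (\<lambda>x. sg (A x) (Suc k) * z x)"
          by (rule integrable_compact_support[of _ R]) (auto intro!: continuous_intros cA cz simp: R)
        ultimately show ?thesis by (simp add: G_def right_diff_distrib mult.commute)
      qed
      ultimately have "(LINT x|lborel. sg (A x) (Suc k) * (z (x - h m *\<^sub>R e) - z x))
          = - (LINT x|lborel. b m x \<bullet> (newt (A x + t *\<^sub>R B m x) k *v Z x))" using t by simp
      then have "(LINT x|lborel. sg (A x) (Suc k) * (z (x - h m *\<^sub>R e) - z x)) / h m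
          = - ((LINT x|lborel. b m x \<bullet> (newt (A x + t *\<^sub>R B m x) k *v Z x)) / h m)" by simp
      then show ?thesis using t(1,2) by (intro exI[of _ t]) simp
    qed
    then have "\<exists>t. \<forall>m. 0 < t m \<and> t m < 1 \<and> (LINT x|lborel. sg (A x) (Suc k) * ((z (x - h m *\<^sub>R e) - z x) / h m))
        = - (LINT x|lborel. ((1 / h m) *\<^sub>R b m x) \<bullet> (newt (A x + t m *\<^sub>R B m x) k *v Z x))"
      by (intro choice allI)
    then obtain t where tt: "\<forall>m. 0 < t m \<and> t m < 1 \<and> (LINT x|lborel. sg (A x) (Suc k) * ((z (x - h m *\<^sub>R e) - z x) / h m))
        = - (LINT x|lborel. ((1 / h m) *\<^sub>R b m x) \<bullet> (newt (A x + t m *\<^sub>R B m x) k *v Z x))" ..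
    have t: "0 < t m" "t m < 1"
      "(LINT x|lborel. sg (A x) (Suc k) * ((z (x - h m *\<^sub>R e) - z x) / h m))
        = - (LINT x|lborel. ((1 / h m) *\<^sub>R b m x) \<bullet> (newt (A x + t m *\<^sub>R B m x) k *v Z x))" for m
      using spec[OF tt, of m] by (auto simp only:)
    have h0: "h \<longlonglongrightarrow> 0" using seq_h unfolding h_def[abs_def] .
    have "(\<lambda>m. LINT x|lborel. sg (A x) (Suc k) * ((z (x - h m *\<^sub>R e) - z x) / h m))
        \<longlonglongrightarrow> (LINT x|lborel. - (sg (A x) (Suc k) * (Z x \<bullet> e)))"
      unfolding h_def by (rule difference_quotient_integral[OF z]) (intro continuous_intros cA)
    moreover have "(\<lambda>m. LINT x|lborel. ((1 / h m) *\<^sub>R b m x) \<bullet> (newt (A x + t m *\<^sub>R B m x) k *v Z x))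
        \<longlonglongrightarrow> (LINT x|lborel. (A x *v e) \<bullet> (newt (A x) k *v Z x))"
    proof -
      obtain C where C: "C > 0" "\<And>x. norm x \<le> R + norm e \<Longrightarrow> norm (A x) \<le> C"
        using continuous_compact_support_bounded[OF cA] by metis
      \<comment> \<open>On the support of \<open>z\<close> the matrices
        \<open>A x + t *\<^sub>R B m x\<close> have norm at most \<open>3 * C\<close>, because
        \<open>B m x\<close> is a difference of two values bounded by \<open>C\<close>.\<close>
      have "compact ((\<lambda>M :: real^'n^'n. newt M k) ` cball 0 (3 * C))"
        by (intro compact_continuous_image continuous_intros) auto
      then obtain K where K: "K > 0" "\<And>M :: real^'n^'n. norm M \<le> 3 * C \<Longrightarrow> norm (newt M k) \<le> K"
        using compact_imp_bounded bounded_pos by (metis image_eqI mem_cball_0)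
      obtain K1 where K1: "K1 > 0" "\<And>(M :: real^'n^'n) (v :: real^'n). norm (M *v v) \<le> norm M * norm v * K1"
        using matvec.pos_bounded by metis
      have shift: "norm (x + s *\<^sub>R e) \<le> R + norm e" if "norm x \<le> R" "0 \<le> s" "s \<le> 1" for x s
      proof -
        have "norm (x + s *\<^sub>R e) \<le> norm x + s * norm e" using norm_triangle_ineq[of x "s *\<^sub>R e"] that by simp
        also have "\<dots> \<le> R + norm e" using that mult_right_mono[of s 1 "norm e"] by simp
        finally show ?thesis .
      qed
      have bb: "norm ((1 / h m) *\<^sub>R b m x) \<le> C * K1 * norm e" if x: "norm x \<le> R" for m x
      proof -
        have "norm (g (x + h m *\<^sub>R e) - g x) \<le> (C * K1) * norm ((x + h m *\<^sub>R e) - x)"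
        proof (rule differentiable_bound[of "cball 0 (R + norm e)" g "\<lambda>y v. A y *v v"])
          fix y :: "real^'n" assume y: "y \<in> cball 0 (R + norm e)"
          show "(g has_derivative (*v) (A y)) (at y within cball 0 (R + norm e))"
            using dg[of y] by (rule has_derivative_at_withinI)
          have "norm (A y *v v) \<le> C * K1 * norm v" for v
          proof -
            have "norm (A y *v v) \<le> norm (A y) * (norm v * K1)" using K1(2)[of "A y" v] by (simp add: mult.assoc)
            also have "\<dots> \<le> C * (norm v * K1)" using C(2)[of y] y K1(1) by (intro mult_right_mono) auto
            finally show ?thesis by (simp add: mult_ac)
          qed
          then show "onorm ((*v) (A y)) \<le> C * K1" by (rule onorm_le)
        qed (use x h[of m] shift[of x "h m"] in \<open>auto intro: add_increasing2\<close>)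
        then have "norm (b m x) \<le> C * K1 * norm e * h m" using h(1)[of m] by (simp add: b_def mult_ac)
        then have "norm (b m x) / h m \<le> C * K1 * norm e" using h(1)[of m] by (simp add: divide_le_eq)
        then show ?thesis using h(1)[of m] by simp
      qed
      have nb: "norm (newt (A x + t m *\<^sub>R B m x) k) \<le> K" if x: "norm x \<le> R" for m x
      proof (rule K(2))
        have "norm (A x) \<le> C" using x by (intro C(2)) (simp add: add_increasing2)
        moreover have "norm (A (x + h m *\<^sub>R e)) \<le> C" using x h[of m] by (intro C(2) shift) auto
        ultimately have "norm (B m x) \<le> 2 * C" unfolding B_def using norm_triangle_ineq4[of "A (x + h m *\<^sub>R e)" "A x"] by simp
        moreover have "norm (t m *\<^sub>R B m x) \<le> norm (B m x)"
          using t(1,2)[of m] mult_right_mono[of "t m" 1 "norm (B m x)"] by simp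
        ultimately show "norm (A x + t m *\<^sub>R B m x) \<le> 3 * C"
          using norm_triangle_ineq[of "A x" "t m *\<^sub>R B m x"] \<open>norm (A x) \<le> C\<close> by linarith
      qed
      define w where "w x = (C * K1 * norm e) * (K * norm (Z x) * K1)" for x
      show ?thesis
      proof (rule integral_dominated_convergence)
        show "integrable lborel w"
          unfolding w_def by (rule integrable_compact_support[of _ R]) (auto intro!: continuous_intros cz simp: R)
        show "(\<lambda>x. (A x *v e) \<bullet> (newt (A x) k *v Z x)) \<in> borel_measurable lborel"
          by (intro borel_measurable_lborel_continuous continuous_intros matvec.continuous_on cA cz)
        show "(\<lambda>x. ((1 / h m) *\<^sub>R b m x) \<bullet> (newt (A x + t m *\<^sub>R B m x) k *v Z x)) \<in> borel_measurable lborel" for m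
          by (intro borel_measurable_lborel_continuous continuous_intros matvec.continuous_on cA cz cb cB)
        show "AE x in lborel. (\<lambda>m. ((1 / h m) *\<^sub>R b m x) \<bullet> (newt (A x + t m *\<^sub>R B m x) k *v Z x))
            \<longlonglongrightarrow> (A x *v e) \<bullet> (newt (A x) k *v Z x)"
        proof (rule AE_I2)
          fix x
          have "(\<lambda>m. (g (x + h m *\<^sub>R e) - g x) /\<^sub>R h m) \<longlonglongrightarrow> A x *v e"
            by (rule has_derivative_sequence[OF dg h0]) (use h in \<open>simp add: less_imp_neq[symmetric]\<close>)
          then have 1: "(\<lambda>m. (1 / h m) *\<^sub>R b m x) \<longlonglongrightarrow> A x *v e" by (simp add: b_def divide_inverse)
          have "isCont A x" using cA by (simp add: continuous_on_eq_continuous_at)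
          moreover have "(\<lambda>m. x + h m *\<^sub>R e) \<longlonglongrightarrow> x"
            using tendsto_add[OF tendsto_const tendsto_scaleR[OF h0 tendsto_const], of x e] by simp
          ultimately have "(\<lambda>m. A (x + h m *\<^sub>R e)) \<longlonglongrightarrow> A x" by (rule isCont_tendsto_compose)
          then have B0: "(\<lambda>m. B m x) \<longlonglongrightarrow> 0" by (simp add: B_def LIM_zero_iff)
          have "(\<lambda>m. t m *\<^sub>R B m x) \<longlonglongrightarrow> 0"
          proof (rule Lim_null_comparison[OF _ tendsto_norm_zero[OF B0]], rule always_eventually, rule allI)
            fix m show "norm (t m *\<^sub>R B m x) \<le> norm (B m x)"
              using t(1,2)[of m] mult_right_mono[of "t m" 1 "norm (B m x)"] by simp
          qed
          then have "(\<lambda>m. A x + t m *\<^sub>R B m x) \<longlonglongrightarrow> A x" using tendsto_add[OF tendsto_const, of _ 0 _ "A x"] by force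
          moreover have "isCont (\<lambda>M :: real^'n^'n. newt M k) (A x)"
          proof -
            have "continuous_on UNIV (\<lambda>M :: real^'n^'n. newt M k)" by (intro continuous_intros)
            then show ?thesis by (simp add: continuous_on_eq_continuous_at)
          qed
          ultimately have 2: "(\<lambda>m. newt (A x + t m *\<^sub>R B m x) k) \<longlonglongrightarrow> newt (A x) k"
            using isCont_tendsto_compose by blast
          show "(\<lambda>m. ((1 / h m) *\<^sub>R b m x) \<bullet> (newt (A x + t m *\<^sub>R B m x) k *v Z x))
              \<longlonglongrightarrow> (A x *v e) \<bullet> (newt (A x) k *v Z x)"
            by (intro tendsto_inner 1 matvec.tendsto 2 tendsto_const)
        qed
        show "AE x in lborel. norm (((1 / h m) *\<^sub>R b m x) \<bullet> (newt (A x + t m *\<^sub>R B m x) k *v Z x)) \<le> w x" for m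
        proof (rule AE_I2)
          fix x
          show "norm (((1 / h m) *\<^sub>R b m x) \<bullet> (newt (A x + t m *\<^sub>R B m x) k *v Z x)) \<le> w x"
          proof (cases "norm x \<le> R")
            case True
            have "norm (newt (A x + t m *\<^sub>R B m x) k *v Z x) \<le> norm (newt (A x + t m *\<^sub>R B m x) k) * norm (Z x) * K1"
              by (rule K1(2))
            also have "\<dots> \<le> K * norm (Z x) * K1" using nb[OF True] K1(1) by (intro mult_right_mono) auto
            finally have 3: "norm (newt (A x + t m *\<^sub>R B m x) k *v Z x) \<le> K * norm (Z x) * K1" .
            have "norm (((1 / h m) *\<^sub>R b m x) \<bullet> (newt (A x + t m *\<^sub>R B m x) k *v Z x))
              \<le> norm ((1 / h m) *\<^sub>R b m x) * norm (newt (A x + t m *\<^sub>R B m x) k *v Z x)"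
              unfolding real_norm_def by (rule Cauchy_Schwarz_ineq2)
            also have "\<dots> \<le> w x" unfolding w_def
              by (rule mult_mono[OF bb[OF True] 3]) (use C K1 in auto)
            finally show ?thesis .
          next
            case False
            then show ?thesis using R(3)[of x] by (simp add: w_def)
          qed
        qed
      qed
    qed
    then have "(\<lambda>m. LINT x|lborel. sg (A x) (Suc k) * ((z (x - h m *\<^sub>R e) - z x) / h m))
        \<longlonglongrightarrow> - (LINT x|lborel. (A x *v e) \<bullet> (newt (A x) k *v Z x))"
      unfolding t(3) by (rule tendsto_minus)
    ultimately have eq: "(LINT x|lborel. - (sg (A x) (Suc k) * (Z x \<bullet> e)))
        = - (LINT x|lborel. (A x *v e) \<bullet> (newt (A x) k *v Z x))" by (rule LIMSEQ_unique)
    \<comment> \<open>The two limits just identified are the two terms in the recursion of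
      \<open>newt\<close>.\<close>
    have "(newt (A x) (Suc k) *v Z x) \<bullet> e = sg (A x) (Suc k) * (Z x \<bullet> e) - (A x *v e) \<bullet> (newt (A x) k *v Z x)" for x
    proof -
      have "(A x *v e) \<bullet> (newt (A x) k *v Z x) = e \<bullet> (A x *v (newt (A x) k *v Z x))"
        by (simp add: symmetric_inner[OF symA])
      also have "\<dots> = e \<bullet> ((newt (A x) k ** A x) *v Z x)" by (simp add: matrix_vector_mul_assoc newt_commute)
      finally show ?thesis
        by (simp add: newt_Suc matvec.diff_left matvec.scaleR_left inner_diff_right inner_commute[of _ e])
    qed
    moreover have "integrable lborel (\<lambda>x. sg (A x) (Suc k) * (Z x \<bullet> e))"
      by (rule integrable_compact_support[of _ R]) (auto intro!: continuous_intros cA cz simp: R)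
    moreover have "integrable lborel (\<lambda>x. (A x *v e) \<bullet> (newt (A x) k *v Z x))"
      by (rule integrable_compact_support[of _ R]) (auto intro!: continuous_intros matvec.continuous_on cA cz simp: R)
    moreover have "(LINT x|lborel. newt (A x) (Suc k) *v Z x) \<bullet> e = (LINT x|lborel. (newt (A x) (Suc k) *v Z x) \<bullet> e)"
      using iN by simp
    ultimately show ?thesis using eq by simp
  qed
  then show ?case using inner_eq_zero_iff by blast
qed

subsection \<open>Integral identities for solutions\<close>

definition C1 :: "(real^'n \<Rightarrow> real) \<Rightarrow> (real^'n \<Rightarrow> real^'n) \<Rightarrow> bool" where
  "C1 f F \<longleftrightarrow> (\<forall>x. (f has_derivative (\<lambda>h. F x \<bullet> h)) (at x)) \<and> continuous_on UNIV F"

lemma C1_continuous: "C1 f F \<Longrightarrow> continuous_on UNIV f" "C1 f F \<Longrightarrow> continuous_on UNIV F"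
  unfolding C1_def by (meson continuous_at_imp_continuous_on has_derivative_continuous)+

lemma C1_mult:
  assumes "C1 f F" "C1 g G"
  shows "C1 (\<lambda>x. f x * g x) (\<lambda>x. f x *\<^sub>R G x + g x *\<^sub>R F x)"
  unfolding C1_def
proof (intro conjI allI)
  fix x
  show "((\<lambda>x. f x * g x) has_derivative (\<lambda>h. (f x *\<^sub>R G x + g x *\<^sub>R F x) \<bullet> h)) (at x)"
    using assms by (auto simp: C1_def inner_add_left algebra_simps intro!: derivative_eq_intros)
  show "continuous_on UNIV (\<lambda>x. f x *\<^sub>R G x + g x *\<^sub>R F x)"
    by (intro continuous_intros C1_continuous[OF assms(1)] C1_continuous[OF assms(2)])
qed

lemma C1c_eq: "C1c z Z \<longleftrightarrow> C1 z Z \<and> (\<exists>R. \<forall>x. norm x > R \<longrightarrow> z x = 0)"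
  by (auto simp: C1c_def C1_def)

lemma C1c_mult:
  assumes "C1c f F" "C1 g G"
  shows "C1c (\<lambda>x. f x * g x) (\<lambda>x. f x *\<^sub>R G x + g x *\<^sub>R F x)"
  using C1_mult[of f F g G] assms unfolding C1c_eq by fastforce

text \<open>\<open>A\<close> is minus the Hessian of \<open>u\<close>. Strict positivity and the
  open cone are assumed because solutions with a zero are treated by the strong maximum
  principle.\<close>

locale hessian_solution =
  fixes u :: "real^'n \<Rightarrow> real" and Du :: "real^'n \<Rightarrow> real^'n" and A :: "real^'n \<Rightarrow> real^'n^'n" and k :: nat
  assumes u_pos: "\<And>x. u x > 0"
    and deriv_u: "\<And>x. (u has_derivative (\<lambda>h. Du x \<bullet> h)) (at x)"
    and deriv_Du: "\<And>x. (Du has_derivative (\<lambda>h. - (A x *v h))) (at x)"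
    and cont_A: "continuous_on UNIV A"
    and cone_A: "\<And>x. A x \<in> cone k"
    and k2: "k \<ge> 2" and nk: "CARD('n) > 4 * k"
    and eqn: "\<And>x. sg (A x) k = u x powr (real k * (real CARD('n) + 2) / (real CARD('n) - 2 * real k))"
begin

definition N :: real where "N = real CARD('n)"
text \<open>The power for which \<open>u powr (-\<kappa>)\<close> is a quadratic polynomial when
  \<open>u\<close> has the form claimed in the theorem.\<close>

definition \<kappa> :: real where "\<kappa> = 2 * real k / (N - 2 * real k)"
definition p :: real where "p = real k * (N + 2) / (N - 2 * real k)"

abbreviation rho :: "real^'n \<Rightarrow> real" where "rho x \<equiv> Du x \<bullet> Du x"
abbreviation T :: "nat \<Rightarrow> real^'n \<Rightarrow> real^'n^'n" where "T j x \<equiv> newt (A x) j"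
abbreviation s :: "nat \<Rightarrow> real^'n \<Rightarrow> real" where "s j x \<equiv> sg (A x) j"

lemma u_ne: "u x \<noteq> 0"
  using u_pos[of x] by simp

lemma N: "N > 4 * real k" "real k \<ge> 2" "N > 0"
  using nk k2 by (auto simp: N_def)

lemma N_kappa: "(N - 2 * real k) * \<kappa> = 2 * real k"
  using N by (simp add: \<kappa>_def)

lemma kappa: "0 < \<kappa>" "\<kappa> < 1"
  using N by (auto simp: \<kappa>_def)

lemma N_p: "(N - 2 * real k) * p = real k * (N + 2)"
  using N by (simp add: p_def)

lemma p_kappa: "p - \<kappa> = \<kappa> * N / 2"
proof -
  have "real k * (N + 2) - 2 * real k = real k * N" by (simp add: algebra_simps)
  moreover have "2 * real k / D * N / 2 = real k * N / D" for D by simp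
  ultimately show ?thesis unfolding p_def \<kappa>_def diff_divide_distrib[symmetric] by (simp only:)
qed

lemma eqn': "s k x = u x powr p"
  by (simp add: eqn p_def N_def)

lemma symA: "transpose (A x) = A x"
  using cone_A[of x] by (simp add: cone_def)

lemma s_pos: "j \<le> k \<Longrightarrow> s j x > 0"
  using cone_A[of x] by (simp add: cone_def)

lemma C1_u: "C1 u Du"
proof -
  have "continuous_on UNIV Du"
    using deriv_Du by (meson continuous_at_imp_continuous_on has_derivative_continuous)
  then show ?thesis using deriv_u by (simp add: C1_def)
qed

lemma cont_u: "continuous_on UNIV u" and cont_Du: "continuous_on UNIV Du"
  using C1_continuous[OF C1_u] by auto

lemma cont_upow: "continuous_on UNIV (\<lambda>x. u x powr a)"
  by (intro continuous_on_powr continuous_intros cont_u) (auto simp: u_ne)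

lemmas conts = continuous_intros matvec.continuous_on cont_u cont_Du cont_upow cont_A

lemma C1_upow: "C1 (\<lambda>x. u x powr a) (\<lambda>x. (a * u x powr (a - 1)) *\<^sub>R Du x)"
  unfolding C1_def
proof (intro conjI allI)
  fix x
  have "((\<lambda>t. t powr a) has_real_derivative a * u x powr (a - 1)) (at (u x))"
    using u_pos[of x] by (rule has_real_derivative_powr)
  from has_derivative_compose[OF deriv_u this[unfolded has_field_derivative_def]]
  show "((\<lambda>x. u x powr a) has_derivative (\<lambda>h. ((a * u x powr (a - 1)) *\<^sub>R Du x) \<bullet> h)) (at x)"
    by simp
qed (intro conts)

lemma C1_rho: "C1 (\<lambda>x. rho x ^ i) (\<lambda>x. - (2 * real i * rho x ^ (i - 1)) *\<^sub>R (A x *v Du x))"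
  unfolding C1_def
proof (intro conjI allI)
  fix x
  have r: "(rho has_derivative (\<lambda>h. - 2 * ((A x *v Du x) \<bullet> h))) (at x)"
    using has_derivative_inner[OF deriv_Du deriv_Du, of x]
    by (simp add: inner_commute[of _ "Du x"] symmetric_inner[OF symA])
  show "((\<lambda>x. rho x ^ i) has_derivative (\<lambda>h. (- (2 * real i * rho x ^ (i - 1)) *\<^sub>R (A x *v Du x)) \<bullet> h)) (at x)"
    using has_derivative_power[OF r, of i] by (simp add: mult_ac)
qed (intro conts)

lemma integrable_cs:
  assumes "continuous_on UNIV f" "\<And>x. norm x > R \<Longrightarrow> f x = 0"
  shows "integrable lborel (f :: real^'n \<Rightarrow> real)"
  by (rule integrable_compact_support[OF assms])

text \<open>The divergence theorem for \<open>T j x *v Du x\<close>, whose divergence is formally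
  minus the trace of \<open>T j x ** A x\<close>. No third derivatives of \<open>u\<close> appear in
  the weak form.\<close>

lemma basic_identity:
  assumes z: "C1c z Z"
  shows "real (Suc j) * (LINT x|lborel. z x * s (Suc j) x) = (LINT x|lborel. Du x \<bullet> (T j x *v Z x))"
proof -
  have f: "C1f (\<lambda>x. - Du x) A"
    unfolding C1f_def using deriv_Du cont_A symA has_derivative_minus[OF deriv_Du] by simp
  have "(LINT x|lborel. z x * trace (T j x ** (- A x))) = - (LINT x|lborel. Du x \<bullet> (T j x *v Z x))"
  proof (rule newt_segment_by_parts[OF newt_divergence_free[OF f] cont_A z])
    show "(Du has_derivative (*v) (- A x)) (at x)" for x
    proof -
      have "(*v) (- A x) = (\<lambda>h. - (A x *v h))" by (simp add: fun_eq_iff matvec.minus_left)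
      then show ?thesis using deriv_Du[of x] by simp
    qed
    show "continuous_on UNIV (\<lambda>x. - A x)" by (intro continuous_intros cont_A)
    show "transpose (- A x) = - A x" for x using symA[of x] by (simp add: vec_eq_iff transpose_def)
  qed
  moreover have "z x * trace (T j x ** (- A x)) = - (real (Suc j) * (z x * s (Suc j) x))" for x
    by (simp add: matmul.minus_right linear_neg[OF bounded_linear.linear[OF bounded_linear_trace]]
        trace_newt_mult del: of_nat_Suc)
  ultimately show ?thesis by simp
qed

text \<open>\<open>basic_identity\<close> is tested with
  \<open>z x * u x powr a * rho x ^ i\<close>. The gradient of \<open>rho\<close> is -2 times
  \<open>A x *v Du x\<close>, and \<open>T j x ** A x\<close> equals \<open>s (j + 1) x\<close>
  times the identity minus \<open>T (j + 1) x\<close>; the first part moves to the left and creates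
  the factor \<open>j + 1 + 2 * i\<close>. For \<open>i = 0\<close> the truncated exponent
  \<open>i - 1\<close> is multiplied by zero.\<close>

lemma general_identity:
  assumes X: "C1c z Z"
  shows "real (j + 1 + 2 * i) * (LINT x|lborel. z x * u x powr a * rho x ^ i * s (j + 1) x) =
    a * (LINT x|lborel. z x * u x powr (a - 1) * rho x ^ i * (Du x \<bullet> (T j x *v Du x)))
    + 2 * real i * (LINT x|lborel. z x * u x powr a * rho x ^ (i - 1) * (Du x \<bullet> (T (j + 1) x *v Du x)))
    + (LINT x|lborel. u x powr a * rho x ^ i * (Du x \<bullet> (T j x *v Z x)))"
proof -
  obtain R where R: "\<And>x. norm x > R \<Longrightarrow> z x = 0" "\<And>x. norm x > R \<Longrightarrow> Z x = 0"
    using C1c_support[OF X] by metis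
  have cz: "continuous_on UNIV z" "continuous_on UNIV Z" using C1c_continuous[OF X] X by (auto simp: C1c_def)
  have t: "C1c (\<lambda>x. z x * (u x powr a * rho x ^ i))
      (\<lambda>x. z x *\<^sub>R (u x powr a *\<^sub>R (- (2 * real i * rho x ^ (i - 1)) *\<^sub>R (A x *v Du x))
        + rho x ^ i *\<^sub>R ((a * u x powr (a - 1)) *\<^sub>R Du x)) + (u x powr a * rho x ^ i) *\<^sub>R Z x)"
    by (rule C1c_mult[OF X C1_mult[OF C1_upow C1_rho]])
  let ?I = "\<lambda>x. z x * u x powr a * rho x ^ i * s (j + 1) x"
  let ?L = "\<lambda>x. z x * u x powr (a - 1) * rho x ^ i * (Du x \<bullet> (T j x *v Du x))"
  let ?M = "\<lambda>x. z x * u x powr a * rho x ^ (i - 1) * (Du x \<bullet> (T (j + 1) x *v Du x))"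
  let ?B = "\<lambda>x. u x powr a * rho x ^ i * (Du x \<bullet> (T j x *v Z x))"
  have int: "integrable lborel ?I" "integrable lborel ?L" "integrable lborel ?M" "integrable lborel ?B"
    by (rule integrable_cs[of _ R], (intro conts cz), simp add: R)+
  have "Du x \<bullet> (T j x *v (z x *\<^sub>R (u x powr a *\<^sub>R (- (2 * real i * rho x ^ (i - 1)) *\<^sub>R (A x *v Du x))
        + rho x ^ i *\<^sub>R ((a * u x powr (a - 1)) *\<^sub>R Du x)) + (u x powr a * rho x ^ i) *\<^sub>R Z x))
    = a * ?L x + 2 * real i * ?M x + ?B x - 2 * real i * ?I x" for x
  proof -
    have "T j x *v (A x *v Du x) = s (j + 1) x *\<^sub>R Du x - T (j + 1) x *v Du x"
      by (simp add: matrix_vector_mul_assoc newt_Suc matvec.diff_left matvec.scaleR_left)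
    then have 1: "Du x \<bullet> (T j x *v (A x *v Du x)) = s (j + 1) x * rho x - Du x \<bullet> (T (j + 1) x *v Du x)"
      by (simp add: inner_diff_right)
    have 2: "real i * rho x ^ i = real i * (rho x ^ (i - 1) * rho x)"
      by (cases i) auto
    have "Du x \<bullet> (T j x *v (z x *\<^sub>R (u x powr a *\<^sub>R (- (2 * real i * rho x ^ (i - 1)) *\<^sub>R (A x *v Du x))
        + rho x ^ i *\<^sub>R ((a * u x powr (a - 1)) *\<^sub>R Du x)) + (u x powr a * rho x ^ i) *\<^sub>R Z x))
      = - 2 * z x * u x powr a * (real i * rho x ^ (i - 1)) * (Du x \<bullet> (T j x *v (A x *v Du x))) + a * ?L x + ?B x"
      by (simp add: matvec.add_right matvec.scaleR_right matvec.minus_right inner_add_right algebra_simps)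
    also have "\<dots> = - 2 * z x * u x powr a * s (j + 1) x * (real i * (rho x ^ (i - 1) * rho x))
        + 2 * real i * ?M x + a * ?L x + ?B x"
      unfolding 1 by (simp add: algebra_simps)
    also have "\<dots> = a * ?L x + 2 * real i * ?M x + ?B x - 2 * real i * ?I x"
      unfolding 2[symmetric] by (simp add: algebra_simps)
    finally show ?thesis .
  qed
  then have "real (Suc j) * (LINT x|lborel. ?I x) = (LINT x|lborel. a * ?L x + 2 * real i * ?M x + ?B x - 2 * real i * ?I x)"
    using basic_identity[OF t, of j] by (simp add: mult.assoc)
  also have "\<dots> = a * (LINT x|lborel. ?L x) + 2 * real i * (LINT x|lborel. ?M x) + (LINT x|lborel. ?B x)
      - 2 * real i * (LINT x|lborel. ?I x)"
    using int by simp
  finally show ?thesis by (simp add: algebra_simps)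
qed

lemma choose_ratio:
  "real (CARD('n) - 1 choose k) = real (CARD('n) choose k) * (N - real k) / N"
  "real (CARD('n) - 1 choose (k - 1)) = real (CARD('n) choose k) * real k / N"
  "real (CARD('n) choose (k + 1)) = real (CARD('n) choose k) * (N - real k) / (real k + 1)"
  "real (CARD('n) choose k) > 0"
proof -
  show "real (CARD('n) - 1 choose k) = real (CARD('n) choose k) * (N - real k) / N"
    using choose_minus_1_real(1)[of "CARD('n)" k] N by (simp add: N_def[symmetric] field_simps)
  show "real (CARD('n) - 1 choose (k - 1)) = real (CARD('n) choose k) * real k / N"
    using choose_minus_1_real(2)[of "CARD('n)" "k - 1"] N k2 by (simp add: N_def[symmetric] field_simps of_nat_diff)
  show "real (CARD('n) choose (k + 1)) = real (CARD('n) choose k) * (N - real k) / (real k + 1)"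
    using choose_Suc_real[of k "CARD('n)"] nk by (simp add: N_def[symmetric] field_simps)
  show "real (CARD('n) choose k) > 0" using nk by simp
qed

abbreviation Q :: "real^'n \<Rightarrow> real" where "Q x \<equiv> defect k (A x) (Du x) (\<kappa> / u x)"
abbreviation V :: "real^'n \<Rightarrow> real^'n" where "V x \<equiv> flux k (A x) (Du x) (\<kappa> / u x)"

text \<open>Three instances of \<open>general_identity\<close> are combined. The equation is used to
  read \<open>u x powr (p - \<kappa>)\<close> as \<open>u x powr (-\<kappa>) * s k x\<close>, which
  lets the identity for \<open>s 1\<close> produce the quadratic term of the defect.\<close>

lemma defect_identity:
  assumes z: "C1c z Z"
  shows "(LINT x|lborel. z x * u x powr (-\<kappa>) * Q x) = - (LINT x|lborel. u x powr (-\<kappa>) * (Z x \<bullet> V x))"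
proof -
  obtain R where R: "\<And>x. norm x > R \<Longrightarrow> z x = 0" "\<And>x. norm x > R \<Longrightarrow> Z x = 0"
    using C1c_support[OF z] by metis
  have cz: "continuous_on UNIV z" "continuous_on UNIV Z" using C1c_continuous[OF z] z by (auto simp: C1c_def)
  define C where "C = real (CARD('n) choose k)"
  define kk where "kk = real k"
  have C: "C > 0" using choose_ratio(4) by (simp add: C_def)
  note cr = choose_ratio[folded C_def kk_def]
  have Nk: "N > 4 * kk" "kk \<ge> 2" using N by (auto simp: kk_def)
  let ?f1 = "\<lambda>x. z x * u x powr (-\<kappa>) * s 1 x * s k x"
  let ?f2 = "\<lambda>x. z x * u x powr (-\<kappa>) * s (k + 1) x"
  let ?f3 = "\<lambda>x. z x * u x powr (-\<kappa> - 1) * (Du x \<bullet> (T k x *v Du x))"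
  let ?f4 = "\<lambda>x. z x * u x powr (-\<kappa> - 1) * s k x * rho x"
  let ?f5 = "\<lambda>x. z x * u x powr (-\<kappa> - 2) * rho x * (Du x \<bullet> (T (k - 1) x *v Du x))"
  let ?g1 = "\<lambda>x. u x powr (-\<kappa>) * (Du x \<bullet> (T k x *v Z x))"
  let ?g2 = "\<lambda>x. u x powr (-\<kappa> - 1) * rho x * (Du x \<bullet> (T (k - 1) x *v Z x))"
  let ?g3 = "\<lambda>x. u x powr (-\<kappa>) * s k x * (Du x \<bullet> Z x)"
  have int: "integrable lborel ?f1" "integrable lborel ?f2" "integrable lborel ?f3" "integrable lborel ?f4"
    "integrable lborel ?f5" "integrable lborel ?g1" "integrable lborel ?g2" "integrable lborel ?g3"
    by (rule integrable_cs[of _ R], (intro conts cz), simp add: R)+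
  define I1 I2 I3 I4 I5 G1 G2 G3 where
    "I1 = (LINT x|lborel. ?f1 x)" and "I2 = (LINT x|lborel. ?f2 x)" and "I3 = (LINT x|lborel. ?f3 x)"
    and "I4 = (LINT x|lborel. ?f4 x)" and "I5 = (LINT x|lborel. ?f5 x)"
    and "G1 = (LINT x|lborel. ?g1 x)" and "G2 = (LINT x|lborel. ?g2 x)" and "G3 = (LINT x|lborel. ?g3 x)"
  have pw: "u x powr (p - \<kappa>) = u x powr (-\<kappa>) * s k x" "u x powr (p - \<kappa> - 1) = u x powr (-\<kappa> - 1) * s k x" for x
    by (simp_all add: eqn' algebra_simps flip: powr_add)
  have i2: "(kk + 1) * I2 = - \<kappa> * I3 + G1"
    using general_identity[OF z, of k 0 "-\<kappa>"]
    by (simp add: I2_def I3_def G1_def kk_def mult.assoc add.commute)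
  have e12: "-\<kappa> - 1 - 1 = -\<kappa> - 2" by simp
  have i4: "(2 + kk) * I4 = (- \<kappa> - 1) * I5 + 2 * I3 + G2"
    using general_identity[OF z, of "k - 1" 1 "-\<kappa> - 1"] k2
    unfolding e12 by (simp add: I4_def I5_def I3_def G2_def kk_def mult_ac of_nat_diff)
  have i1: "I1 = (p - \<kappa>) * I4 + G3"
    using general_identity[OF z, of 0 0 "p - \<kappa>"] unfolding pw
    by (simp add: I1_def I4_def G3_def mult_ac)
  have "z x * u x powr (-\<kappa>) * Q x = 1 / C * ?f1 x - N / (C * (N - kk) / (kk + 1)) * ?f2 x
      - N * \<kappa> / kk * (1 / (C * (N - kk) / N) * ?f3 x - 1 / C * ?f4 x)
      + N * \<kappa>\<^sup>2 / (4 * kk) * (1 / (C * kk / N)) * ?f5 x" for x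
  proof -
    have u1: "u x powr (-\<kappa> - 1) = u x powr (-\<kappa>) / u x"
      using u_pos[of x] by (simp add: powr_diff)
    have u2: "u x powr (-\<kappa> - 2) = u x powr (-\<kappa>) / (u x)\<^sup>2"
      using u_pos[of x] by (simp add: powr_diff powr_numeral)
    have N1: "N * sgh (A x) 1 = s 1 x" using N by (simp add: sgh_def N_def)
    have Q: "Q x = (N * sgh (A x) 1) * (s k x / C) - N * (s (k + 1) x / (C * (N - kk) / (kk + 1)))
        - N * (\<kappa> / u x) / kk * (1 / (C * (N - kk) / N) * (Du x \<bullet> (T k x *v Du x)) - s k x / C * rho x)
        + N * (\<kappa> / u x)\<^sup>2 / (4 * kk) * rho x * (1 / (C * kk / N) * (Du x \<bullet> (T (k - 1) x *v Du x)))"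
      unfolding defect_def sgh_def newth_def cr(1,2,3) N_def[symmetric] C_def[symmetric] kk_def[symmetric]
      by (simp add: matvec.scaleR_left algebra_simps)
    show ?thesis unfolding Q N1 u1 u2 using u_pos[of x] by (simp add: algebra_simps power_divide)
  qed
  then have "(LINT x|lborel. z x * u x powr (-\<kappa>) * Q x) = 1 / C * I1 - N / (C * (N - kk) / (kk + 1)) * I2
      - N * \<kappa> / kk * (1 / (C * (N - kk) / N) * I3 - 1 / C * I4)
      + N * \<kappa>\<^sup>2 / (4 * kk) * (1 / (C * kk / N)) * I5"
    using int by (simp add: I1_def I2_def I3_def I4_def I5_def)
  also have "\<dots> = - (1 / (C * (N - kk) / N) * G1 - 1 / C * G3 - \<kappa> / 2 * (1 / (C * kk / N)) * G2)"
  proof -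
    have k1: "\<kappa> = 2 * kk / (N - 2 * kk)" by (simp add: \<kappa>_def kk_def)
    have p1: "p - \<kappa> = \<kappa> * N / 2" by (rule p_kappa)
    have g1: "G1 = (kk + 1) * I2 + \<kappa> * I3" using i2 by simp
    have g2: "G2 = (kk + 2) * I4 + (1 + \<kappa>) * I5 - 2 * I3" using i4 by (simp add: algebra_simps)
    have g3: "G3 = I1 - \<kappa> * N / 2 * I4" using i1 unfolding p1 by simp
    define a b c where "a = 1 / C" and "b = 1 / (N - kk)" and "c = 1 / kk"
    have bc: "b * (N - kk) = 1" "c * kk = 1" using Nk by (auto simp: b_def c_def)
    have r: "N / (C * (N - kk) / (kk + 1)) = a * (N * (kk + 1) * b)" "1 / (C * (N - kk) / N) = a * (N * b)"
      "1 / (C * kk / N) = a * (N * c)" "N * \<kappa> / kk = N * \<kappa> * c" "N * \<kappa>\<^sup>2 / (4 * kk) = N * \<kappa>\<^sup>2 * c / 4"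
      by (simp_all add: a_def b_def c_def)
    \<comment> \<open>Three integrals occur both in the defect and in the identities for the flux
      terms. Their total coefficients vanish; the last one does so because 1 + \<kappa> = N \<kappa>
      / (2 k).\<close>
    have c3: "- (N * N * \<kappa> * c * b) + N * \<kappa> * b + \<kappa> * N * c = 0"
    proof -
      have "- (N * N * \<kappa> * c * b) + N * \<kappa> * b + \<kappa> * N * c =
          N * \<kappa> * (b * (1 - c * kk) + c * (1 - b * (N - kk)))" by (simp add: algebra_simps)
      then show ?thesis by (simp add: bc)
    qed
    have c4: "N * \<kappa> * c + \<kappa> * N / 2 - \<kappa> * N * c * (kk + 2) / 2 = 0"
    proof -
      have "N * \<kappa> * c + \<kappa> * N / 2 - \<kappa> * N * c * (kk + 2) / 2 = \<kappa> * N / 2 * (1 - c * kk)"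
        by (simp add: algebra_simps)
      then show ?thesis by (simp add: bc)
    qed
    have c5: "N * \<kappa>\<^sup>2 * c / 4 * (N * c) - \<kappa> / 2 * (N * c) * (1 + \<kappa>) = 0"
    proof -
      have "1 + \<kappa> = N * \<kappa> / (2 * kk)" unfolding k1 using Nk by (simp add: field_simps)
      then have "1 + \<kappa> = N * \<kappa> * c / 2" by (simp add: c_def)
      then show ?thesis by (simp add: power2_eq_square)
    qed
    have "1 / C * I1 - N / (C * (N - kk) / (kk + 1)) * I2
      - N * \<kappa> / kk * (1 / (C * (N - kk) / N) * I3 - 1 / C * I4)
      + N * \<kappa>\<^sup>2 / (4 * kk) * (1 / (C * kk / N)) * I5
      + (1 / (C * (N - kk) / N) * G1 - 1 / C * G3 - \<kappa> / 2 * (1 / (C * kk / N)) * G2)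
      = a * (I3 * (- (N * N * \<kappa> * c * b) + N * \<kappa> * b + \<kappa> * N * c)
        + I4 * (N * \<kappa> * c + \<kappa> * N / 2 - \<kappa> * N * c * (kk + 2) / 2)
        + I5 * (N * \<kappa>\<^sup>2 * c / 4 * (N * c) - \<kappa> / 2 * (N * c) * (1 + \<kappa>)))"
      unfolding r g1 g2 g3 a_def[symmetric] by (simp add: algebra_simps add_divide_distrib)
    then show ?thesis unfolding c3 c4 c5 by simp
  qed
  also have "1 / (C * (N - kk) / N) * G1 - 1 / C * G3 - \<kappa> / 2 * (1 / (C * kk / N)) * G2
      = (LINT x|lborel. 1 / (C * (N - kk) / N) * ?g1 x - 1 / C * ?g3 x - \<kappa> / 2 * (1 / (C * kk / N)) * ?g2 x)"
    using int by (simp add: G1_def G2_def G3_def)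
  also have "(\<lambda>x. 1 / (C * (N - kk) / N) * ?g1 x - 1 / C * ?g3 x - \<kappa> / 2 * (1 / (C * kk / N)) * ?g2 x)
      = (\<lambda>x. u x powr (-\<kappa>) * (Z x \<bullet> V x))"
  proof
    fix x
    have u1: "u x powr (-\<kappa> - 1) = u x powr (-\<kappa>) / u x"
      using u_pos[of x] by (simp add: powr_diff)
    have sw: "Du x \<bullet> (T j x *v Z x) = Z x \<bullet> (T j x *v Du x)" for j
      using symmetric_inner[OF transpose_newt[OF symA], of "Du x"] by (simp add: inner_commute)
    have ZV: "Z x \<bullet> V x = 1 / (C * (N - kk) / N) * (Z x \<bullet> (T k x *v Du x)) - s k x / C * (Z x \<bullet> Du x)
        - \<kappa> / u x / 2 * rho x * (1 / (C * kk / N) * (Z x \<bullet> (T (k - 1) x *v Du x)))"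
      unfolding flux_def sgh_def newth_def cr(1,2) C_def[symmetric]
      by (simp add: inner_diff_right matvec.scaleR_left)
    show "1 / (C * (N - kk) / N) * ?g1 x - 1 / C * ?g3 x - \<kappa> / 2 * (1 / (C * kk / N)) * ?g2 x
        = u x powr (-\<kappa>) * (Z x \<bullet> V x)"
      unfolding u1 sw ZV by (simp add: inner_commute[of "Du x" "Z x"] algebra_simps)
  qed
  finally show ?thesis .
qed

lemma cont_sgh: "continuous_on UNIV (\<lambda>x. sgh (A x) j)"
proof -
  have "continuous_on UNIV (\<lambda>x. s j x * inverse (real (CARD('n) choose j)))"
    by (rule continuous_on_mult_right[OF continuous_on_sg[OF cont_A]])
  then show ?thesis by (simp add: sgh_def divide_inverse)
qed

lemma cont_newth: "continuous_on UNIV (\<lambda>x. newth (A x) j)"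
  unfolding newth_def by (rule continuous_on_scaleR[OF continuous_on_const continuous_on_newt[OF cont_A]])

lemma cont_theta: "continuous_on UNIV (\<lambda>x. \<kappa> / u x)"
  by (rule continuous_on_divide[OF continuous_on_const cont_u]) (simp add: u_ne)

lemma cont_Q: "continuous_on UNIV Q"
proof -
  have "continuous_on UNIV (\<lambda>x. a * (sgh (A x) 1 * sgh (A x) k - sgh (A x) (k + 1))
    - a * (\<kappa> / u x) * b * (Du x \<bullet> (newth (A x) k *v Du x) - sgh (A x) k * rho x)
    + a * (\<kappa> / u x)\<^sup>2 * d * rho x * (Du x \<bullet> (newth (A x) (k - 1) *v Du x)))" for a b d :: real
    by (intro continuous_on_add continuous_on_diff continuous_on_mult continuous_on_power continuous_on_inner
        continuous_on_const cont_sgh cont_theta matvec.continuous_on cont_newth cont_Du)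
  from this[of N "1 / real k" "1 / (4 * real k)"] show ?thesis
    unfolding defect_def N_def[symmetric] by simp
qed

lemma cont_V: "continuous_on UNIV V"
proof -
  have "continuous_on UNIV (\<lambda>x. newth (A x) k *v Du x - sgh (A x) k *\<^sub>R Du x
    - ((\<kappa> / u x) * (1 / 2) * rho x) *\<^sub>R (newth (A x) (k - 1) *v Du x))"
    by (intro continuous_on_diff continuous_on_mult continuous_on_inner continuous_on_scaleR
        continuous_on_const cont_sgh cont_theta matvec.continuous_on cont_newth cont_Du)
  then show ?thesis unfolding flux_def by simp
qed

lemma cone_point_A:
  obtains q l where "cone_point (A x) k q l"
proof -
  obtain q l where "eigbasis (A x) q l" using symmetric_eigbasis[OF symA] by blast
  then have "cone_point (A x) k q l" using cone_A[of x] k2 nk by unfold_locales auto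
  then show ?thesis using that by blast
qed

lemma Q_nonneg: "Q x \<ge> 0"
proof -
  obtain q l where "cone_point (A x) k q l" by (rule cone_point_A)
  then show ?thesis by (rule cone_point.defect_nonneg)
qed

lemma T_nonneg: "j < k \<Longrightarrow> \<xi> \<bullet> (T j x *v \<xi>) \<ge> 0"
  by (rule cone_newt_nonneg[OF cone_A])

lemma T_le: "j < k \<Longrightarrow> \<xi> \<bullet> (T j x *v \<xi>) \<le> N * s j x * (\<xi> \<bullet> \<xi>)"
proof -
  assume j: "j < k"
  have "\<xi> \<bullet> (T j x *v \<xi>) \<le> (N - real j) * s j x * (\<xi> \<bullet> \<xi>)"
    using cone_newt_le[OF cone_A j] by (simp add: N_def)
  also have "\<dots> \<le> N * s j x * (\<xi> \<bullet> \<xi>)"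
    using s_pos[of j x] j by (intro mult_right_mono) auto
  finally show ?thesis .
qed

definition Cf :: real where
  "Cf = real k / N * N / real (CARD('n) - 1 choose (k - 1))"

lemma Cf: "Cf \<ge> 0"
  using N by (simp add: Cf_def)

lemma flux_bound: "(\<xi> \<bullet> V x)\<^sup>2 \<le> Cf * rho x * s (k - 1) x * (\<xi> \<bullet> \<xi>) * Q x"
proof -
  obtain q l where "cone_point (A x) k q l" by (rule cone_point_A)
  then have "(\<xi> \<bullet> V x)\<^sup>2 \<le> real k / N * rho x * Q x * (\<xi> \<bullet> (newth (A x) (k - 1) *v \<xi>))"
    unfolding N_def by (rule cone_point.flux_le)
  also have "\<xi> \<bullet> (newth (A x) (k - 1) *v \<xi>) = (\<xi> \<bullet> (T (k - 1) x *v \<xi>)) / real (CARD('n) - 1 choose (k - 1))"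
    by (simp add: newth_def matvec.scaleR_left)
  also have "real k / N * rho x * Q x * \<dots> \<le>
      real k / N * rho x * Q x * (N * s (k - 1) x * (\<xi> \<bullet> \<xi>) / real (CARD('n) - 1 choose (k - 1)))"
    using T_le[of "k - 1" \<xi> x] k2 N Q_nonneg[of x] by (intro mult_left_mono divide_right_mono) auto
  also have "\<dots> = Cf * rho x * s (k - 1) x * (\<xi> \<bullet> \<xi>) * Q x" by (simp add: Cf_def)
  finally show ?thesis .
qed

text \<open>With \<open>z\<^sup>2\<close> as test function the flux enters as
  \<open>2 * z x * (Z x \<bullet> V x)\<close>. By \<open>flux_bound\<close> and the
  arithmetic-geometric mean it costs half of the left side, which is absorbed.\<close>

lemma energy_estimate:
  assumes z: "C1c z Z"
  shows "(LINT x|lborel. (z x)\<^sup>2 * u x powr (-\<kappa>) * Q x)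
    \<le> 4 * Cf * (LINT x|lborel. u x powr (-\<kappa>) * rho x * s (k - 1) x * (Z x \<bullet> Z x))"
proof -
  obtain R where R: "\<And>x. norm x > R \<Longrightarrow> z x = 0" "\<And>x. norm x > R \<Longrightarrow> Z x = 0"
    using C1c_support[OF z] by metis
  have cz: "continuous_on UNIV z" "continuous_on UNIV Z" using C1c_continuous[OF z] z by (auto simp: C1c_def)
  have zz: "C1c (\<lambda>x. z x * z x) (\<lambda>x. z x *\<^sub>R Z x + z x *\<^sub>R Z x)"
    using C1c_mult[OF z, of z Z] z by (simp add: C1c_eq)
  let ?E = "\<lambda>x. (z x)\<^sup>2 * u x powr (-\<kappa>) * Q x"
  let ?W = "\<lambda>x. u x powr (-\<kappa>) * rho x * s (k - 1) x * (Z x \<bullet> Z x)"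
  have iE: "integrable lborel ?E" by (rule integrable_cs[of _ R], intro conts cz cont_Q, simp add: R)
  have iW: "integrable lborel ?W" by (rule integrable_cs[of _ R], intro conts cz cont_Q, simp add: R)
  have iV: "integrable lborel (\<lambda>x. u x powr (-\<kappa>) * ((z x *\<^sub>R Z x + z x *\<^sub>R Z x) \<bullet> V x))"
    by (rule integrable_cs[of _ R], intro conts cz cont_V, simp add: R)
  have "(LINT x|lborel. ?E x) = (LINT x|lborel. - (u x powr (-\<kappa>) * ((z x *\<^sub>R Z x + z x *\<^sub>R Z x) \<bullet> V x)))"
    using defect_identity[OF zz] by (simp add: power2_eq_square)
  also have "\<dots> \<le> (LINT x|lborel. 1 / 2 * ?E x + 2 * Cf * ?W x)"
  proof (rule integral_mono)
    fix x
    define K where "K = Cf * rho x * s (k - 1) x * (Z x \<bullet> Z x)"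
    have K: "K \<ge> 0" using Cf s_pos[of "k - 1" x] by (simp add: K_def)
    have "(2 * (z x * (Z x \<bullet> V x)))\<^sup>2 \<le> 4 * (z x)\<^sup>2 * (K * Q x)"
      using flux_bound[of "Z x" x] mult_left_mono[of "(Z x \<bullet> V x)\<^sup>2" "K * Q x" "4 * (z x)\<^sup>2"]
      by (simp add: K_def power_mult_distrib)
    also have "\<dots> \<le> (1 / 2 * ((z x)\<^sup>2 * Q x) + 2 * K)\<^sup>2"
    proof -
      have "(1 / 2 * ((z x)\<^sup>2 * Q x) + 2 * K)\<^sup>2 - 4 * (z x)\<^sup>2 * (K * Q x) = (1 / 2 * ((z x)\<^sup>2 * Q x) - 2 * K)\<^sup>2"
        by (simp add: power2_eq_square algebra_simps)
      then show ?thesis by (metis diff_ge_0_iff_ge zero_le_power2)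
    qed
    finally have "\<bar>2 * (z x * (Z x \<bullet> V x))\<bar> \<le> 1 / 2 * ((z x)\<^sup>2 * Q x) + 2 * K"
      using K Q_nonneg[of x] by (intro power2_le_imp_le[of "\<bar>_\<bar>"]) auto
    then have "- (2 * (z x * (Z x \<bullet> V x))) \<le> 1 / 2 * ((z x)\<^sup>2 * Q x) + 2 * K" by linarith
    have e: "(z x *\<^sub>R Z x + z x *\<^sub>R Z x) \<bullet> V x = 2 * (z x * (Z x \<bullet> V x))"
      by (simp only: inner_add_left inner_scaleR_left mult_2)
    from mult_left_mono[OF \<open>- (2 * (z x * (Z x \<bullet> V x))) \<le> 1 / 2 * ((z x)\<^sup>2 * Q x) + 2 * K\<close>, of "u x powr (-\<kappa>)"]
    show "- (u x powr (-\<kappa>) * ((z x *\<^sub>R Z x + z x *\<^sub>R Z x) \<bullet> V x)) \<le> 1 / 2 * ?E x + 2 * Cf * ?W x"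
      unfolding e by (simp add: K_def algebra_simps)
  qed (use iE iW iV in auto)
  also have "\<dots> = 1 / 2 * (LINT x|lborel. ?E x) + 2 * Cf * (LINT x|lborel. ?W x)"
    using iE iW by simp
  finally show ?thesis by simp
qed

end

subsection \<open>Integral estimates\<close>

text \<open>A power of at least two smooths the corner of the positive part.\<close>

lemma DERIV_max_power:
  assumes "M \<ge> 2"
  shows "((\<lambda>t::real. max 0 t ^ M) has_real_derivative real M * max 0 t ^ (M - 1)) (at t)"
proof -
  obtain M' where M: "M = Suc (Suc M')" using assms by (metis Suc_le_D numeral_2_eq_2 Suc_le_mono)
  consider "t > 0" | "t < 0" | "t = 0" by linarith
  then show ?thesis
  proof cases
    case 1
    have "((\<lambda>t::real. t ^ M) has_real_derivative real M * t ^ (M - 1)) (at t)"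
      using DERIV_pow[of M t] by simp
    then have "((\<lambda>t::real. max 0 t ^ M) has_real_derivative real M * t ^ (M - 1)) (at t)"
      by (rule has_field_derivative_transform_within_open[of _ _ _ "{0<..}"]) (use 1 in auto)
    then show ?thesis using 1 by simp
  next
    case 2
    have "((\<lambda>t::real. 0) has_real_derivative 0) (at t)" by simp
    then have "((\<lambda>t::real. max 0 t ^ M) has_real_derivative 0) (at t)"
      by (rule has_field_derivative_transform_within_open[of _ _ _ "{..<0}"]) (use 2 assms in auto)
    then show ?thesis using 2 by (simp add: M)
  next
    case 3
    have "((\<lambda>y. (max 0 y ^ M - max 0 0 ^ M) / (y - 0)) \<longlongrightarrow> 0) (at (0::real))"
    proof (rule Lim_null_comparison[of _ "\<lambda>y. \<bar>y\<bar> ^ (M - 1)"])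
      show "\<forall>\<^sub>F y in at 0. norm ((max 0 y ^ M - max 0 0 ^ M) / (y - 0)) \<le> \<bar>y::real\<bar> ^ (M - 1)"
      proof (rule always_eventually, rule allI)
        fix y :: real
        have "\<bar>max 0 y ^ M\<bar> = max 0 y ^ M" by simp
        also have "\<dots> \<le> \<bar>y\<bar> ^ M" by (intro power_mono) auto
        also have "\<dots> = \<bar>y\<bar> ^ (M - 1) * \<bar>y\<bar>" by (simp add: M)
        finally have "\<bar>max 0 y ^ M\<bar> \<le> \<bar>y\<bar> ^ (M - 1) * \<bar>y\<bar>" .
        then show "norm ((max 0 y ^ M - max 0 0 ^ M) / (y - 0)) \<le> \<bar>y\<bar> ^ (M - 1)"
          by (cases "y = 0") (simp_all add: M abs_divide divide_le_eq)
      qed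
      have "((\<lambda>y::real. \<bar>y\<bar> ^ (M - 1)) \<longlongrightarrow> \<bar>0\<bar> ^ (M - 1)) (at 0)" by (intro tendsto_intros)
      then show "((\<lambda>y::real. \<bar>y\<bar> ^ (M - 1)) \<longlongrightarrow> 0) (at 0)" by (simp add: M)
    qed
    then show ?thesis using 3 by (simp add: has_field_derivative_iff M)
  qed
qed

text \<open>A truncated paraboloid. As a test function it is always raised to a power of at least
  two, which makes it continuously differentiable with the explicit gradient
  \<open>cut_grad\<close>.\<close>

definition cut :: "real \<Rightarrow> real^'n \<Rightarrow> real" where
  "cut R x = max 0 (1 - (x \<bullet> x) / (4 * R\<^sup>2))"

definition cut_grad :: "real \<Rightarrow> nat \<Rightarrow> real^'n \<Rightarrow> real^'n" where
  "cut_grad R M x = (- (real M * cut R x ^ (M - 1) / (2 * R\<^sup>2))) *\<^sub>R x"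

lemma cut_01: "0 \<le> cut R x" "cut R x \<le> 1"
  by (auto simp: cut_def)

lemma cut_support: "R > 0 \<Longrightarrow> norm x > 2 * R \<Longrightarrow> cut R x = 0"
proof -
  assume R: "R > 0" "norm x > 2 * R"
  then have "(2 * R)\<^sup>2 \<le> (norm x)\<^sup>2" by (intro power_mono) auto
  then have "1 \<le> (x \<bullet> x) / (4 * R\<^sup>2)" using R by (simp add: dot_square_norm power_mult_distrib)
  then show ?thesis by (simp add: cut_def)
qed

lemma cut_lower: "R > 0 \<Longrightarrow> norm x \<le> R \<Longrightarrow> cut R x \<ge> 3 / 4"
proof -
  assume R: "R > 0" "norm x \<le> R"
  then have "(norm x)\<^sup>2 \<le> R\<^sup>2" by (intro power_mono) auto
  then have "(x \<bullet> x) / (4 * R\<^sup>2) \<le> 1 / 4" using R by (simp add: dot_square_norm field_simps)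
  then show ?thesis by (simp add: cut_def)
qed

lemma continuous_on_cut: "continuous_on UNIV (cut R)"
  unfolding cut_def divide_inverse
  by (intro continuous_on_max continuous_on_const continuous_on_diff continuous_on_mult
      continuous_on_inner continuous_on_id)

lemma C1c_cut:
  assumes "R > 0" "M \<ge> 2"
  shows "C1c (\<lambda>x::real^'n. cut R x ^ M) (cut_grad R M)"
  unfolding C1c_eq C1_def
proof (intro conjI allI exI impI)
  fix x :: "real^'n"
  have "((\<lambda>x::real^'n. 1 - (x \<bullet> x) * inverse (4 * R\<^sup>2)) has_derivative (\<lambda>h. - (2 * (x \<bullet> h) * inverse (4 * R\<^sup>2)))) (at x)"
    by (auto intro!: derivative_eq_intros simp: inner_commute)
  from has_derivative_compose[OF this DERIV_max_power[OF assms(2), unfolded has_field_derivative_def]]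
  have "((\<lambda>x. cut R x ^ M) has_derivative
      (\<lambda>h. real M * cut R x ^ (M - 1) * - (2 * (x \<bullet> h) * inverse (4 * R\<^sup>2)))) (at x)"
    unfolding cut_def divide_inverse .
  moreover have "real M * C * - (2 * t * inverse (4 * R\<^sup>2)) = - (real M * C / (2 * R\<^sup>2)) * t" for C t
    by (simp add: field_simps)
  ultimately show "((\<lambda>x. cut R x ^ M) has_derivative (\<lambda>h. cut_grad R M x \<bullet> h)) (at x)"
    by (simp only: cut_grad_def inner_scaleR_left)
next
  show "continuous_on UNIV (cut_grad R M :: real^'n \<Rightarrow> real^'n)"
    unfolding cut_grad_def divide_inverse
    by (intro continuous_on_scaleR continuous_on_minus continuous_on_mult continuous_on_power continuous_on_cut
        continuous_on_const continuous_on_id)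
next
  fix x :: "real^'n" assume "norm x > 2 * R"
  then show "cut R x ^ M = 0" using cut_support[OF assms(1), of x] assms(2) by simp
qed

lemma cut_grad_support: "R > 0 \<Longrightarrow> M \<ge> 2 \<Longrightarrow> norm x > 2 * R \<Longrightarrow> cut_grad R M x = 0"
  using cut_support[of R x] by (simp add: cut_grad_def power_0_left)

text \<open>The exponent \<open>2 * M - 2\<close> is later split as \<open>M + (M - 2)\<close>: one
  part stays with the term to be absorbed, the other with the error.\<close>

lemma cut_grad_bound:
  assumes "R > 0" "M \<ge> 2"
  shows "cut_grad R M x \<bullet> cut_grad R M x \<le> (real M)\<^sup>2 * cut R x ^ (2 * M - 2) / R\<^sup>2"
proof (cases "norm x > 2 * R")
  case True
  have "cut_grad R M x = 0" by (rule cut_grad_support[OF assms True])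
  then show ?thesis using cut_01(1)[of R x] by simp
next
  case False
  then have "(norm x)\<^sup>2 \<le> (2 * R)\<^sup>2" by (intro power_mono) auto
  then have x: "x \<bullet> x \<le> 4 * R\<^sup>2" by (simp add: dot_square_norm power_mult_distrib)
  have "cut_grad R M x \<bullet> cut_grad R M x = (real M)\<^sup>2 * (cut R x ^ (M - 1))\<^sup>2 / (4 * (R\<^sup>2)\<^sup>2) * (x \<bullet> x)"
    by (simp add: cut_grad_def power2_eq_square mult_ac)
  also have "\<dots> \<le> (real M)\<^sup>2 * (cut R x ^ (M - 1))\<^sup>2 / (4 * (R\<^sup>2)\<^sup>2) * (4 * R\<^sup>2)"
    by (intro mult_left_mono x) auto
  also have "\<dots> = (real M)\<^sup>2 * (cut R x ^ (M - 1))\<^sup>2 / R\<^sup>2"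
    using assms(1) by (simp add: power2_eq_square)
  also have "(cut R x ^ (M - 1))\<^sup>2 = cut R x ^ (2 * M - 2)"
    by (simp add: power_mult[symmetric] right_diff_distrib' mult.commute)
  finally show ?thesis .
qed

text \<open>Split at \<open>z = e * v\<close>. Below it the product is at most
  \<open>e ^ b * v ^ (a + b)\<close>; above it \<open>v\<close> is at most
  \<open>z / e\<close>.\<close>

lemma young_power:
  assumes "b \<ge> 1" "\<delta> > (0::real)"
  shows "\<exists>C\<ge>0. \<forall>v\<ge>0. \<forall>z\<ge>0. v ^ a * z ^ b \<le> \<delta> * v ^ (a + b) + C * z ^ (a + b)"
proof -
  define e where "e = min \<delta> 1"
  have e: "e > 0" "e \<le> 1" "e \<le> \<delta>" using assms by (auto simp: e_def)
  have "e ^ b \<le> e ^ 1" using assms(1) e by (intro power_decreasing) auto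
  then have eb: "e ^ b \<le> \<delta>" using e by simp
  show ?thesis
  proof (intro exI[of _ "(1 / e) ^ a"] conjI allI impI)
    show "0 \<le> (1 / e) ^ a" using e by simp
    fix v z :: real assume vz: "v \<ge> 0" "z \<ge> 0"
    show "v ^ a * z ^ b \<le> \<delta> * v ^ (a + b) + (1 / e) ^ a * z ^ (a + b)"
    proof (cases "z \<le> e * v")
      case True
      have "v ^ a * z ^ b \<le> v ^ a * (e * v) ^ b" using True vz by (intro mult_left_mono power_mono) auto
      also have "\<dots> = e ^ b * v ^ (a + b)" by (simp add: power_mult_distrib power_add)
      also have "\<dots> \<le> \<delta> * v ^ (a + b)" using eb vz by (intro mult_right_mono) auto
      finally show ?thesis using e vz by (simp add: add_increasing2)
    next
      case False
      then have "v \<le> (1 / e) * z" using e by (simp add: field_simps)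
      then have "v ^ a * z ^ b \<le> ((1 / e) * z) ^ a * z ^ b" using vz by (intro mult_right_mono power_mono) auto
      also have "\<dots> = (1 / e) ^ a * z ^ (a + b)" by (simp only: power_mult_distrib power_add mult.assoc)
      finally show ?thesis using assms vz by (simp add: add_increasing)
    qed
  qed
qed

section \<open>Weighted gradient integrals and their Caccioppoli inequalities\<close>

context hessian_solution
begin

text \<open>Each Caccioppoli step raises \<open>l\<close> by one and spends two powers of the
  cutoff; for \<open>l \<le> k\<close> at least two powers remain.\<close>

definition m :: nat where "m = 2 * k + 2"

text \<open>\<open>i\<close> counts the factors |Du|^2, \<open>j\<close> is the order of the
  symmetric function, and \<open>l\<close> counts the factors R^(-2) produced by the cutoff. All
  members with \<open>i + j + l = k\<close>, and all \<open>lI\<close> with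
  \<open>i + j + l + 1 = k\<close>, scale alike in \<open>u\<close> and in length; the estimates
  never leave this family.\<close>

definition aI :: "real \<Rightarrow> nat \<Rightarrow> nat \<Rightarrow> nat \<Rightarrow> real^'n \<Rightarrow> real" where
  "aI R i j l x = cut R x ^ (m - 2 * l) * inverse R ^ (2 * l) * u x powr (1 - \<kappa> - real i + real l) * rho x ^ i * s j x"

definition lI :: "real \<Rightarrow> nat \<Rightarrow> nat \<Rightarrow> nat \<Rightarrow> real^'n \<Rightarrow> real" where
  "lI R i j l x = cut R x ^ (m - 2 * l) * inverse R ^ (2 * l) * u x powr (- \<kappa> - real i + real l) * rho x ^ i
    * (Du x \<bullet> (T j x *v Du x))"

definition aInt :: "nat \<Rightarrow> nat \<Rightarrow> nat \<Rightarrow> real \<Rightarrow> real" where "aInt i j l R = (LINT x|lborel. aI R i j l x)"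
definition lInt :: "nat \<Rightarrow> nat \<Rightarrow> nat \<Rightarrow> real \<Rightarrow> real" where "lInt i j l R = (LINT x|lborel. lI R i j l x)"

lemma cut_pow_support: "R > 0 \<Longrightarrow> l \<le> k \<Longrightarrow> norm x > 2 * R \<Longrightarrow> cut R x ^ (m - 2 * l) = 0"
  using cut_support[of R x] by (simp add: m_def)

lemma cont_cut_pow: "continuous_on UNIV (\<lambda>x::real^'n. cut R x ^ M)"
  by (intro continuous_on_power continuous_on_cut)

lemma aI_int: "R > 0 \<Longrightarrow> l \<le> k \<Longrightarrow> integrable lborel (aI R i j l)"
  unfolding aI_def
  by (rule integrable_cs[of _ "2 * R"], intro conts cont_cut_pow, simp add: cut_pow_support)

lemma lI_int: "R > 0 \<Longrightarrow> l \<le> k \<Longrightarrow> integrable lborel (lI R i j l)"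
  unfolding lI_def
  by (rule integrable_cs[of _ "2 * R"], intro conts cont_cut_pow, simp add: cut_pow_support)


lemma aI_nonneg: "R > 0 \<Longrightarrow> j \<le> k \<Longrightarrow> aI R i j l x \<ge> 0"
  unfolding aI_def using cut_01(1)[of R x] s_pos[of j x] by simp

lemma lI_nonneg: "R > 0 \<Longrightarrow> j < k \<Longrightarrow> lI R i j l x \<ge> 0"
  unfolding lI_def using cut_01(1)[of R x] T_nonneg[of j "Du x" x] by simp

lemma aInt_nonneg: "R > 0 \<Longrightarrow> j \<le> k \<Longrightarrow> aInt i j l R \<ge> 0"
  unfolding aInt_def by (simp add: aI_nonneg)

lemma lInt_nonneg: "R > 0 \<Longrightarrow> j < k \<Longrightarrow> lInt i j l R \<ge> 0"
  unfolding lInt_def by (simp add: lI_nonneg)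

lemma lInt_le:
  assumes "R > 0" "j < k" "l \<le> k"
  shows "lInt i j l R \<le> N * aInt (i + 1) j l R"
proof -
  have "lI R i j l x \<le> N * aI R (i + 1) j l x" for x
  proof -
    have e: "1 - \<kappa> - real (i + 1) + real l = - \<kappa> - real i + real l" by simp
    have "lI R i j l x \<le> cut R x ^ (m - 2 * l) * inverse R ^ (2 * l) * u x powr (- \<kappa> - real i + real l) * rho x ^ i
        * (N * s j x * rho x)"
      unfolding lI_def using T_le[OF assms(2), of "Du x" x] cut_01(1)[of R x] assms(1)
      by (intro mult_left_mono) auto
    also have "\<dots> = N * aI R (i + 1) j l x" unfolding aI_def e by simp
    finally show ?thesis .
  qed
  then have "lInt i j l R \<le> (LINT x|lborel. N * aI R (i + 1) j l x)"
    unfolding lInt_def using assms by (intro integral_mono lI_int integrable_mult_right aI_int) auto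
  then show ?thesis by (simp add: aInt_def)
qed

text \<open>\<open>young_power\<close> is applied with v = cut^2 |Du|^2 and z = u^2 / R^2; the
  remaining factor \<open>B\<close> is common to the three integrands.\<close>

lemma aInt_young:
  assumes "b \<ge> 1" "\<delta> > 0" "a + b + j \<le> k"
  shows "\<exists>C\<ge>0. \<forall>R>0. aInt a j b R \<le> \<delta> * aInt (a + b) j 0 R + C * aInt 0 j (a + b) R"
proof -
  obtain C where C: "C \<ge> 0" "\<And>v z. v \<ge> 0 \<Longrightarrow> z \<ge> 0 \<Longrightarrow> v ^ a * z ^ b \<le> \<delta> * v ^ (a + b) + C * z ^ (a + b)"
    using young_power[OF assms(1,2), of a] by metis
  have "aInt a j b R \<le> \<delta> * aInt (a + b) j 0 R + C * aInt 0 j (a + b) R" if R: "R > 0" for R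
  proof -
    have "aI R a j b x \<le> \<delta> * aI R (a + b) j 0 x + C * aI R 0 j (a + b) x" for x
    proof -
      define c where "c = cut R x"
      define B where "B = c ^ (m - 2 * (a + b)) * u x powr (1 - \<kappa> - real (a + b)) * s j x"
      define v z where "v = c\<^sup>2 * rho x" and "z = (u x)\<^sup>2 * (inverse R)\<^sup>2"
      have c: "c \<ge> 0" by (simp add: c_def cut_01)
      have up: "u x powr (e + real (2 * q)) = u x powr e * ((u x)\<^sup>2) ^ q" for e q
        using u_pos[of x] by (simp add: powr_add powr_realpow power_mult[symmetric] del: of_nat_mult)
      have cp: "c ^ (m - 2 * b) = c ^ (m - 2 * (a + b)) * (c\<^sup>2) ^ a" "c ^ (m - 2 * 0) = c ^ (m - 2 * (a + b)) * (c\<^sup>2) ^ (a + b)"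
        using assms(3) by (simp_all add: m_def flip: power_mult power_add)
      have 1: "aI R a j b x = B * (v ^ a * z ^ b)"
      proof -
        have e: "1 - \<kappa> - real a + real b = (1 - \<kappa> - real (a + b)) + real (2 * b)" by simp
        show ?thesis unfolding aI_def c_def[symmetric] e up cp(1) B_def v_def z_def
          by (simp add: power_mult_distrib power_mult)
      qed
      have 2: "aI R (a + b) j 0 x = B * v ^ (a + b)"
      proof -
        have e: "1 - \<kappa> - real (a + b) + real 0 = 1 - \<kappa> - real (a + b)" by simp
        show ?thesis unfolding aI_def c_def[symmetric] e cp(2) B_def v_def
          by (simp add: power_mult_distrib)
      qed
      have 3: "aI R 0 j (a + b) x = B * z ^ (a + b)"
      proof -
        have e: "1 - \<kappa> - real 0 + real (a + b) = (1 - \<kappa> - real (a + b)) + real (2 * (a + b))" by simp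
        have q: "inverse R ^ (2 * (a + b)) = ((inverse R)\<^sup>2) ^ (a + b)" by (rule power_mult)
        show ?thesis unfolding aI_def c_def[symmetric] e up B_def z_def q
          by (simp add: power_mult_distrib)
      qed
      have "B \<ge> 0" using c s_pos[of j x] assms(3) by (simp add: B_def)
      then have "B * (v ^ a * z ^ b) \<le> B * (\<delta> * v ^ (a + b) + C * z ^ (a + b))"
        by (intro mult_left_mono C(2)) (auto simp: v_def z_def)
      then show ?thesis unfolding 1 2 3 by (simp add: algebra_simps)
    qed
    then have "aInt a j b R \<le> (LINT x|lborel. \<delta> * aI R (a + b) j 0 x + C * aI R 0 j (a + b) x)"
      unfolding aInt_def using R assms(3)
      by (intro integral_mono Bochner_Integration.integrable_add integrable_mult_right aI_int) auto
    also have "\<dots> = \<delta> * aInt (a + b) j 0 R + C * aInt 0 j (a + b) R"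
      using R assms(3) aI_int[of R 0 "a + b" j] aI_int[of R "a + b" 0 j] by (simp add: aInt_def)
    finally show ?thesis .
  qed
  then show ?thesis using C(1) by blast
qed

text \<open>In \<open>general_identity\<close> with a power of the cutoff, only the term containing
  the gradient of the cutoff is an error. Cauchy-Schwarz for the nonnegative form
  \<open>T j x\<close> and the arithmetic-geometric mean split it into a small multiple of
  \<open>lInt i j l R\<close> and a term with one more factor R^(-2).\<close>

lemma caccioppoli_identity:
  assumes ijl: "i + j + l + 1 = k" and \<delta>: "\<delta> > 0"
  shows "\<exists>C\<ge>0. \<forall>R>0. \<bar>real (j + 1 + 2 * i) * aInt i (j + 1) l R
      - (1 - \<kappa> - real i + real l) * lInt i j l R - 2 * real i * lInt (i - 1) (j + 1) l R\<bar>
    \<le> \<delta> * lInt i j l R + C * aInt i j (l + 1) R"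
proof -
  define M where "M = m - 2 * l"
  have M: "M \<ge> 2" "m - 2 * (l + 1) = M - 2" using ijl by (auto simp: M_def m_def)
  \<comment> \<open>Chosen so that \<open>4 * (\<delta> * L) * (C * K)\<close> below equals the
    Cauchy-Schwarz bound for the error.\<close>
  define C where "C = N * (real M)\<^sup>2 / (4 * \<delta>)"
  have "\<bar>real (j + 1 + 2 * i) * aInt i (j + 1) l R - (1 - \<kappa> - real i + real l) * lInt i j l R
      - 2 * real i * lInt (i - 1) (j + 1) l R\<bar> \<le> \<delta> * lInt i j l R + C * aInt i j (l + 1) R" if R: "R > 0" for R
  proof -
    define a where "a = 1 - \<kappa> - real i + real l"
    let ?B = "\<lambda>x. u x powr a * rho x ^ i * (Du x \<bullet> (T j x *v cut_grad R M x))"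
    define q where "q = inverse R ^ (2 * l)"
    have q: "q > 0" using R by (simp add: q_def)
    have cg: "continuous_on UNIV (cut_grad R M :: real^'n \<Rightarrow> real^'n)"
    proof -
      have "C1c (\<lambda>x::real^'n. cut R x ^ M) (cut_grad R M)" by (rule C1c_cut[OF R M(1)])
      then show ?thesis by (simp add: C1c_def)
    qed
    have iB: "integrable lborel ?B"
    proof (rule integrable_cs[of _ "2 * R"])
      show "continuous_on UNIV ?B" by (intro conts cg)
      show "norm x > 2 * R \<Longrightarrow> ?B x = 0" for x :: "real^'n"
        by (simp add: cut_grad_support[OF R M(1)])
    qed
    have id: "real (j + 1 + 2 * i) * (LINT x|lborel. cut R x ^ M * u x powr a * rho x ^ i * s (j + 1) x) =
        a * (LINT x|lborel. cut R x ^ M * u x powr (a - 1) * rho x ^ i * (Du x \<bullet> (T j x *v Du x)))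
        + 2 * real i * (LINT x|lborel. cut R x ^ M * u x powr a * rho x ^ (i - 1) * (Du x \<bullet> (T (j + 1) x *v Du x)))
        + (LINT x|lborel. ?B x)"
      by (rule general_identity[OF C1c_cut[OF R M(1)]])
    have 1: "aInt i (j + 1) l R = q * (LINT x|lborel. cut R x ^ M * u x powr a * rho x ^ i * s (j + 1) x)"
      unfolding aInt_def aI_def M_def[symmetric] a_def[symmetric] q_def[symmetric]
      by (subst integral_mult_right_zero[symmetric]) (simp add: mult_ac)
    have ea: "- \<kappa> - real i + real l = a - 1" by (simp add: a_def)
    have 2: "lInt i j l R = q * (LINT x|lborel. cut R x ^ M * u x powr (a - 1) * rho x ^ i * (Du x \<bullet> (T j x *v Du x)))"
      unfolding lInt_def lI_def M_def[symmetric] ea q_def[symmetric]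
      by (subst integral_mult_right_zero[symmetric]) (simp add: mult_ac)
    have 3: "2 * real i * lInt (i - 1) (j + 1) l R =
        2 * real i * (q * (LINT x|lborel. cut R x ^ M * u x powr a * rho x ^ (i - 1) * (Du x \<bullet> (T (j + 1) x *v Du x))))"
    proof (cases "i = 0")
      case False
      then have e: "- \<kappa> - real (i - 1) + real l = a" by (simp add: a_def of_nat_diff)
      show ?thesis
        unfolding lInt_def lI_def M_def[symmetric] e q_def[symmetric]
        by (subst integral_mult_right_zero[symmetric]) (simp add: mult_ac)
    qed simp
    have "real (j + 1 + 2 * i) * aInt i (j + 1) l R - a * lInt i j l R - 2 * real i * lInt (i - 1) (j + 1) l R
        = q * (LINT x|lborel. ?B x)"
      unfolding 1 2 3 using arg_cong[OF id, of "\<lambda>t. q * t"] by (simp add: algebra_simps)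
    also have "\<dots> = (LINT x|lborel. q * ?B x)" by simp
    also have "\<bar>\<dots>\<bar> \<le> (LINT x|lborel. \<bar>q * ?B x\<bar>)" by (rule integral_abs_bound)
    also have "\<dots> \<le> (LINT x|lborel. \<delta> * lI R i j l x + C * aI R i j (l + 1) x)"
    proof (rule integral_mono)
      fix x :: "real^'n"
      define c where "c = cut R x"
      have c: "c \<ge> 0" by (simp add: c_def cut_01)
      define E where "E = q * rho x ^ i * u x powr a"
      have E: "E \<ge> 0" using q by (simp add: E_def)
      define t where "t = Du x \<bullet> (T j x *v Du x)"
      have jk: "j < k" using ijl by simp
      have t: "t \<ge> 0" unfolding t_def by (rule T_nonneg[OF jk])
      have "(Du x \<bullet> (T j x *v cut_grad R M x))\<^sup>2 \<le> t * (cut_grad R M x \<bullet> (T j x *v cut_grad R M x))"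
        unfolding t_def by (rule cone_newt_cauchy_schwarz[OF cone_A jk])
      also have "\<dots> \<le> t * (N * s j x * (cut_grad R M x \<bullet> cut_grad R M x))"
        by (intro mult_left_mono T_le[OF jk] t)
      also have "\<dots> \<le> t * (N * s j x * ((real M)\<^sup>2 * c ^ (2 * M - 2) / R\<^sup>2))"
        unfolding c_def using s_pos[of j x] jk N by (intro mult_left_mono cut_grad_bound[OF R M(1)] t) auto
      finally have 4: "(Du x \<bullet> (T j x *v cut_grad R M x))\<^sup>2 \<le> t * (N * s j x * ((real M)\<^sup>2 * c ^ (2 * M - 2) / R\<^sup>2))" .
      have ui: "u x powr (a - 1) = u x powr a / u x" "u x powr (a + 1) = u x powr a * u x"
        using u_pos[of x] by (simp_all add: powr_diff powr_add)
      define L K where "L = c ^ M * t / u x" and "K = c ^ (M - 2) * u x * s j x / R\<^sup>2"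
      have LK: "L \<ge> 0" "K \<ge> 0"
        using c t u_pos[of x] s_pos[of j x] jk by (auto simp: L_def K_def less_imp_le)
      have l: "lI R i j l x = E * L"
        unfolding lI_def M_def[symmetric] ea q_def[symmetric] ui c_def[symmetric] t_def[symmetric] E_def L_def by simp
      have ea2: "1 - \<kappa> - real i + real (l + 1) = a + 1" by (simp add: a_def)
      have ql: "inverse R ^ (2 * (l + 1)) = q / R\<^sup>2"
        using R by (simp add: q_def power2_eq_square divide_inverse)
      have k: "aI R i j (l + 1) x = E * K"
        unfolding aI_def M(2) ea2 ql ui c_def[symmetric] E_def K_def by simp
      have "(Du x \<bullet> (T j x *v cut_grad R M x))\<^sup>2 \<le> 4 * (\<delta> * L) * (C * K)"
      proof -
        have "c ^ (2 * M - 2) = c ^ M * c ^ (M - 2)" using M(1) by (simp flip: power_add add: mult_2)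
        then have "4 * (\<delta> * L) * (C * K) = t * (N * s j x * ((real M)\<^sup>2 * c ^ (2 * M - 2) / R\<^sup>2))"
          using \<delta> u_ne[of x] R by (simp add: L_def K_def C_def field_simps)
        then show ?thesis using 4 by simp
      qed
      also have "\<dots> \<le> (\<delta> * L + C * K)\<^sup>2"
      proof -
        have "(\<delta> * L + C * K)\<^sup>2 - 4 * (\<delta> * L) * (C * K) = (\<delta> * L - C * K)\<^sup>2"
          by (simp add: power2_eq_square algebra_simps)
        then show ?thesis by (metis diff_ge_0_iff_ge zero_le_power2)
      qed
      finally have "\<bar>Du x \<bullet> (T j x *v cut_grad R M x)\<bar> \<le> \<delta> * L + C * K"
        using \<delta> LK N by (intro power2_le_imp_le[of "\<bar>_\<bar>"]) (auto simp: C_def)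
      then have "E * \<bar>Du x \<bullet> (T j x *v cut_grad R M x)\<bar> \<le> E * (\<delta> * L + C * K)" by (intro mult_left_mono E)
      moreover have "\<bar>q * ?B x\<bar> = E * \<bar>Du x \<bullet> (T j x *v cut_grad R M x)\<bar>"
        using q by (simp add: E_def abs_mult mult_ac)
      ultimately show "\<bar>q * ?B x\<bar> \<le> \<delta> * lI R i j l x + C * aI R i j (l + 1) x"
        unfolding l k by (simp add: algebra_simps)
    next
      show "integrable lborel (\<lambda>x. \<bar>q * ?B x\<bar>)" using iB by simp
      show "integrable lborel (\<lambda>x. \<delta> * lI R i j l x + C * aI R i j (l + 1) x)"
        using R ijl by (intro Bochner_Integration.integrable_add integrable_mult_right aI_int lI_int) auto
    qed
    also have "\<dots> = \<delta> * lInt i j l R + C * aInt i j (l + 1) R"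
      using R ijl aI_int[of R "l + 1" i j] lI_int[of R l i j] by (simp add: aInt_def lInt_def)
    finally show ?thesis by (simp add: a_def)
  qed
  moreover have "C \<ge> 0" using N \<delta> by (simp add: C_def)
  ultimately show ?thesis by blast
qed


section \<open>Absorption of the intermediate integrals\<close>

text \<open>The terms without cutoff loss (\<open>l = 0\<close>) that still contain the gradient.
  The \<open>aInt\<close> among them are the endpoints of Young's inequality that receive the small
  coefficient.\<close>

definition Stot :: "real \<Rightarrow> real" where
  "Stot R = (\<Sum>i<k. lInt i (k - 1 - i) 0 R) + (\<Sum>i\<in>{1..k}. aInt i (k - i) 0 R)"

text \<open>The two endpoints accessible to the growth hypothesis: by the equation the first is a
  cutoff integral of \<open>u x powr \<gamma>\<close>, and the second involves only a power of
  \<open>u\<close> and R^(-2k).\<close>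

definition Wtot :: "real \<Rightarrow> real" where
  "Wtot R = aInt 0 k 0 R + aInt 0 0 k R"

text \<open>Being controlled means being bounded by an arbitrarily small part of \<open>Stot\<close> plus a
  multiple of \<open>Wtot\<close>; once all terms of \<open>Stot\<close> are controlled, \<open>Stot\<close> is absorbed.\<close>

definition ctrl :: "(real \<Rightarrow> real) \<Rightarrow> bool" where
  "ctrl f \<longleftrightarrow> (\<forall>\<delta>>0. \<exists>C\<ge>0. \<forall>R>0. f R \<le> \<delta> * Stot R + C * Wtot R)"

lemma Stot_nonneg: "R > 0 \<Longrightarrow> Stot R \<ge> 0"
  unfolding Stot_def by (intro add_nonneg_nonneg sum_nonneg lInt_nonneg aInt_nonneg) auto

lemma Wtot_nonneg: "R > 0 \<Longrightarrow> Wtot R \<ge> 0"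
  unfolding Wtot_def by (intro add_nonneg_nonneg aInt_nonneg) auto

lemma aInt_le_Stot:
  assumes "R > 0" "1 \<le> i" "i \<le> k"
  shows "aInt i (k - i) 0 R \<le> Stot R"
proof -
  have "aInt i (k - i) 0 R \<le> (\<Sum>i\<in>{1..k}. aInt i (k - i) 0 R)"
    using assms by (intro member_le_sum) (auto intro: aInt_nonneg)
  moreover have "0 \<le> (\<Sum>i<k. lInt i (k - 1 - i) 0 R)"
    using assms by (intro sum_nonneg lInt_nonneg) auto
  ultimately show ?thesis by (simp add: Stot_def)
qed

lemma ctrl_scale: "ctrl f \<Longrightarrow> c \<ge> 0 \<Longrightarrow> ctrl (\<lambda>R. c * f R)"
  unfolding ctrl_def
proof (intro allI impI)
  fix \<delta> :: real assume f: "\<forall>\<delta>>0. \<exists>C\<ge>0. \<forall>R>0. f R \<le> \<delta> * Stot R + C * Wtot R" and c: "0 \<le> c" and \<delta>: "0 < \<delta>"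
  have "\<delta> / (c + 1) > 0" using c \<delta> by simp
  then obtain C where C: "C \<ge> 0" "\<And>R. R > 0 \<Longrightarrow> f R \<le> \<delta> / (c + 1) * Stot R + C * Wtot R" using f by blast
  have "c * f R \<le> \<delta> * Stot R + c * C * Wtot R" if R: "R > 0" for R
  proof -
    have "c * f R \<le> c * (\<delta> / (c + 1) * Stot R + C * Wtot R)" by (intro mult_left_mono C R c)
    also have "\<dots> = (c / (c + 1)) * (\<delta> * Stot R) + c * C * Wtot R" by (simp add: algebra_simps)
    also have "(c / (c + 1)) * (\<delta> * Stot R) \<le> 1 * (\<delta> * Stot R)"
      using c \<delta> Stot_nonneg[OF R] by (intro mult_right_mono) auto
    finally show ?thesis by simp
  qed
  then show "\<exists>C\<ge>0. \<forall>R>0. c * f R \<le> \<delta> * Stot R + C * Wtot R"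
    using c C(1) by (intro exI[of _ "c * C"]) auto
qed

lemma ctrl_add:
  assumes "ctrl f" "ctrl g"
  shows "ctrl (\<lambda>R. f R + g R)"
  unfolding ctrl_def
proof (intro allI impI)
  fix \<delta> :: real assume \<delta>: "\<delta> > 0"
  have h: "\<delta> / 2 > 0" using \<delta> by simp
  obtain C where C: "C \<ge> 0" "\<And>R. R > 0 \<Longrightarrow> f R \<le> \<delta> / 2 * Stot R + C * Wtot R"
    using assms(1) h unfolding ctrl_def by blast
  obtain D where D: "D \<ge> 0" "\<And>R. R > 0 \<Longrightarrow> g R \<le> \<delta> / 2 * Stot R + D * Wtot R"
    using assms(2) h unfolding ctrl_def by blast
  have "f R + g R \<le> \<delta> * Stot R + (C + D) * Wtot R" if "R > 0" for R
    using C(2)[OF that] D(2)[OF that] by (simp add: algebra_simps)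
  then show "\<exists>C\<ge>0. \<forall>R>0. f R + g R \<le> \<delta> * Stot R + C * Wtot R"
    using C(1) D(1) by (intro exI[of _ "C + D"]) auto
qed

lemma ctrl_mono: "ctrl g \<Longrightarrow> (\<And>R. R > 0 \<Longrightarrow> f R \<le> g R) \<Longrightarrow> ctrl f"
  unfolding ctrl_def by (meson order.trans)

lemma ctrl_Wtot: "(\<And>R. R > 0 \<Longrightarrow> f R \<le> Wtot R) \<Longrightarrow> ctrl f"
  unfolding ctrl_def
proof (intro allI impI exI[of _ "1::real"] conjI)
  fix \<delta> R :: real assume "\<And>R. R > 0 \<Longrightarrow> f R \<le> Wtot R" "\<delta> > 0" "R > 0"
  then show "f R \<le> \<delta> * Stot R + 1 * Wtot R" using Stot_nonneg[of R] by (simp add: add_increasing)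
qed simp

lemma ctrl_eps:
  assumes "\<And>\<delta>. \<delta> > 0 \<Longrightarrow> \<exists>g. ctrl g \<and> (\<forall>R>0. f R \<le> \<delta> * Stot R + g R)"
  shows "ctrl f"
  unfolding ctrl_def
proof (intro allI impI)
  fix \<delta> :: real assume \<delta>: "\<delta> > 0"
  then have h: "\<delta> / 2 > 0" by simp
  obtain g where g: "ctrl g" "\<And>R. R > 0 \<Longrightarrow> f R \<le> \<delta> / 2 * Stot R + g R" using assms[OF h] by blast
  obtain C where C: "C \<ge> 0" "\<And>R. R > 0 \<Longrightarrow> g R \<le> \<delta> / 2 * Stot R + C * Wtot R"
    using g(1) h unfolding ctrl_def by blast
  have "f R \<le> \<delta> * Stot R + C * Wtot R" if "R > 0" for R
    using C(2)[OF that] g(2)[OF that] by (simp add: algebra_simps)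
  then show "\<exists>C\<ge>0. \<forall>R>0. f R \<le> \<delta> * Stot R + C * Wtot R" using C(1) by blast
qed

lemma ctrl_sum: "finite I \<Longrightarrow> (\<And>i. i \<in> I \<Longrightarrow> ctrl (f i)) \<Longrightarrow> ctrl (\<lambda>R. \<Sum>i\<in>I. f i R)"
proof (induction I rule: finite_induct)
  case empty
  then show ?case by (auto intro: ctrl_Wtot Wtot_nonneg)
next
  case (insert i I)
  then show ?case by (simp add: ctrl_add)
qed

text \<open>The term lies between \<open>aInt (a + b) j 0\<close>, a summand of \<open>Stot\<close>
  which takes the small coefficient, and the gradient-free \<open>aInt 0 j (a + b)\<close>.\<close>

lemma ctrl_young:
  assumes "b \<ge> 1" "a + b + j = k" "ctrl (aInt 0 j (a + b))"
  shows "ctrl (aInt a j b)"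
proof (rule ctrl_eps)
  fix \<delta> :: real assume "\<delta> > 0"
  then obtain C where C: "C \<ge> 0" "\<And>R. R > 0 \<Longrightarrow> aInt a j b R \<le> \<delta> * aInt (a + b) j 0 R + C * aInt 0 j (a + b) R"
    using aInt_young[OF assms(1), of \<delta> a j] assms(2) by auto
  have "aInt a j b R \<le> \<delta> * Stot R + C * aInt 0 j (a + b) R" if R: "R > 0" for R
  proof -
    have j: "j = k - (a + b)" using assms(2) by simp
    have "aInt (a + b) j 0 R \<le> Stot R" unfolding j using assms by (intro aInt_le_Stot R) auto
    then have "\<delta> * aInt (a + b) j 0 R \<le> \<delta> * Stot R" using \<open>\<delta> > 0\<close> by (intro mult_left_mono) auto
    then show ?thesis using C(2)[OF R] by simp
  qed
  then show "\<exists>g. ctrl g \<and> (\<forall>R>0. aInt a j b R \<le> \<delta> * Stot R + g R)"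
    using ctrl_scale[OF assms(3) C(1)] by blast
qed

text \<open>Descending induction from \<open>l = k\<close>, where the term belongs to
  \<open>Wtot\<close>. A Caccioppoli step bounds the case \<open>l\<close> by
  \<open>lInt 0 j l\<close> and the case \<open>l + 1\<close>; since \<open>lInt 0 j l\<close> is at
  most \<open>N\<close> times \<open>aInt 1 j l\<close>, Young's inequality leads back to the case
  \<open>l + 1\<close>.\<close>

lemma ctrl_Z:
  assumes "1 \<le> l" "l \<le> k"
  shows "ctrl (aInt 0 (k - l) l)"
  using assms(2,1)
proof (induction l rule: inc_induct)
  case base
  show ?case by (rule ctrl_Wtot) (simp add: Wtot_def aInt_nonneg)
next
  case (step l)
  define j where "j = k - Suc l"
  have j: "0 + j + l + 1 = k" "j + 1 = k - l" "j < k" using step by (auto simp: j_def)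
  have Z: "ctrl (aInt 0 j (l + 1))" using step by (simp add: j_def)
  obtain C where C: "C \<ge> 0" "\<And>R. R > 0 \<Longrightarrow> \<bar>real (j + 1 + 2 * 0) * aInt 0 (j + 1) l R
      - (1 - \<kappa> - real 0 + real l) * lInt 0 j l R - 2 * real 0 * lInt (0 - 1) (j + 1) l R\<bar>
    \<le> 1 * lInt 0 j l R + C * aInt 0 j (l + 1) R"
    using caccioppoli_identity[OF j(1), of 1] by auto
  have Y: "ctrl (aInt 1 j l)"
    using ctrl_young[of l 1 j] step.prems j(1) Z by (simp add: add.commute)
  show ?case
  proof (rule ctrl_mono[OF ctrl_add[OF ctrl_scale[OF Y, of "(2 + real l) * N"] ctrl_scale[OF Z C(1)]]])
    show "(2 + real l) * N \<ge> 0" using N by simp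
    fix R :: real assume R: "R > 0"
    have nn: "lInt 0 j l R \<ge> 0" "aInt 0 (j + 1) l R \<ge> 0" using lInt_nonneg[OF R j(3)] aInt_nonneg[OF R, of "j + 1"] j by auto
    have "aInt 0 (j + 1) l R \<le> real (j + 1) * aInt 0 (j + 1) l R"
      using nn(2) mult_right_mono[of 1 "real (j + 1)" "aInt 0 (j + 1) l R"] by simp
    also have "\<dots> \<le> (1 - \<kappa> + real l) * lInt 0 j l R + lInt 0 j l R + C * aInt 0 j (l + 1) R"
      using C(2)[OF R] by simp
    also have "\<dots> = (2 - \<kappa> + real l) * lInt 0 j l R + C * aInt 0 j (l + 1) R" by (simp add: algebra_simps)
    also have "(2 - \<kappa> + real l) * lInt 0 j l R \<le> (2 + real l) * lInt 0 j l R"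
      using kappa nn by (intro mult_right_mono) auto
    also have "\<dots> \<le> (2 + real l) * (N * aInt (0 + 1) j l R)"
      using step.hyps by (intro mult_left_mono lInt_le R j(3)) auto
    finally show "aInt 0 (k - l) l R \<le> (2 + real l) * N * aInt 1 j l R + C * aInt 0 j (l + 1) R"
      by (simp add: j(2)[symmetric] mult_ac)
  qed
qed

text \<open>Induction on the number of gradient factors. For \<open>i = 0\<close> the term has
  coefficient 1 - \<kappa>, positive because n > 4k, and is bounded by the equation term
  \<open>aInt 0 k 0\<close>. For i \<ge> 1 the coefficient changes side and becomes \<kappa> + i -
  1, so that \<open>lInt i\<close> and \<open>aInt i\<close> are bounded together by the preceding
  \<open>lInt\<close>.\<close>

lemma ctrl_L:
  assumes "i < k"
  shows "ctrl (lInt i (k - 1 - i) 0)" and "i \<ge> 1 \<Longrightarrow> ctrl (aInt i (k - i) 0)"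
proof -
  have "ctrl (lInt i (k - 1 - i) 0) \<and> (i \<ge> 1 \<longrightarrow> ctrl (aInt i (k - i) 0))" if "i < k" for i
    using that
  proof (induction i)
    case 0
    define j where "j = k - 1"
    have j: "0 + j + 0 + 1 = k" "j + 1 = k" "j < k" using k2 by (auto simp: j_def)
    \<comment> \<open>Half of the available coefficient is kept to absorb the Caccioppoli
      error.\<close>
    have d: "(1 - \<kappa>) / 2 > 0" using kappa by simp
    obtain C where C: "C \<ge> 0" "\<And>R. R > 0 \<Longrightarrow> \<bar>real (j + 1 + 2 * 0) * aInt 0 (j + 1) 0 R
        - (1 - \<kappa> - real 0 + real 0) * lInt 0 j 0 R - 2 * real 0 * lInt (0 - 1) (j + 1) 0 R\<bar>
      \<le> (1 - \<kappa>) / 2 * lInt 0 j 0 R + C * aInt 0 j (0 + 1) R"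
      using caccioppoli_identity[OF j(1) d] by auto
    have Z: "ctrl (aInt 0 j 1)" using ctrl_Z[of 1] k2 by (simp add: j_def)
    have W: "ctrl (aInt 0 k 0)" by (rule ctrl_Wtot) (simp add: Wtot_def aInt_nonneg)
    have "ctrl (lInt 0 j 0)"
    proof (rule ctrl_mono[OF ctrl_scale[OF ctrl_add[OF ctrl_scale[OF W, of "real k"] ctrl_scale[OF Z C(1)]], of "2 / (1 - \<kappa>)"]])
      fix R :: real assume R: "R > 0"
      have "(1 - \<kappa>) * lInt 0 j 0 R \<le> real k * aInt 0 k 0 R + (1 - \<kappa>) / 2 * lInt 0 j 0 R + C * aInt 0 j 1 R"
      proof -
        have jr: "real (j + 1 + 2 * 0) = real k" "j + 1 = k" "1 - \<kappa> - real 0 + real 0 = 1 - \<kappa>" "(0::nat) + 1 = 1"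
          using j(2) by simp_all
        have "real (k + 2 * 0) = real k" by simp
        then show ?thesis using C(2)[OF R] unfolding jr by simp
      qed
      then have "(1 - \<kappa>) / 2 * lInt 0 j 0 R \<le> real k * aInt 0 k 0 R + C * aInt 0 j 1 R" by (simp add: field_simps)
      then have "2 / (1 - \<kappa>) * ((1 - \<kappa>) / 2 * lInt 0 j 0 R) \<le> 2 / (1 - \<kappa>) * (real k * aInt 0 k 0 R + C * aInt 0 j 1 R)"
        using kappa by (intro mult_left_mono) auto
      then show "lInt 0 j 0 R \<le> 2 / (1 - \<kappa>) * (real k * aInt 0 k 0 R + C * aInt 0 j 1 R)"
        using kappa by simp
    qed (use kappa in auto)
    then show ?case by (simp add: j_def)
  next
    case (Suc i)
    define i' j where "i' = Suc i" and "j = k - 1 - Suc i"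
    have j: "i' + j + 0 + 1 = k" "j + 1 = k - i'" "j < k" "j + 1 = k - 1 - i" "i' - 1 = i"
      using Suc.prems by (auto simp: j_def i'_def)
    have d: "\<kappa> / 2 > 0" using kappa by simp
    obtain C where C: "C \<ge> 0" "\<And>R. R > 0 \<Longrightarrow> \<bar>real (j + 1 + 2 * i') * aInt i' (j + 1) 0 R
        - (1 - \<kappa> - real i' + real 0) * lInt i' j 0 R - 2 * real i' * lInt (i' - 1) (j + 1) 0 R\<bar>
      \<le> \<kappa> / 2 * lInt i' j 0 R + C * aInt i' j (0 + 1) R"
      using caccioppoli_identity[OF j(1) d] by auto
    have Z: "ctrl (aInt 0 j (i' + 1))" using ctrl_Z[of "i' + 1"] j Suc.prems by (simp add: j_def i'_def)
    have Y: "ctrl (aInt i' j 1)" using ctrl_young[of 1 i' j] Z j(1) by simp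
    have L: "ctrl (lInt i (j + 1) 0)" using Suc j(4) by simp
    define f where "f R = 2 * real i' * lInt i (j + 1) 0 R + C * aInt i' j 1 R" for R
    have cf: "ctrl f" unfolding f_def[abs_def] by (intro ctrl_add ctrl_scale L Y C(1)) simp
    have main: "aInt i' (j + 1) 0 R + \<kappa> / 2 * lInt i' j 0 R \<le> f R" "aInt i' (j + 1) 0 R \<ge> 0" "lInt i' j 0 R \<ge> 0"
      if R: "R > 0" for R
    proof -
      show nn: "aInt i' (j + 1) 0 R \<ge> 0" "lInt i' j 0 R \<ge> 0"
        using aInt_nonneg[OF R, of "j + 1"] lInt_nonneg[OF R j(3)] j by auto
      have "real (j + 1 + 2 * i') * aInt i' (j + 1) 0 R - (1 - \<kappa> - real i') * lInt i' j 0 R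
          \<le> f R + \<kappa> / 2 * lInt i' j 0 R"
        using C(2)[OF R] unfolding j(5) f_def by (simp add: abs_le_iff)
      moreover have "aInt i' (j + 1) 0 R \<le> real (j + 1 + 2 * i') * aInt i' (j + 1) 0 R"
        using nn(1) mult_right_mono[of 1 "real (j + 1 + 2 * i')" "aInt i' (j + 1) 0 R"] by simp
      moreover have "\<kappa> * lInt i' j 0 R \<le> (\<kappa> + real i' - 1) * lInt i' j 0 R"
        using nn(2) by (intro mult_right_mono) (auto simp: i'_def)
      ultimately show "aInt i' (j + 1) 0 R + \<kappa> / 2 * lInt i' j 0 R \<le> f R" by (simp add: algebra_simps)
    qed
    have "ctrl (aInt i' (j + 1) 0)"
    proof (rule ctrl_mono[OF cf])
      fix R :: real assume "R > 0"
      then show "aInt i' (j + 1) 0 R \<le> f R"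
        using main[of R] kappa mult_nonneg_nonneg[of "\<kappa> / 2" "lInt i' j 0 R"] by linarith
    qed
    moreover have "ctrl (lInt i' j 0)"
    proof (rule ctrl_mono[OF ctrl_scale[OF cf, of "2 / \<kappa>"]])
      fix R :: real assume "R > 0"
      then have "\<kappa> / 2 * lInt i' j 0 R \<le> f R" using main[of R] by linarith
      then have "2 / \<kappa> * (\<kappa> / 2 * lInt i' j 0 R) \<le> 2 / \<kappa> * f R" using kappa by (intro mult_left_mono) auto
      then show "lInt i' j 0 R \<le> 2 / \<kappa> * f R" using kappa by simp
    qed (use kappa in auto)
    ultimately have "ctrl (lInt i' j 0)" "ctrl (aInt i' (k - i') 0)" by (simp_all only: j(2))
    then show ?case by (simp add: j_def i'_def)
  qed
  then show "ctrl (lInt i (k - 1 - i) 0)" "i \<ge> 1 \<Longrightarrow> ctrl (aInt i (k - i) 0)" using assms by auto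
qed

text \<open>\<open>T 0\<close> is the identity, so the last \<open>aInt\<close> in
  \<open>Stot\<close>, which \<open>ctrl_L\<close> does not reach, is itself an
  \<open>lInt\<close>.\<close>

lemma aInt_k: "aInt k 0 0 R = lInt (k - 1) 0 0 R"
proof -
  have 1: "rho x ^ k = rho x ^ (k - 1) * rho x" for x using k2 by (cases k) auto
  have 2: "1 - \<kappa> - real k + real 0 = - \<kappa> - real (k - 1) + real 0" using k2 by (simp add: of_nat_diff)
  show ?thesis unfolding aInt_def lInt_def aI_def lI_def 1 2 by (simp add: mult.assoc)
qed

text \<open>Every summand of \<open>Stot\<close> is controlled, so \<delta> = 1/2 absorbs
  \<open>Stot\<close> into itself. Apart from the cutoff, \<open>aInt 1 (k - 1) 0\<close> has the
  weight on the right of \<open>energy_estimate\<close>.\<close>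

lemma gradient_estimate: "\<exists>C\<ge>0. \<forall>R>0. aInt 1 (k - 1) 0 R \<le> C * Wtot R"
proof -
  have a: "ctrl (aInt i (k - i) 0)" if "i \<in> {1..k}" for i
  proof (cases "i = k")
    case True
    have "ctrl (lInt (k - 1) (k - 1 - (k - 1)) 0)" using k2 by (intro ctrl_L) auto
    then show ?thesis unfolding True by (rule ctrl_mono) (simp add: aInt_k)
  next
    case False
    then have "i < k" "i \<ge> 1" using that by auto
    then show ?thesis by (rule ctrl_L(2))
  qed
  have "ctrl Stot"
    unfolding Stot_def[abs_def] by (intro ctrl_add ctrl_sum ctrl_L(1) a) auto
  then obtain C where C: "C \<ge> 0" "\<And>R. R > 0 \<Longrightarrow> Stot R \<le> 1 / 2 * Stot R + C * Wtot R"
    unfolding ctrl_def by (metis half_gt_zero_iff zero_less_one)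
  have "aInt 1 (k - 1) 0 R \<le> 2 * C * Wtot R" if R: "R > 0" for R
    using C(2)[OF R] aInt_le_Stot[OF R, of 1] k2 by simp
  then show ?thesis using C(1) by (intro exI[of _ "2 * C"]) auto
qed

section \<open>Use of the growth hypothesis\<close>

definition \<gamma> :: real where "\<gamma> = 1 - \<kappa> + p"

lemma gamma_eq: "\<gamma> = (N * (real k + 1) - 2 * real k) / (N - 2 * real k)"
proof -
  have "\<gamma> * (N - 2 * real k) = N * (real k + 1) - 2 * real k"
    using N_kappa N_p unfolding \<gamma>_def by (simp add: algebra_simps)
  then show ?thesis using N by (simp add: nonzero_eq_divide_eq)
qed

text \<open>If R^(-2k) is at most u^(p - k), the left side is at most u^\<gamma>. Otherwise
  \<open>u\<close> is bounded by a power of \<open>R\<close>, and the exponents add up to -(N - 2k /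
  (k + 1)), which is at most 2 - N. The remainder R^(2 - N) integrates to a multiple of R^2 over a
  ball of comparable radius.\<close>

lemma interpolate:
  assumes R: "R \<ge> 1"
  shows "inverse R ^ (2 * k) * u x powr (1 - \<kappa> + real k) \<le> u x powr \<gamma> + R powr (2 - N)"
proof -
  define e where "e = p - real k"
  have eN: "e * (N - 2 * real k) = 2 * real k * (real k + 1)"
    using N_p unfolding e_def by (simp add: algebra_simps)
  have "0 < 2 * real k * (real k + 1)" using N by simp
  then have "0 < e * (N - 2 * real k)" by (simp only: eN)
  then have e: "e > 0" using N by (simp add: zero_less_mult_iff)
  have ir: "inverse R ^ (2 * k) = R powr (- (2 * real k))"
    using R by (simp add: powr_minus powr_realpow[symmetric] power_inverse)
  show ?thesis
  proof (cases "R powr (- (2 * real k)) \<le> u x powr e")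
    case True
    then have "R powr (- (2 * real k)) * u x powr (1 - \<kappa> + real k) \<le> u x powr e * u x powr (1 - \<kappa> + real k)"
      by (intro mult_right_mono) auto
    also have "\<dots> = u x powr \<gamma>" by (simp add: e_def \<gamma>_def add.commute flip: powr_add)
    finally show ?thesis using ir by (simp add: add_increasing2)
  next
    case False
    define g where "g = 1 - \<kappa> + real k"
    have g: "g > 0" using kappa by (simp add: g_def)
    have "u x powr g = (u x powr e) powr (g / e)" using e by (simp add: powr_powr)
    also have "\<dots> \<le> (R powr (- (2 * real k))) powr (g / e)"
      using False g e by (intro powr_mono2) auto
    also have "\<dots> = R powr (- (2 * real k) * (g / e))" by (simp add: powr_powr)
    finally have "R powr (- (2 * real k)) * u x powr g \<le> R powr (- (2 * real k)) * R powr (- (2 * real k) * (g / e))"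
      by (intro mult_left_mono) auto
    also have "\<dots> = R powr (- (2 * real k) * (1 + g / e))" by (simp add: algebra_simps flip: powr_add)
    also have "\<dots> \<le> R powr (2 - N)"
    proof (rule powr_mono[OF _ R])
      have "e + g = \<gamma>" by (simp add: e_def g_def \<gamma>_def)
      then have "1 + g / e = \<gamma> / e" using e by (simp add: field_simps)
      also have "\<dots> = (N * (real k + 1) - 2 * real k) / (2 * real k * (real k + 1))"
      proof -
        have "\<gamma> / e = (\<gamma> * (N - 2 * real k)) / (e * (N - 2 * real k))" using N by simp
        also have "\<gamma> * (N - 2 * real k) = N * (real k + 1) - 2 * real k" using N by (simp add: gamma_eq)
        finally show ?thesis by (simp only: eN)
      qed
      finally have "2 * real k * (1 + g / e) = 2 * real k * ((N * (real k + 1) - 2 * real k) / (2 * real k * (real k + 1)))"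
        by (rule arg_cong)
      also have "\<dots> = (N * (real k + 1) - 2 * real k) / (real k + 1)" using N by simp
      also have "\<dots> = N - 2 * real k / (real k + 1)" by (simp add: diff_divide_distrib)
      finally have "2 * real k * (1 + g / e) = N - 2 * real k / (real k + 1)" .
      moreover have "2 * real k / (real k + 1) \<le> 2" by (simp add: divide_le_eq)
      ultimately show "- (2 * real k) * (1 + g / e) \<le> 2 - N" by simp
    qed
    finally show ?thesis using ir by (simp add: g_def add_increasing)
  qed
qed

lemma Wtot_growth:
  assumes "\<exists>C>0. \<forall>\<^sub>F R in at_top. (LINT x:ball 0 R|lborel. u x powr \<gamma>) \<le> C * R\<^sup>2 * ln R"
  shows "\<exists>C\<ge>0. \<exists>R0>0. \<forall>R\<ge>R0. Wtot R \<le> C * R\<^sup>2 * ln R"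
proof -
  obtain C R1 where C: "C > 0" "\<And>R. R \<ge> R1 \<Longrightarrow> (LINT x:ball 0 R|lborel. u x powr \<gamma>) \<le> C * R\<^sup>2 * ln R"
    using assms by (auto simp: eventually_at_top_linorder)
  define B where "B = measure lborel (ball (0::real^'n) 1)"
  have B: "B \<ge> 0" by (simp add: B_def)
  \<comment> \<open>R \<ge> 3 gives ln (3 R) \<le> 2 ln R and ln R \<ge> 1. The radius 3 R is taken
    because its open ball contains the closed ball of radius 2 R that carries the cutoff.\<close>
  define R0 where "R0 = max R1 3"
  have "Wtot R \<le> (36 * C + 3 ^ CARD('n) * B) * R\<^sup>2 * ln R" if R: "R \<ge> R0" for R
  proof -
    have R3: "R \<ge> 3" "R > 0" "R \<ge> 1" "3 * R \<ge> R1" using R by (auto simp: R0_def)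
    let ?I = "\<lambda>x. indicator (ball 0 (3 * R)) x :: real"
    have iu: "integrable lborel (\<lambda>x. ?I x * u x powr \<gamma>)"
    proof -
      have "integrable lborel (\<lambda>x. indicator (cball 0 (3 * R)) x *\<^sub>R (u x powr \<gamma>))"
        by (rule borel_integrable_compact) (auto intro: continuous_on_subset[OF cont_upow])
      then have "set_integrable lborel (cball 0 (3 * R)) (\<lambda>x. u x powr \<gamma>)" by (simp add: set_integrable_def)
      then have "set_integrable lborel (ball 0 (3 * R)) (\<lambda>x. u x powr \<gamma>)"
        by (rule set_integrable_subset) auto
      then show ?thesis by (simp add: set_integrable_def)
    qed
    have fin: "emeasure lborel (ball (0::real^'n) (3 * R)) < \<infinity>" by (rule emeasure_bounded_finite) simp
    have i1: "integrable lborel (\<lambda>x::real^'n. ?I x)" using fin by (simp add: integrable_indicator_iff)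
    have supp: "cut R x = 0" if "x \<notin> ball 0 (3 * R)" for x :: "real^'n"
      using that R3 by (intro cut_support) auto
    have c1: "cut R x ^ q \<le> 1" for x :: "real^'n" and q using cut_01[of R x] by (simp add: power_le_one)
    have a1: "aI R 0 k 0 x \<le> ?I x * u x powr \<gamma>" for x
    proof (cases "x \<in> ball 0 (3 * R)")
      case True
      have "aI R 0 k 0 x = cut R x ^ m * u x powr \<gamma>"
        by (simp add: aI_def eqn' \<gamma>_def mult.assoc flip: powr_add)
      also have "\<dots> \<le> 1 * u x powr \<gamma>" by (intro mult_right_mono c1) auto
      finally show ?thesis using True by simp
    next
      case False
      then show ?thesis using supp by (simp add: aI_def m_def)
    qed
    have a2: "aI R 0 0 k x \<le> ?I x * u x powr \<gamma> + R powr (2 - N) * ?I x" for x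
    proof (cases "x \<in> ball 0 (3 * R)")
      case True
      have "aI R 0 0 k x = cut R x ^ (m - 2 * k) * (inverse R ^ (2 * k) * u x powr (1 - \<kappa> + real k))"
        by (simp add: aI_def)
      also have "\<dots> \<le> 1 * (inverse R ^ (2 * k) * u x powr (1 - \<kappa> + real k))"
        using R3 by (intro mult_right_mono c1) auto
      also have "\<dots> \<le> u x powr \<gamma> + R powr (2 - N)" using interpolate[OF R3(3), of x] by simp
      finally show ?thesis using True by simp
    next
      case False
      then show ?thesis using supp by (simp add: aI_def m_def)
    qed
    have "Wtot R \<le> (LINT x|lborel. ?I x * u x powr \<gamma>) + (LINT x|lborel. ?I x * u x powr \<gamma> + R powr (2 - N) * ?I x)"
      unfolding Wtot_def aInt_def using iu i1 R3
      by (intro add_mono integral_mono aI_int a1 a2 Bochner_Integration.integrable_add integrable_mult_right) auto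
    also have "\<dots> = 2 * (LINT x|lborel. ?I x * u x powr \<gamma>) + R powr (2 - N) * measure lborel (ball (0::real^'n) (3 * R))"
      using iu i1 by simp
    also have "(LINT x|lborel. ?I x * u x powr \<gamma>) = (LINT x:ball 0 (3 * R)|lborel. u x powr \<gamma>)"
      by (simp add: set_lebesgue_integral_def)
    also have "\<dots> \<le> C * (3 * R)\<^sup>2 * ln (3 * R)" by (rule C(2)[OF R3(4)])
    also have "ln (3 * R) \<le> 2 * ln R"
    proof -
      have "ln (3 * R) \<le> ln (R * R)" using R3 by (intro ln_mono) auto
      then show ?thesis using R3 by (simp add: ln_mult)
    qed
    also have "R powr (2 - N) * measure lborel (ball (0::real^'n) (3 * R)) = 3 ^ CARD('n) * B * R\<^sup>2"
    proof -
      have "measure lborel (ball (0::real^'n) (3 * R)) = (3 * R) ^ CARD('n) * B"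
        using content_ball_conv_unit_ball[of "3 * R" "0::real^'n"] R3 by (simp add: B_def)
      moreover have "R powr (2 - N) = R\<^sup>2 / R ^ CARD('n)"
        using R3 by (simp add: powr_diff N_def powr_realpow)
      ultimately show ?thesis using R3 by (simp add: power_mult_distrib)
    qed
    also have "3 ^ CARD('n) * B * R\<^sup>2 \<le> 3 ^ CARD('n) * B * R\<^sup>2 * ln R"
    proof -
      have "exp 1 \<le> R" using R3 exp_le by simp
      then have "1 \<le> ln R" using R3 by (simp add: ln_ge_iff)
      then have "3 ^ CARD('n) * B * R\<^sup>2 * 1 \<le> 3 ^ CARD('n) * B * R\<^sup>2 * ln R"
        using B by (intro mult_left_mono) auto
      then show ?thesis by simp
    qed
    finally have "Wtot R \<le> 2 * (C * (3 * R)\<^sup>2 * (2 * ln R)) + 3 ^ CARD('n) * B * R\<^sup>2 * ln R"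
      using C(1) by (simp add: mult_left_mono)
    then show ?thesis by (simp add: algebra_simps power_mult_distrib)
  qed
  moreover have "R0 > 0" by (simp add: R0_def)
  ultimately show ?thesis using C(1) B by (intro exI[of _ "36 * C + 3 ^ CARD('n) * B"] conjI exI[of _ R0]) auto
qed

end

section \<open>Dyadic averages of cutoffs and the vanishing of the defect\<close>

lemma C1c_sum:
  assumes "finite I" "\<And>i. i \<in> I \<Longrightarrow> C1c (f i) (F i)"
  shows "C1c (\<lambda>x. \<Sum>i\<in>I. c i * f i x) (\<lambda>x. \<Sum>i\<in>I. c i *\<^sub>R F i x)"
  unfolding C1c_def
proof (intro conjI allI)
  fix x
  have "((\<lambda>x. \<Sum>i\<in>I. c i * f i x) has_derivative (\<lambda>h. \<Sum>i\<in>I. c i * (F i x \<bullet> h))) (at x)"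
    using assms(2) by (intro has_derivative_sum has_derivative_mult_right) (auto simp: C1c_def)
  then show "((\<lambda>x. \<Sum>i\<in>I. c i * f i x) has_derivative (\<lambda>h. (\<Sum>i\<in>I. c i *\<^sub>R F i x) \<bullet> h)) (at x)"
    by (simp add: inner_sum_left)
next
  show "continuous_on UNIV (\<lambda>x. \<Sum>i\<in>I. c i *\<^sub>R F i x)"
    using assms(2) by (intro continuous_on_sum continuous_on_scaleR continuous_on_const) (auto simp: C1c_def)
next
  have "\<forall>i\<in>I. \<exists>R. \<forall>x. norm x > R \<longrightarrow> f i x = 0" using assms(2) by (auto simp: C1c_def)
  then obtain R where R: "\<forall>i\<in>I. \<forall>x. norm x > R i \<longrightarrow> f i x = 0" by metis
  define M where "M = Max (insert 0 (R ` I))"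
  have "R i \<le> M" if "i \<in> I" for i using assms(1) that by (simp add: M_def)
  then have "f i x = 0" if "i \<in> I" "norm x > M" for i x using R that by (meson le_less_trans)
  then show "\<exists>R. \<forall>x. R < norm x \<longrightarrow> (\<Sum>i\<in>I. c i * f i x) = 0"
    by (intro exI[of _ M]) (auto intro!: sum.neutral)
qed

text \<open>The admissible scales begin at \<open>2 ^ j \<ge> t / 2\<close>, so the geometric series
  is at most 4 / t. The induction carries the remaining tail \<open>2 / 2 ^ (a + n)\<close>, which
  closes it.\<close>

lemma dyadic_sum_le:
  fixes t :: real
  assumes "t \<ge> 0"
  shows "t * (\<Sum>j\<in>{j\<in>{a..<a + n}. t \<le> 2 ^ Suc j}. 1 / 2 ^ j) \<le> 4"
proof -
  define S where "S n = (\<Sum>j\<in>{j\<in>{a..<a + n}. t \<le> 2 ^ Suc j}. 1 / 2 ^ j :: real)" for n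
  have P: "S n = 0 \<or> t * S n + t * (2 / 2 ^ (a + n)) \<le> 4" for n
  proof (induction n)
    case 0
    then show ?case by (simp add: S_def)
  next
    case (Suc n)
    show ?case
    proof (cases "t \<le> 2 ^ Suc (a + n)")
      case True
      then have "{j\<in>{a..<a + Suc n}. t \<le> 2 ^ Suc j} = insert (a + n) {j\<in>{a..<a + n}. t \<le> 2 ^ Suc j}" by auto
      then have "S (Suc n) = 1 / 2 ^ (a + n) + S n" by (simp add: S_def)
      then have e: "t * S (Suc n) + t * (2 / 2 ^ (a + Suc n)) = t * S n + t * (2 / 2 ^ (a + n))"
        by (simp add: algebra_simps)
      have "t * (2 / 2 ^ (a + n)) \<le> 4" using True by (simp add: field_simps)
      then show ?thesis using Suc e by auto
    next
      case False
      then have "{j\<in>{a..<a + Suc n}. t \<le> 2 ^ Suc j} = {j\<in>{a..<a + n}. t \<le> 2 ^ Suc j}"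
        by (auto simp: less_Suc_eq)
      then have "S (Suc n) = S n" by (simp add: S_def)
      moreover have "t * (2 / 2 ^ (a + Suc n)) \<le> t * (2 / 2 ^ (a + n))"
        using assms by (intro mult_left_mono divide_left_mono) auto
      ultimately show ?thesis using Suc by auto
    qed
  qed
  have "t * (2 / 2 ^ (a + n)) \<ge> 0" using assms by simp
  then have "t * S n \<le> 4" using P[of n] by auto
  then show ?thesis by (simp add: S_def)
qed

text \<open>At \<open>x\<close> only scales with \<open>norm x \<le> 2 ^ Suc j\<close> contribute,
  and all their gradients are multiples of \<open>x\<close>. By \<open>dyadic_sum_le\<close> the
  cross terms then cost a bounded factor and not the number of scales.\<close>

lemma averaged_cut_grad:
  fixes c :: "nat \<Rightarrow> real" and x :: "real^'n"
  shows "(\<Sum>j\<in>{a..<a + n}. c j *\<^sub>R cut_grad (2 ^ j) 2 x) \<bullet> (\<Sum>j\<in>{a..<a + n}. c j *\<^sub>R cut_grad (2 ^ j) 2 x)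
    \<le> 8 * (4 / 3) ^ q * (\<Sum>j\<in>{a..<a + n}. (c j)\<^sup>2 / 4 ^ j * cut (2 ^ Suc j) x ^ q)"
proof -
  let ?J = "{j\<in>{a..<a + n}. norm x \<le> 2 ^ Suc j}"
  have z: "cut (2 ^ j) x = 0" if "j \<in> {a..<a + n} - ?J" for j
    using that by (intro cut_support) auto
  \<comment> \<open>With these weights 4^(-j) is \<open>w j * w j ^ 3\<close>. In Cauchy-Schwarz the
    squares of \<open>w\<close> form a geometric series, and those of the cubes leave 8^(-j),
    reduced to 4^(-j) by \<open>norm x \<le> 2 * 2 ^ j\<close>.\<close>
  define w where "w j = sqrt (1 / 2 ^ j)" for j :: nat
  define b where "b j = c j * cut (2 ^ j) x" for j
  have w2: "(w j)\<^sup>2 = 1 / 2 ^ j" for j by (simp add: w_def)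
  have w6: "(w j ^ 3)\<^sup>2 = 1 / 8 ^ j" for j
  proof -
    have "(w j ^ 3)\<^sup>2 = ((w j)\<^sup>2) ^ 3" by (simp flip: power_mult)
    also have "\<dots> = 1 / (2 ^ j) ^ 3" unfolding w2 by (simp add: power_divide)
    also have "(2 ^ j) ^ 3 = (8::real) ^ j" by (simp add: power_mult[symmetric] mult.commute[of j] ) (simp add: power_mult)
    finally show ?thesis .
  qed
  have w4: "w j * w j ^ 3 = 1 / 4 ^ j" for j
  proof -
    have "w j * w j ^ 3 = (w j)\<^sup>2 * (w j)\<^sup>2" by (simp add: power2_eq_square power3_eq_cube)
    also have "\<dots> = 1 / 4 ^ j" unfolding w2 by (simp flip: power_mult_distrib)
    finally show ?thesis .
  qed
  define H where "H = (\<Sum>j\<in>?J. w j * (b j * w j ^ 3))"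
  have "(\<Sum>j\<in>{a..<a + n}. c j *\<^sub>R cut_grad (2 ^ j) 2 x) = (\<Sum>j\<in>?J. c j *\<^sub>R cut_grad (2 ^ j) 2 x)"
    by (intro sum.mono_neutral_right) (use z in \<open>auto simp: cut_grad_def\<close>)
  also have "\<dots> = (\<Sum>j\<in>?J. (- (w j * (b j * w j ^ 3))) *\<^sub>R x)"
  proof (rule sum.cong)
    fix j
    have "((2::real) ^ j)\<^sup>2 = 4 ^ j" by (simp add: power2_eq_square flip: power_mult_distrib)
    moreover have "w j * (b j * w j ^ 3) = b j * (1 / 4 ^ j)"
      unfolding w4[symmetric] by (simp only: mult.left_commute)
    ultimately show "c j *\<^sub>R cut_grad (2 ^ j) 2 x = (- (w j * (b j * w j ^ 3))) *\<^sub>R x"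
      by (simp only:) (simp add: cut_grad_def b_def)
  qed simp
  also have "\<dots> = - H *\<^sub>R x" by (simp add: H_def sum_negf scaleR_sum_left)
  finally have e: "(\<Sum>j\<in>{a..<a + n}. c j *\<^sub>R cut_grad (2 ^ j) 2 x) = - H *\<^sub>R x" .
  have "H\<^sup>2 \<le> (\<Sum>j\<in>?J. (w j)\<^sup>2) * (\<Sum>j\<in>?J. (b j * w j ^ 3)\<^sup>2)"
    unfolding H_def by (rule Cauchy_Schwarz_ineq_sum)
  also have "\<dots> = (\<Sum>j\<in>?J. 1 / 2 ^ j) * (\<Sum>j\<in>?J. (b j)\<^sup>2 / 8 ^ j)"
    by (simp only: w2 w6 power_mult_distrib) simp
  finally have "(norm x)\<^sup>2 * H\<^sup>2 \<le> (norm x)\<^sup>2 * ((\<Sum>j\<in>?J. 1 / 2 ^ j) * (\<Sum>j\<in>?J. (b j)\<^sup>2 / 8 ^ j))"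
    by (intro mult_left_mono) auto
  also have "\<dots> = (norm x * (\<Sum>j\<in>?J. 1 / 2 ^ j)) * (\<Sum>j\<in>?J. norm x * ((b j)\<^sup>2 / 8 ^ j))"
    by (simp only: power2_eq_square sum_distrib_left mult_ac)
  also have "\<dots> \<le> 4 * (\<Sum>j\<in>?J. norm x * ((b j)\<^sup>2 / 8 ^ j))"
    by (intro mult_right_mono dyadic_sum_le sum_nonneg) auto
  also have "(\<Sum>j\<in>?J. norm x * ((b j)\<^sup>2 / 8 ^ j)) \<le> (\<Sum>j\<in>?J. 2 * (4 / 3) ^ q * ((c j)\<^sup>2 / 4 ^ j * cut (2 ^ Suc j) x ^ q))"
  proof (rule sum_mono)
    fix j assume "j \<in> ?J"
    then have x: "norm x \<le> 2 * 2 ^ j" by simp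
    have "(cut (2 ^ j) x)\<^sup>2 \<le> 1" using cut_01[of "2 ^ j" x] by (simp add: power_le_one)
    then have "(b j)\<^sup>2 \<le> (c j)\<^sup>2 * 1" unfolding b_def power_mult_distrib by (intro mult_left_mono) auto
    then have "norm x * ((b j)\<^sup>2 / 8 ^ j) \<le> (2 * 2 ^ j) * ((c j)\<^sup>2 / 8 ^ j)"
      using x by (intro mult_mono divide_right_mono) auto
    also have "\<dots> = 2 * ((c j)\<^sup>2 / 4 ^ j)"
    proof -
      have "(8::real) ^ j = 2 ^ j * 4 ^ j" by (simp flip: power_mult_distrib)
      then show ?thesis by simp
    qed
    also have "\<dots> \<le> 2 * ((c j)\<^sup>2 / 4 ^ j * ((4 / 3) ^ q * cut (2 ^ Suc j) x ^ q))"
    proof -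
      \<comment> \<open>The cutoff of twice the radius is at least 3/4 here, so any power of it can
        be inserted; this brings the bound into the form of \<open>aI\<close>.\<close>
      have "1 \<le> 4 / 3 * cut (2 ^ Suc j) x" using cut_lower[of "2 ^ Suc j" x] x by simp
      then have "1 \<le> (4 / 3 * cut (2 ^ Suc j) x) ^ q" by (rule one_le_power)
      then have "(c j)\<^sup>2 / 4 ^ j * 1 \<le> (c j)\<^sup>2 / 4 ^ j * ((4 / 3) ^ q * cut (2 ^ Suc j) x ^ q)"
        unfolding power_mult_distrib by (intro mult_left_mono) auto
      then show ?thesis by simp
    qed
    finally show "norm x * ((b j)\<^sup>2 / 8 ^ j) \<le> 2 * (4 / 3) ^ q * ((c j)\<^sup>2 / 4 ^ j * cut (2 ^ Suc j) x ^ q)"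
      by (simp add: mult_ac)
  qed
  also have "\<dots> \<le> (\<Sum>j\<in>{a..<a + n}. 2 * (4 / 3) ^ q * ((c j)\<^sup>2 / 4 ^ j * cut (2 ^ Suc j) x ^ q))"
    by (intro sum_mono2) (auto simp: cut_01(1))
  also have "4 * (\<Sum>j\<in>{a..<a + n}. 2 * (4 / 3) ^ q * ((c j)\<^sup>2 / 4 ^ j * cut (2 ^ Suc j) x ^ q))
      = 8 * (4 / 3) ^ q * (\<Sum>j\<in>{a..<a + n}. (c j)\<^sup>2 / 4 ^ j * cut (2 ^ Suc j) x ^ q)"
    by (simp only: sum_distrib_left[symmetric])
  finally have "(norm x)\<^sup>2 * H\<^sup>2 \<le> 8 * (4 / 3) ^ q * (\<Sum>j\<in>{a..<a + n}. (c j)\<^sup>2 / 4 ^ j * cut (2 ^ Suc j) x ^ q)"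
    by simp
  moreover have "(- H *\<^sub>R x) \<bullet> (- H *\<^sub>R x) = (norm x)\<^sup>2 * H\<^sup>2"
    by (simp add: dot_square_norm power2_eq_square)
  ultimately show ?thesis unfolding e by simp
qed

lemma continuous_nonneg_integral_0:
  fixes f :: "real^'n \<Rightarrow> real"
  assumes "continuous_on UNIV f" "integrable lborel f" "\<And>x. f x \<ge> 0" "(LINT x|lborel. f x) \<le> 0"
  shows "f x = 0"
proof -
  have "(LINT x|lborel. f x) = 0" using assms(3,4) by (intro antisym integral_nonneg) auto
  then have "AE x in lborel. f x = 0"
    using integral_nonneg_eq_0_iff_AE[OF assms(2)] assms(3) by auto
  then have "AE x in lebesgue. f x = 0" by (rule AE_completion)
  then have "{x. f x \<noteq> 0} \<in> null_sets lebesgue"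
    by (simp add: completion.AE_iff_null_sets)
  then have "negligible {x. f x \<noteq> 0}" by (simp add: negligible_iff_null_sets)
  moreover have "open {x. f x \<noteq> 0}"
    using assms(1) by (intro open_Collect_neq continuous_on_const)
  ultimately have "{x. f x \<noteq> 0} = {}" using open_not_negligible by blast
  then show ?thesis by blast
qed

context hessian_solution
begin

text \<open>At the radius \<open>2 ^ Suc j\<close> the bound R^2 log R becomes a multiple of
  \<open>4 ^ j * real j\<close>.\<close>

lemma weighted_gradient_growth:
  assumes "\<exists>C>0. \<forall>\<^sub>F R in at_top. (LINT x:ball 0 R|lborel. u x powr \<gamma>) \<le> C * R\<^sup>2 * ln R"
  shows "\<exists>K\<ge>0. \<exists>j0. \<forall>j\<ge>j0. aInt 1 (k - 1) 0 (2 ^ Suc j) \<le> K * 4 ^ j * real j"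
proof -
  obtain C where C: "C \<ge> 0" "\<And>R. R > 0 \<Longrightarrow> aInt 1 (k - 1) 0 R \<le> C * Wtot R"
    using gradient_estimate by blast
  obtain D R0 where D: "D \<ge> 0" "\<And>R. R \<ge> R0 \<Longrightarrow> Wtot R \<le> D * R\<^sup>2 * ln R"
    using Wtot_growth[OF assms] by blast
  obtain j1 where j1: "R0 < 2 ^ j1" using real_arch_pow[of 2 R0] by auto
  have "aInt 1 (k - 1) 0 (2 ^ Suc j) \<le> (8 * C * D) * 4 ^ j * real j" if j: "j \<ge> max j1 1" for j
  proof -
    have "(2::real) ^ j1 \<le> 2 ^ Suc j" using j by (intro power_increasing) auto
    then have R: "2 ^ Suc j \<ge> R0" using j1 by linarith
    have "ln ((2::real) ^ Suc j) = real (Suc j) * ln 2" by (rule ln_realpow)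
    also have "\<dots> \<le> real (Suc j) * 1" using ln_2_less_1 by (intro mult_left_mono) auto
    also have "\<dots> \<le> 2 * real j" using j by simp
    finally have l: "ln ((2::real) ^ Suc j) \<le> 2 * real j" .
    have "aInt 1 (k - 1) 0 (2 ^ Suc j) \<le> C * Wtot (2 ^ Suc j)" by (rule C(2)) simp
    also have "\<dots> \<le> C * (D * (2 ^ Suc j)\<^sup>2 * ln (2 ^ Suc j))" by (intro mult_left_mono D(2) R C(1))
    also have "\<dots> \<le> C * (D * (2 ^ Suc j)\<^sup>2 * (2 * real j))"
      using C(1) D(1) by (intro mult_left_mono l) auto
    also have "((2::real) ^ Suc j)\<^sup>2 = 4 * 4 ^ j" by (simp add: power2_eq_square flip: power_mult_distrib)
    finally show ?thesis by (simp add: mult_ac)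
  qed
  then show ?thesis using C(1) D(1) by (intro exI[of _ "8 * C * D"] conjI exI[of _ "max j1 1"]) auto
qed

text \<open>The radial averages with weights \<open>1 / j\<close> over dyadic scales gain a factor \<open>1 / h\<close>, where
  \<open>h\<close> is a partial sum of the harmonic series.\<close>

lemma Q_integral_bound:
  assumes K: "\<And>j. j \<ge> a \<Longrightarrow> aInt 1 (k - 1) 0 (2 ^ Suc j) \<le> K * 4 ^ j * real j" and a: "a \<ge> 1"
    and h: "h = (\<Sum>j\<in>{a..<a + n}. 1 / real j)" "h > 0" and r: "r > 0" "2 * r \<le> 2 ^ a"
  shows "(LINT x|lborel. (cut r x)\<^sup>2 * u x powr (-\<kappa>) * Q x)
    \<le> (16 / 9)\<^sup>2 * (4 * Cf * (8 * (4 / 3) ^ m * (K / h)))"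
proof -
  \<comment> \<open>The weights sum to one. Against the bound \<open>K * 4 ^ j * real j\<close> they
    contribute the sum of \<open>(c j)\<^sup>2 * real j\<close>, and weights proportional to 1 / j
    minimise it for a fixed total; the minimum is 1 / h.\<close>
  define c where "c j = 1 / (real j * h)" for j
  define z where "z x = (\<Sum>j\<in>{a..<a + n}. c j * cut (2 ^ j) x ^ 2)" for x :: "real^'n"
  define Z where "Z x = (\<Sum>j\<in>{a..<a + n}. c j *\<^sub>R cut_grad (2 ^ j) 2 x)" for x :: "real^'n"
  have c0: "c j \<ge> 0" for j using h(2) by (simp add: c_def)
  have zc: "C1c z Z" unfolding z_def[abs_def] Z_def[abs_def] by (intro C1c_sum C1c_cut) auto
  have cz: "continuous_on UNIV z" "continuous_on UNIV Z"
    using zc C1c_continuous[OF zc] by (auto simp: C1c_def)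
  obtain R where R: "\<And>x. norm x > R \<Longrightarrow> z x = 0" "\<And>x. norm x > R \<Longrightarrow> Z x = 0"
    using C1c_support[OF zc] by blast
  have sc: "(\<Sum>j\<in>{a..<a + n}. c j) = 1"
  proof -
    have "(\<Sum>j\<in>{a..<a + n}. c j) = (\<Sum>j\<in>{a..<a + n}. 1 / real j) / h"
      by (simp add: c_def sum_divide_distrib)
    then show ?thesis using h by simp
  qed
  have zl: "z x \<ge> 9 / 16" if "norm x \<le> 2 ^ a" for x
  proof -
    have "(\<Sum>j\<in>{a..<a + n}. c j * (9 / 16)) \<le> z x"
      unfolding z_def
    proof (intro sum_mono mult_left_mono c0)
      fix j assume "j \<in> {a..<a + n}"
      then have "(2::real) ^ a \<le> 2 ^ j" by (intro power_increasing) auto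
      then have "norm x \<le> 2 ^ j" using that by linarith
      then have "3 / 4 \<le> cut (2 ^ j) x" by (intro cut_lower) auto
      then have "(3 / 4)\<^sup>2 \<le> (cut (2 ^ j) x)\<^sup>2" by (intro power_mono) auto
      then show "9 / 16 \<le> (cut (2 ^ j) x)\<^sup>2" by (simp add: power2_eq_square)
    qed
    then show ?thesis by (simp only: sc mult_1 flip: sum_distrib_right)
  qed
  have i1: "integrable lborel (\<lambda>x. (cut r x)\<^sup>2 * u x powr (-\<kappa>) * Q x)"
    by (rule integrable_cs[of _ "2 * r"]) (intro conts continuous_on_cut cont_Q, use cut_support[OF r(1)] in auto)
  have i2: "integrable lborel (\<lambda>x. (z x)\<^sup>2 * u x powr (-\<kappa>) * Q x)"
    by (rule integrable_cs[of _ R]) (intro conts cz cont_Q, use R in auto)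
  have i3: "integrable lborel (\<lambda>x. u x powr (-\<kappa>) * rho x * s (k - 1) x * (Z x \<bullet> Z x))"
    by (rule integrable_cs[of _ R]) (intro conts cz continuous_on_sg, use R in auto)
  have "(LINT x|lborel. (cut r x)\<^sup>2 * u x powr (-\<kappa>) * Q x)
      \<le> (LINT x|lborel. (16 / 9)\<^sup>2 * ((z x)\<^sup>2 * u x powr (-\<kappa>) * Q x))"
  proof (rule integral_mono[OF i1 integrable_mult_right[OF i2]])
    fix x
    have "(cut r x)\<^sup>2 \<le> (16 / 9 * z x)\<^sup>2"
    proof (cases "norm x > 2 * r")
      case True
      then have "cut r x = 0" by (rule cut_support[OF r(1)])
      then show ?thesis by simp
    next
      case False
      then have "cut r x \<le> 16 / 9 * z x" using zl[of x] r(2) cut_01(2)[of r x] by simp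
      then show ?thesis by (intro power_mono cut_01)
    qed
    then have "(cut r x)\<^sup>2 * (u x powr (-\<kappa>) * Q x) \<le> (16 / 9 * z x)\<^sup>2 * (u x powr (-\<kappa>) * Q x)"
      using Q_nonneg[of x] by (intro mult_right_mono) auto
    then show "(cut r x)\<^sup>2 * u x powr (-\<kappa>) * Q x \<le> (16 / 9)\<^sup>2 * ((z x)\<^sup>2 * u x powr (-\<kappa>) * Q x)"
      by (simp only: power_mult_distrib mult.assoc)
  qed
  also have "\<dots> = (16 / 9)\<^sup>2 * (LINT x|lborel. (z x)\<^sup>2 * u x powr (-\<kappa>) * Q x)" by simp
  also have "\<dots> \<le> (16 / 9)\<^sup>2 * (4 * Cf * (LINT x|lborel. u x powr (-\<kappa>) * rho x * s (k - 1) x * (Z x \<bullet> Z x)))"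
    by (intro mult_left_mono energy_estimate zc) auto
  also have "(LINT x|lborel. u x powr (-\<kappa>) * rho x * s (k - 1) x * (Z x \<bullet> Z x))
      \<le> (LINT x|lborel. 8 * (4 / 3) ^ m * (\<Sum>j\<in>{a..<a + n}. (c j)\<^sup>2 / 4 ^ j * aI (2 ^ Suc j) 1 (k - 1) 0 x))"
  proof (rule integral_mono[OF i3])
    show "integrable lborel (\<lambda>x. 8 * (4 / 3) ^ m * (\<Sum>j\<in>{a..<a + n}. (c j)\<^sup>2 / 4 ^ j * aI (2 ^ Suc j) 1 (k - 1) 0 x))"
      by (intro integrable_mult_right Bochner_Integration.integrable_sum aI_int) auto
    fix x
    define E where "E = u x powr (-\<kappa>) * rho x * s (k - 1) x"
    have E: "E \<ge> 0" using s_pos[of "k - 1" x] by (simp add: E_def)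
    have "E * (Z x \<bullet> Z x) \<le> E * (8 * (4 / 3) ^ m * (\<Sum>j\<in>{a..<a + n}. (c j)\<^sup>2 / 4 ^ j * cut (2 ^ Suc j) x ^ m))"
      unfolding Z_def by (intro mult_left_mono averaged_cut_grad E)
    also have "\<dots> = 8 * (4 / 3) ^ m * (\<Sum>j\<in>{a..<a + n}. (c j)\<^sup>2 / 4 ^ j * (cut (2 ^ Suc j) x ^ m * E))"
      by (simp add: sum_distrib_left mult_ac)
    also have "(\<lambda>j. cut (2 ^ Suc j) x ^ m * E) = (\<lambda>j. aI (2 ^ Suc j) 1 (k - 1) 0 x)"
      by (simp add: aI_def E_def mult.assoc)
    finally show "u x powr (-\<kappa>) * rho x * s (k - 1) x * (Z x \<bullet> Z x)
        \<le> 8 * (4 / 3) ^ m * (\<Sum>j\<in>{a..<a + n}. (c j)\<^sup>2 / 4 ^ j * aI (2 ^ Suc j) 1 (k - 1) 0 x)"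
      by (simp only: E_def)
  qed
  also have "\<dots> = 8 * (4 / 3) ^ m * (\<Sum>j\<in>{a..<a + n}. (c j)\<^sup>2 / 4 ^ j * aInt 1 (k - 1) 0 (2 ^ Suc j))"
    unfolding aInt_def
    by (subst integral_mult_right_zero, subst Bochner_Integration.integral_sum)
      (auto intro!: integrable_mult_right aI_int simp del: power_Suc)
  also have "(\<Sum>j\<in>{a..<a + n}. (c j)\<^sup>2 / 4 ^ j * aInt 1 (k - 1) 0 (2 ^ Suc j)) \<le> (\<Sum>j\<in>{a..<a + n}. K / h\<^sup>2 * (1 / real j))"
  proof (rule sum_mono)
    fix j assume j: "j \<in> {a..<a + n}"
    have "(c j)\<^sup>2 / 4 ^ j * aInt 1 (k - 1) 0 (2 ^ Suc j) \<le> (c j)\<^sup>2 / 4 ^ j * (K * 4 ^ j * real j)"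
      using j by (intro mult_left_mono K) auto
    also have "\<dots> = K * ((c j)\<^sup>2 * real j)" by simp
    also have "(c j)\<^sup>2 * real j = 1 / h\<^sup>2 * (1 / real j)" using a j by (simp add: c_def power2_eq_square)
    finally show "(c j)\<^sup>2 / 4 ^ j * aInt 1 (k - 1) 0 (2 ^ Suc j) \<le> K / h\<^sup>2 * (1 / real j)" by simp
  qed
  also have "\<dots> = K / h\<^sup>2 * h" unfolding h(1) by (simp only: sum_distrib_left)
  also have "\<dots> = K / h" using h(2) by (simp add: power2_eq_square)
  finally show ?thesis using Cf by (simp add: mult_left_mono)
qed

lemma Q_eq_0:
  assumes "\<exists>C>0. \<forall>\<^sub>F R in at_top. (LINT x:ball 0 R|lborel. u x powr \<gamma>) \<le> C * R\<^sup>2 * ln R"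
  shows "Q y = 0"
proof -
  obtain K j0 where K: "K \<ge> 0" "\<And>j. j \<ge> j0 \<Longrightarrow> aInt 1 (k - 1) 0 (2 ^ Suc j) \<le> K * 4 ^ j * real j"
    using weighted_gradient_growth[OF assms] by blast
  define r where "r = norm y + 1"
  have r: "r > 0" by (simp add: r_def add_nonneg_pos)
  obtain j1 where j1: "2 * r < 2 ^ j1" using real_arch_pow[of 2 "2 * r"] by auto
  define a where "a = max (max j0 j1) 1"
  have "(2::real) ^ j1 \<le> 2 ^ a" by (intro power_increasing) (auto simp: a_def)
  then have ra: "2 * r \<le> 2 ^ a" using j1 by linarith
  define D where "D = (16 / 9)\<^sup>2 * (4 * Cf * (8 * (4 / 3) ^ m * K))"
  have D: "D \<ge> 0" using Cf K(1) by (simp add: D_def)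
  let ?f = "\<lambda>x. (cut r x)\<^sup>2 * u x powr (-\<kappa>) * Q x"
  have "(LINT x|lborel. ?f x) \<le> 0"
  proof (rule field_le_epsilon)
    fix e :: real assume e: "e > 0"
    \<comment> \<open>The first scale \<open>a\<close> stays fixed, and the window is lengthened
      until the harmonic sum \<open>h\<close> exceeds \<open>D / e\<close>.\<close>
    have "\<forall>\<^sub>F n in sequentially. (harm n :: real) > D / e + harm a"
      using harm_at_top by (auto simp: filterlim_at_top_dense)
    then obtain n where n: "n \<ge> a" "harm n > D / e + harm a"
      by (metis (mono_tags) eventually_sequentially nat_le_linear)
    define n' where "n' = Suc n - a"
    define h where "h = (\<Sum>j\<in>{a..<a + n'}. 1 / real j)"
    have "harm n \<le> harm a + h"
    proof -
      have "{1..n} \<subseteq> {1..a} \<union> {a..<a + n'}" using n(1) by (auto simp: n'_def)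
      then have "harm n \<le> (\<Sum>j\<in>{1..a} \<union> {a..<a + n'}. 1 / real j)"
        unfolding harm_def by (simp add: divide_inverse) (intro sum_mono2, auto)
      also have "\<dots> \<le> (\<Sum>j\<in>{1..a}. 1 / real j) + h"
        unfolding h_def by (subst sum_Un) (auto intro!: sum_nonneg)
      finally show ?thesis by (simp add: harm_def divide_inverse)
    qed
    then have hD: "h > D / e" using n(2) by linarith
    then have h: "h > 0" using D e by (meson divide_nonneg_pos le_less_trans)
    have "(LINT x|lborel. ?f x) \<le> (16 / 9)\<^sup>2 * (4 * Cf * (8 * (4 / 3) ^ m * (K / h)))"
      by (rule Q_integral_bound[OF _ _ h_def h r ra]) (use K(2) in \<open>auto simp: a_def simp del: power_Suc\<close>)
    also have "\<dots> = D / h" by (simp add: D_def)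
    also have "\<dots> \<le> e" using hD h e by (simp add: field_simps)
    finally show "(LINT x|lborel. ?f x) \<le> 0 + e" by simp
  qed
  moreover have cont: "continuous_on UNIV ?f" by (intro conts continuous_on_cut cont_Q)
  moreover have "integrable lborel ?f"
    by (rule integrable_cs[OF cont, of "2 * r"]) (use cut_support[OF r] in auto)
  moreover have "?f x \<ge> 0" for x using Q_nonneg[of x] by simp
  ultimately have "?f y = 0" using continuous_nonneg_integral_0[of ?f y] by blast
  moreover have "cut r y \<ge> 3 / 4" using r by (intro cut_lower) (auto simp: r_def)
  ultimately show ?thesis using u_pos[of y] by simp
qed

end

subsection \<open>Rigidity\<close>

lemma sg_scalar:
  fixes A :: "real^'n^'n"
  assumes "transpose A = A" "\<And>h. A *v h = r *\<^sub>R h"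
  shows "sg A k = real (CARD('n) choose k) * r ^ k"
proof -
  obtain q l where eb: "eigbasis A q l" using symmetric_eigbasis[OF assms(1)] .
  have "l i = r" for i
  proof -
    have "l i = (l i *\<^sub>R q i) \<bullet> q i" using eb by (simp add: eigbasis_def)
    also have "l i *\<^sub>R q i = r *\<^sub>R q i" using eb assms(2)[of "q i"] by (simp add: eigbasis_def)
    also have "(r *\<^sub>R q i) \<bullet> q i = r" using eb by (simp add: eigbasis_def)
    finally show ?thesis .
  qed
  then have "l = (\<lambda>_. r)" by auto
  then show ?thesis using eb_sg[OF eb, of k] by (simp add: esym_const)
qed

text \<open>The i-th component of \<open>F\<close> depends only on the i-th coordinate, hence so
  does its derivative \<open>L\<close>. This holds for two different coordinates, so
  \<open>L\<close> is constant. Differentiating \<open>L\<close> would take third derivatives of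
  \<open>u\<close>.\<close>

lemma conformal_derivative_const:
  fixes F :: "real^'n \<Rightarrow> real^'n"
  assumes n: "CARD('n) \<ge> 2" and F: "\<And>x. (F has_derivative (\<lambda>h. L x *\<^sub>R h)) (at x)"
  shows "L x = L y"
proof -
  have line: "((\<lambda>t. F (x + t *\<^sub>R e) $ i) has_real_derivative L (x + t *\<^sub>R e) * e $ i) (at t)" for x e i t
  proof -
    have "((\<lambda>t. x + t *\<^sub>R e) has_derivative (\<lambda>d. d *\<^sub>R e)) (at t)" by (auto intro!: derivative_eq_intros)
    from has_derivative_compose[OF this F]
    have "((\<lambda>t. F (x + t *\<^sub>R e)) has_derivative (\<lambda>d. L (x + t *\<^sub>R e) *\<^sub>R (d *\<^sub>R e))) (at t)" .
    from bounded_linear.has_derivative[OF bounded_linear_vec_nth this, of i]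
    show ?thesis
      unfolding has_field_derivative_def by (rule has_derivative_eq_rhs) (simp add: fun_eq_iff mult_ac)
  qed
  have a: "F x $ i = F y $ i" if "x $ i = y $ i" for x y i
  proof -
    have "\<forall>t. ((\<lambda>t. F (x + t *\<^sub>R (y - x)) $ i) has_real_derivative 0) (at t)"
      using line[of x "y - x" i] that by simp
    from DERIV_isconst_all[OF this, of 0 1] show ?thesis by simp
  qed
  have b: "L x = L y" if "x $ i = y $ i" for x y i
  proof -
    have "(\<lambda>t. F (x + t *\<^sub>R axis i 1) $ i) = (\<lambda>t. F (y + t *\<^sub>R axis i 1) $ i)"
      using that by (intro ext a) simp
    then show ?thesis
      using DERIV_unique[OF line[of x "axis i 1" i 0]] line[of y "axis i 1" i 0] by simp
  qed
  obtain i j :: 'n where ij: "i \<noteq> j"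
  proof -
    have "\<not> card (UNIV :: 'n set) \<le> Suc 0" using n by simp
    then show ?thesis using that by (auto simp: card_le_Suc0_iff_eq)
  qed
  define z :: "real^'n" where "z = (\<chi> l. if l = i then x $ l else y $ l)"
  have "L x = L z" by (rule b[of _ i]) (simp add: z_def)
  also have "L z = L y" by (rule b[of _ j]) (use ij in \<open>simp add: z_def\<close>)
  finally show ?thesis .
qed

context hessian_solution
begin

lemma A_of_Q_eq_0:
  assumes "Q x = 0"
  shows "\<exists>r. \<forall>h. A x *v h = r *\<^sub>R h - ((1 + \<kappa>) / u x * (Du x \<bullet> h)) *\<^sub>R Du x"
proof -
  obtain q l where cp: "cone_point (A x) k q l" by (rule cone_point_A)
  have "\<kappa> / u x > 0" using kappa u_pos by simp
  moreover have "real CARD('n) * (\<kappa> / u x) / (2 * real k) = (1 + \<kappa>) / u x"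
  proof -
    have "N * \<kappa> = 2 * real k * (1 + \<kappa>)" using N_kappa by (simp add: algebra_simps)
    then have "N * (\<kappa> / u x) / (2 * real k) = 2 * real k * (1 + \<kappa>) / u x / (2 * real k)" by simp
    also have "\<dots> = (1 + \<kappa>) / u x" using N by simp
    finally show ?thesis by (simp add: N_def)
  qed
  ultimately show ?thesis using cone_point.defect_eq_0[OF cp assms] by simp
qed

text \<open>For \<open>v = u powr (-\<kappa>)\<close> the rank-one part of \<open>A\<close> cancels
  the one from the chain rule, so the Hessian of \<open>v\<close> is a constant multiple of the
  identity. The equation at the critical point of \<open>v\<close> gives the normalisation of
  \<open>a0\<close> and \<open>b0\<close>.\<close>

lemma bubble:
  assumes Q: "\<And>x. Q x = 0"
  shows "\<exists>x0 a0 b0. a0 > 0 \<and> b0 > 0 \<and>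
    real (CARD('n) choose k) * a0 * ((N - 2 * real k) / real k * b0) ^ k = 1 \<and>
    (\<forall>x. u x = (a0 + b0 * (norm (x - x0))\<^sup>2) powr (- ((N - 2 * real k) / (2 * real k))))"
proof -
  obtain r where r: "\<And>x h. A x *v h = r x *\<^sub>R h - ((1 + \<kappa>) / u x * (Du x \<bullet> h)) *\<^sub>R Du x"
    using A_of_Q_eq_0[OF Q] by metis
  define v where "v x = u x powr (- \<kappa>)" for x
  define F where "F x = (- \<kappa> * u x powr (- \<kappa> - 1)) *\<^sub>R Du x" for x
  define L where "L x = \<kappa> * u x powr (- \<kappa> - 1) * r x" for x
  have v_pos: "v x > 0" for x using u_pos[of x] by (simp add: v_def)
  have dv: "(v has_derivative (\<lambda>h. F x \<bullet> h)) (at x)" for x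
    using C1_upow[of "- \<kappa>"] unfolding C1_def v_def[abs_def] F_def by blast
  have dF: "(F has_derivative (\<lambda>h. L x *\<^sub>R h)) (at x)" for x
  proof -
    have "((\<lambda>x. u x powr (- \<kappa> - 1)) has_derivative (\<lambda>h. (((- \<kappa> - 1) * u x powr (- \<kappa> - 1 - 1)) *\<^sub>R Du x) \<bullet> h)) (at x)"
      using C1_upow[of "- \<kappa> - 1"] unfolding C1_def by blast
    from has_derivative_scaleR[OF has_derivative_mult_right[OF this, of "- \<kappa>"] deriv_Du]
    have "(F has_derivative (\<lambda>h. (- \<kappa> * u x powr (- \<kappa> - 1)) *\<^sub>R (- (A x *v h))
        + (- \<kappa> * ((((- \<kappa> - 1) * u x powr (- \<kappa> - 1 - 1)) *\<^sub>R Du x) \<bullet> h)) *\<^sub>R Du x)) (at x)"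
      unfolding F_def[abs_def] .
    moreover have "(- \<kappa> * u x powr (- \<kappa> - 1)) *\<^sub>R (- (A x *v h))
        + (- \<kappa> * ((((- \<kappa> - 1) * u x powr (- \<kappa> - 1 - 1)) *\<^sub>R Du x) \<bullet> h)) *\<^sub>R Du x = L x *\<^sub>R h" for h
    proof -
      have e: "u x powr (- \<kappa> - 1 - 1) = u x powr (- \<kappa> - 1) / u x"         unfolding powr_diff[of "u x" "- \<kappa> - 1" 1] using u_pos[of x] by simp
      have "(- \<kappa> * u x powr (- \<kappa> - 1)) *\<^sub>R (- (A x *v h)) = L x *\<^sub>R h
          - (\<kappa> * u x powr (- \<kappa> - 1) * ((1 + \<kappa>) / u x * (Du x \<bullet> h))) *\<^sub>R Du x"
        by (simp add: r L_def scaleR_diff_right)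
      moreover have "- \<kappa> * ((((- \<kappa> - 1) * u x powr (- \<kappa> - 1 - 1)) *\<^sub>R Du x) \<bullet> h)
          = \<kappa> * u x powr (- \<kappa> - 1) * ((1 + \<kappa>) / u x * (Du x \<bullet> h))"
        unfolding e by (simp add: field_simps)
      ultimately show ?thesis by simp
    qed
    ultimately show ?thesis by simp
  qed
  define c where "c = L 0"
  have L: "L x = c" for x
    unfolding c_def by (rule conformal_derivative_const[OF _ dF]) (use nk k2 in simp)
  define b where "b = F 0"
  have F: "F x = c *\<^sub>R x + b" for x
  proof -
    have "((\<lambda>x. F x - c *\<^sub>R x) has_derivative (\<lambda>h. 0)) (at x within UNIV)" for x
      using dF[of x] by (auto intro!: derivative_eq_intros simp: L)
    from has_derivative_zero_unique[OF convex_UNIV this, of 0 x]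
    show ?thesis by (simp add: b_def algebra_simps)
  qed
  have crit: "c = \<kappa> * u y powr (- \<kappa> - 1) * r y \<and> real (CARD('n) choose k) * r y ^ k = u y powr p" if "F y = 0" for y
  proof -
    have "Du y = 0" using that kappa u_ne[of y] by (simp add: F_def)
    then have "A y *v h = r y *\<^sub>R h" for h by (simp add: r)
    then show ?thesis using sg_scalar[OF symA, of y "r y" k] eqn'[of y] L[of y] by (simp add: L_def)
  qed
  \<comment> \<open>For \<open>c = 0\<close> the function \<open>v\<close> would be affine. If
    nonconstant it would vanish somewhere; if constant, every point would be critical with
    \<open>r = 0\<close>, and the k-th symmetric function would vanish.\<close>
  have c0: "c \<noteq> 0"
  proof
    assume c: "c = 0"
    have "b = 0"
    proof (rule ccontr)
      assume b: "b \<noteq> 0"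
      have "((\<lambda>x. v x - b \<bullet> x) has_derivative (\<lambda>h. 0)) (at x within UNIV)" for x
        using dv[of x] by (auto intro!: derivative_eq_intros simp: F c)
      from has_derivative_zero_unique[OF convex_UNIV this, of "- (v 0 / (b \<bullet> b)) *\<^sub>R b" 0]
      have "v (- (v 0 / (b \<bullet> b)) *\<^sub>R b) = 0" using b by simp
      then show False using v_pos[of "- (v 0 / (b \<bullet> b)) *\<^sub>R b"] by simp
    qed
    then have "F 0 = 0" by (simp add: F)
    from crit[OF this] have "r 0 = 0" "real (CARD('n) choose k) * r 0 ^ k = u 0 powr p"
      using c kappa u_ne[of 0] by auto
    then show False using k2 u_ne[of 0] by (simp add: power_0_left)
  qed
  define x0 where "x0 = - (1 / c) *\<^sub>R b"
  have F0: "F x = c *\<^sub>R (x - x0)" for x using c0 by (simp add: F x0_def algebra_simps)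
  define a0 where "a0 = v x0"
  have v: "v x = a0 + c / 2 * (norm (x - x0))\<^sup>2" for x
  proof -
    have "((\<lambda>x. v x - c / 2 * ((x - x0) \<bullet> (x - x0))) has_derivative (\<lambda>h. 0)) (at x within UNIV)" for x
      using dv[of x] by (auto intro!: derivative_eq_intros simp: F0 inner_commute)
    from has_derivative_zero_unique[OF convex_UNIV this, of x x0]
    show ?thesis by (simp add: a0_def dot_square_norm)
  qed
  have a0: "a0 > 0" using v_pos by (simp add: a0_def)
  \<comment> \<open>For negative \<open>c\<close> the paraboloid \<open>v\<close> would reach zero
    at distance \<open>t\<close> from its vertex.\<close>
  have c: "c > 0"
  proof (rule ccontr)
    assume "\<not> c > 0"
    then have cn: "c < 0" using c0 by simp
    define i :: 'n where "i = undefined"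
    define t where "t = sqrt (- (2 * a0 / c))"
    have "0 \<le> - (2 * a0 / c)" using cn a0 by (simp add: divide_nonneg_neg divide_nonpos_neg divide_le_0_iff)
    then have "t\<^sup>2 = - (2 * a0 / c)" unfolding t_def by simp
    moreover have "norm (x0 + t *\<^sub>R axis i 1 - x0) = \<bar>t\<bar>" by simp
    ultimately have "v (x0 + t *\<^sub>R axis i 1) = 0" unfolding v using cn by simp
    then show False using v_pos[of "x0 + t *\<^sub>R axis i 1"] by simp
  qed
  define b0 where "b0 = c / 2"
  have "u x = (a0 + b0 * (norm (x - x0))\<^sup>2) powr (- ((N - 2 * real k) / (2 * real k)))" for x
  proof -
    have "- \<kappa> * (- ((N - 2 * real k) / (2 * real k))) = 1" using N by (simp add: \<kappa>_def)
    then have "v x powr (- ((N - 2 * real k) / (2 * real k))) = u x"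
      unfolding v_def powr_powr using u_pos[of x] by simp
    then show ?thesis using v[of x] by (simp add: b0_def)
  qed
  moreover have "real (CARD('n) choose k) * a0 * ((N - 2 * real k) / real k * b0) ^ k = 1"
  proof -
    define U where "U = u x0"
    have U: "U > 0" by (simp add: U_def u_pos)
    have cr: "c = \<kappa> * U powr (- \<kappa> - 1) * r x0" "real (CARD('n) choose k) * r x0 ^ k = U powr p"
      using crit[of x0] by (simp_all add: F0 U_def)
    have "(N - 2 * real k) / real k * b0 = c / \<kappa>" by (simp add: b0_def \<kappa>_def mult.commute)
    also have "\<dots> = U powr (- \<kappa> - 1) * r x0" using cr(1) kappa by simp
    finally have "((N - 2 * real k) / real k * b0) ^ k = U powr (real k * (- \<kappa> - 1)) * r x0 ^ k"
      using U by (simp add: power_mult_distrib powr_powr mult.commute flip: powr_realpow)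
    then have "real (CARD('n) choose k) * a0 * ((N - 2 * real k) / real k * b0) ^ k
        = U powr (- \<kappa>) * U powr (real k * (- \<kappa> - 1)) * (real (CARD('n) choose k) * r x0 ^ k)"
      by (simp add: a0_def v_def U_def)
    also have "\<dots> = U powr (- \<kappa> + real k * (- \<kappa> - 1) + p)" unfolding cr(2) powr_add ..
    also have "- \<kappa> + real k * (- \<kappa> - 1) + p = 0" using p_kappa N_kappa by (simp add: algebra_simps)
    finally show ?thesis using U by simp
  qed
  ultimately show ?thesis using a0 c by (intro exI[of _ x0] exI[of _ a0] exI[of _ b0]) (simp add: b0_def)
qed

end

subsection \<open>The strong maximum principle\<close>

text \<open>On the line through \<open>x\<close> in direction \<open>h\<close>, the first derivative
  vanishes at the minimum; a negative second derivative makes it negative just after, so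
  \<open>f\<close> would drop below its minimum.\<close>

lemma local_min_second_derivative:
  fixes f :: "real^'n \<Rightarrow> real"
  assumes f: "\<And>x. (f has_derivative (\<lambda>h. G x \<bullet> h)) (at x)" and G: "(G has_derivative D) (at x)"
    and S: "open S" "x \<in> S" "\<And>y. y \<in> S \<Longrightarrow> f x \<le> f y"
  shows "h \<bullet> D h \<ge> 0"
proof (rule ccontr)
  assume neg: "\<not> h \<bullet> D h \<ge> 0"
  define g where "g t = f (x + t *\<^sub>R h)" for t
  have l: "((\<lambda>t. x + t *\<^sub>R h) has_derivative (\<lambda>d. d *\<^sub>R h)) (at t)" for t
    by (auto intro!: derivative_eq_intros)
  have g1: "(g has_real_derivative G (x + t *\<^sub>R h) \<bullet> h) (at t)" for t
    unfolding g_def[abs_def] has_field_derivative_def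
    by (rule has_derivative_eq_rhs[OF has_derivative_compose[OF l f]]) (simp add: fun_eq_iff mult.commute)
  have g2: "((\<lambda>t. G (x + t *\<^sub>R h) \<bullet> h) has_real_derivative h \<bullet> D h) (at 0)"
  proof -
    have "((\<lambda>t. G (x + t *\<^sub>R h)) has_derivative (\<lambda>d. D (d *\<^sub>R h))) (at 0)"
      using has_derivative_compose[OF l[of 0], of G D] G by simp
    from has_derivative_inner_left[OF this, of h]
    have "((\<lambda>t. G (x + t *\<^sub>R h) \<bullet> h) has_derivative (\<lambda>d. D (d *\<^sub>R h) \<bullet> h)) (at 0)" .
    moreover have "D (d *\<^sub>R h) \<bullet> h = (h \<bullet> D h) * d" for d
      using linear_scale[OF has_derivative_linear[OF G]] by (simp add: inner_commute)
    ultimately show ?thesis by (simp add: has_field_derivative_def)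
  qed
  obtain e where e: "e > 0" "ball x e \<subseteq> S" using S by (meson open_contains_ball)
  define \<delta> where "\<delta> = e / (norm h + 1)"
  have d: "\<delta> > 0" using e by (simp add: \<delta>_def add_nonneg_pos)
  have gmin: "g 0 \<le> g t" if "\<bar>t\<bar> < \<delta>" for t
  proof -
    have "\<bar>t\<bar> * norm h \<le> \<bar>t\<bar> * (norm h + 1)" by (intro mult_left_mono) auto
    also have "\<dots> < e"
    proof -
      have "norm h + 1 > 0" by (simp add: add_nonneg_pos)
      then show ?thesis using that by (simp only: \<delta>_def pos_less_divide_eq)
    qed
    finally have "x + t *\<^sub>R h \<in> ball x e" by (simp add: dist_norm)
    then show ?thesis using e S(3) by (auto simp: g_def)
  qed
  have "G (x + 0 *\<^sub>R h) \<bullet> h = 0"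
    by (rule DERIV_local_min[OF g1[of 0] d]) (use gmin in auto)
  moreover obtain d' where d': "d' > 0" "\<And>t. 0 < t \<Longrightarrow> t < d' \<Longrightarrow> G (x + (0 + t) *\<^sub>R h) \<bullet> h < G (x + 0 *\<^sub>R h) \<bullet> h"
    using DERIV_neg_dec_right[OF g2] neg by auto
  ultimately have neg': "G (x + t *\<^sub>R h) \<bullet> h < 0" if "0 < t" "t < d'" for t using that by fastforce
  define t where "t = min \<delta> d' / 2"
  have t: "0 < t" "t < \<delta>" "t < d'" using d d' by (auto simp: t_def)
  obtain z where z: "0 < z" "z < t" "g t - g 0 = (t - 0) * (G (x + z *\<^sub>R h) \<bullet> h)"
    using MVT2[OF t(1), of g "\<lambda>t. G (x + t *\<^sub>R h) \<bullet> h"] g1 by blast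
  have "G (x + z *\<^sub>R h) \<bullet> h < 0" using z t by (intro neg') auto
  then have "g t < g 0" using z(3) t(1) mult_pos_neg[of t "G (x + z *\<^sub>R h) \<bullet> h"] by simp
  then show False using gmin[of t] t by simp
qed

text \<open>Hopf's argument: compare \<open>u\<close> with a Gaussian barrier in an annulus touching the zero set.\<close>

lemma superharmonic_pos_or_zero:
  fixes u :: "real^'n \<Rightarrow> real"
  assumes nonneg: "\<And>x. u x \<ge> 0" and du: "\<And>x. (u has_derivative (\<lambda>h. Du x \<bullet> h)) (at x)"
    and dDu: "\<And>x. (Du has_derivative (\<lambda>h. - (A x *v h))) (at x)" and tr: "\<And>x. trace (A x) \<ge> 0"
    and z: "u z = 0"
  shows "u y = 0"
proof (rule ccontr)
  assume uy: "u y \<noteq> 0"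
  have cu: "continuous_on S u" for S
    using du by (meson continuous_at_imp_continuous_on has_derivative_continuous continuous_on_subset subset_UNIV)
  define Z where "Z = {x. u x = 0}"
  have Z: "closed Z" "Z \<noteq> {}" unfolding Z_def using cu[of UNIV] z
    by (auto intro: closed_Collect_eq)
  obtain z0 where z0: "z0 \<in> Z" "\<And>x. x \<in> Z \<Longrightarrow> dist y z0 \<le> dist y x"
    using distance_attains_inf[OF Z, of y] by blast
  define d where "d = dist y z0"
  have "y \<noteq> z0" using z0 uy by (auto simp: Z_def)
  then have d: "d > 0" by (simp add: d_def)
  have pos: "u x > 0" if "dist y x < d" for x
  proof -
    have "x \<notin> Z" using z0(2)[of x] that by (auto simp: d_def)
    then show ?thesis using nonneg[of x] by (simp add: Z_def)
  qed
  obtain x1 where x1: "x1 \<in> cball y (d / 2)" "\<And>x. x \<in> cball y (d / 2) \<Longrightarrow> u x1 \<le> u x"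
    using continuous_attains_inf[of "cball y (d / 2)" u] cu d by auto
  define \<epsilon> where "\<epsilon> = u x1"
  have eps: "\<epsilon> > 0" unfolding \<epsilon>_def using x1(1) d by (intro pos) auto
  define N where "N = real CARD('n)"
  have N: "N > 0" by (simp add: N_def)
  \<comment> \<open>In the annulus the distance to \<open>y\<close> is at least d / 2, so
    \<open>2 * \<alpha> * ((x - y) \<bullet> (x - y))\<close> is at least 2 N. This exceeds N and
    makes the Gaussian strictly subharmonic there.\<close>
  define \<alpha> where "\<alpha> = 4 * N / d\<^sup>2"
  have al: "\<alpha> > 0" using d N by (simp add: \<alpha>_def)
  define E where "E x = exp (- \<alpha> * ((x - y) \<bullet> (x - y)))" for x
  define w where "w x = u x - \<epsilon> * (E x - exp (- \<alpha> * d\<^sup>2))" for x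
  define G where "G x = Du x + (2 * \<alpha> * \<epsilon> * E x) *\<^sub>R (x - y)" for x
  have dE: "(E has_derivative (\<lambda>h. - 2 * \<alpha> * E x * ((x - y) \<bullet> h))) (at x)" for x
    unfolding E_def by (auto intro!: derivative_eq_intros simp: inner_commute)
  have dw: "(w has_derivative (\<lambda>h. G x \<bullet> h)) (at x)" for x
    unfolding w_def G_def
    by (auto intro!: derivative_eq_intros du dE simp: inner_add_left algebra_simps)
  define D where "D x h = - (A x *v h) + ((2 * \<alpha> * \<epsilon> * E x) *\<^sub>R h
      + (2 * \<alpha> * \<epsilon> * (- 2 * \<alpha> * E x * ((x - y) \<bullet> h))) *\<^sub>R (x - y))" for x h
  have dG: "(G has_derivative D x) (at x)" for x
  proof -
    have "((\<lambda>x. (2 * \<alpha> * \<epsilon> * E x) *\<^sub>R (x - y)) has_derivative (\<lambda>h. (2 * \<alpha> * \<epsilon> * E x) *\<^sub>R h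
      + (2 * \<alpha> * \<epsilon> * (- 2 * \<alpha> * E x * ((x - y) \<bullet> h))) *\<^sub>R (x - y))) (at x)"
      by (intro has_derivative_scaleR has_derivative_mult_right dE) (auto intro!: derivative_eq_intros)
    from has_derivative_add[OF dDu this] show ?thesis unfolding G_def[abs_def] D_def[abs_def] .
  qed
  define K where "K = cball y d - ball y (d / 2)"
  have K: "compact K" unfolding K_def by (intro compact_diff) auto
  have zK: "z0 \<in> K" using d by (auto simp: K_def d_def)
  have cw: "continuous_on K w"
    using dw by (meson continuous_at_imp_continuous_on has_derivative_continuous continuous_on_subset subset_UNIV)
  obtain x where x: "x \<in> K" "\<And>x'. x' \<in> K \<Longrightarrow> w x \<le> w x'"
    using continuous_attains_inf[OF K _ cw] zK by blast
  \<comment> \<open>A negative minimum cannot lie on the outer sphere, where the barrier vanishes,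
    nor on the inner one, where \<open>u\<close> is at least \<epsilon>. In the interior the second
    derivatives along the axes add up to a contradiction with the trace condition.\<close>
  have "w x \<ge> 0"
  proof (rule ccontr)
    assume neg: "\<not> w x \<ge> 0"
    have xd: "d / 2 \<le> dist y x" "dist y x \<le> d" using x(1) by (auto simp: K_def)
    have "dist y x \<noteq> d"
    proof
      assume "dist y x = d"
      then have "(x - y) \<bullet> (x - y) = d\<^sup>2" by (simp add: dot_square_norm dist_norm norm_minus_commute)
      then have "w x = u x" by (simp add: w_def E_def)
      then show False using neg nonneg[of x] by simp
    qed
    moreover have "dist y x \<noteq> d / 2"
    proof
      assume "dist y x = d / 2"
      then have "\<epsilon> \<le> u x" unfolding \<epsilon>_def by (intro x1) auto
      moreover have "E x \<le> 1" using al by (simp add: E_def)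
      then have "E x - exp (- \<alpha> * d\<^sup>2) \<le> 1" by (smt (verit) exp_gt_zero)
      then have "\<epsilon> * (E x - exp (- \<alpha> * d\<^sup>2)) \<le> \<epsilon>" using eps mult_left_mono[of _ 1 \<epsilon>] by simp
      ultimately show False using neg by (simp add: w_def)
    qed
    ultimately have xi: "x \<in> ball y d - cball y (d / 2)" using xd by auto
    have D: "h \<bullet> D x h \<ge> 0" for h
    proof (rule local_min_second_derivative[OF dw dG _ xi])
      show "open (ball y d - cball y (d / 2))" by (intro open_Diff) auto
      fix x' assume "x' \<in> ball y d - cball y (d / 2)"
      then show "w x \<le> w x'" by (intro x) (auto simp: K_def)
    qed
    have "0 \<le> (\<Sum>i\<in>UNIV. axis i 1 \<bullet> D x (axis i 1))" by (intro sum_nonneg D)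
    also have "\<dots> = (\<Sum>i\<in>UNIV. - (A x $ i $ i) + 2 * \<alpha> * \<epsilon> * E x * (1 - 2 * \<alpha> * ((x - y) $ i)\<^sup>2))"
    proof (rule sum.cong)
      fix i :: 'n
      have "axis i 1 \<bullet> (A x *v axis i 1) = A x $ i $ i"
        by (simp add: matrix_vector_mult_basis column_def inner_axis')
      moreover have "axis i (1::real) \<bullet> axis i 1 = 1" by (simp add: inner_axis_axis)
      moreover have "(x - y) \<bullet> axis i 1 = (x - y) $ i" "axis i 1 \<bullet> (x - y) = (x - y) $ i"
        by (simp_all add: inner_axis inner_axis')
      ultimately show "axis i 1 \<bullet> D x (axis i 1) = - (A x $ i $ i) + 2 * \<alpha> * \<epsilon> * E x * (1 - 2 * \<alpha> * ((x - y) $ i)\<^sup>2)"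
        unfolding D_def by (simp only: inner_add_right inner_minus_right inner_scaleR_right) (simp add: power2_eq_square algebra_simps)
    qed simp
    also have "\<dots> = - trace (A x) + 2 * \<alpha> * \<epsilon> * E x * (N - 2 * \<alpha> * ((x - y) \<bullet> (x - y)))"
      by (simp add: trace_def N_def inner_vec_def power2_eq_square sum.distrib sum_negf sum_subtractf
          flip: sum_distrib_left)
    finally have "0 \<le> 2 * \<alpha> * \<epsilon> * E x * (N - 2 * \<alpha> * ((x - y) \<bullet> (x - y)))" using tr[of x] by linarith
    moreover have "2 * \<alpha> * \<epsilon> * E x > 0" using al eps by (simp add: E_def)
    ultimately have le: "2 * \<alpha> * ((x - y) \<bullet> (x - y)) \<le> N" by (simp add: zero_le_mult_iff)
    have "(d / 2)\<^sup>2 \<le> (x - y) \<bullet> (x - y)"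
      unfolding dot_square_norm using xd(1) d by (intro power_mono) (auto simp: dist_norm norm_minus_commute)
    then have "2 * \<alpha> * (d / 2)\<^sup>2 \<le> 2 * \<alpha> * ((x - y) \<bullet> (x - y))" using al by (intro mult_left_mono) auto
    moreover have "2 * \<alpha> * (d / 2)\<^sup>2 = 2 * N" using d by (simp add: \<alpha>_def power2_eq_square)
    ultimately show False using le N by linarith
  qed
  then have wK: "w x' \<ge> 0" if "x' \<in> K" for x' using x(2)[OF that] by linarith
  have zy: "(z0 - y) \<bullet> (z0 - y) = d\<^sup>2" by (simp add: d_def dot_square_norm dist_norm norm_minus_commute)
  have wz: "w z0 = 0" using z0(1) by (simp add: w_def E_def zy Z_def)
  \<comment> \<open>A zero of a nonnegative function is a minimum. The derivative of
    \<open>w\<close> at \<open>z0\<close> thus comes from the barrier alone, and \<open>w\<close>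
    decreases into the annulus.\<close>
  have Duz: "Du z0 = 0"
  proof -
    have "(\<lambda>h. Du z0 \<bullet> h) = (\<lambda>h. 0)"
      by (rule has_derivative_local_min[OF du[of z0]]) (use z0(1) nonneg in \<open>simp add: Z_def\<close>)
    then have "Du z0 \<bullet> Du z0 = 0" by metis
    then show ?thesis by simp
  qed
  define g where "g t = w (z0 + t *\<^sub>R (y - z0))" for t
  have "((\<lambda>t. z0 + t *\<^sub>R (y - z0)) has_derivative (\<lambda>t. t *\<^sub>R (y - z0))) (at 0)"
    by (auto intro!: derivative_eq_intros)
  from has_derivative_compose[OF this, of w "\<lambda>h. G z0 \<bullet> h"] dw[of z0]
  have "(g has_derivative (\<lambda>t. G z0 \<bullet> (t *\<^sub>R (y - z0)))) (at 0)" by (simp add: g_def[abs_def])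
  moreover have "G z0 \<bullet> (t *\<^sub>R (y - z0)) = - (2 * \<alpha> * \<epsilon> * E z0 * d\<^sup>2) * t" for t
  proof -
    have "(z0 - y) \<bullet> (y - z0) = - d\<^sup>2" using zy by (metis inner_minus_right minus_diff_eq)
    then show ?thesis by (simp add: G_def Duz)
  qed
  ultimately have "(g has_real_derivative - (2 * \<alpha> * \<epsilon> * E z0 * d\<^sup>2)) (at 0)"
    unfolding has_field_derivative_def by (simp only:)
  moreover have "- (2 * \<alpha> * \<epsilon> * E z0 * d\<^sup>2) < 0" using al eps d by (simp add: E_def)
  ultimately obtain e where e: "e > 0" "\<And>t. 0 < t \<Longrightarrow> t < e \<Longrightarrow> g (0 + t) < g 0"
    using DERIV_neg_dec_right by blast
  define t where "t = min e 1 / 2"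
  have t: "0 < t" "t < e" "t \<le> 1 / 2" using e by (auto simp: t_def)
  have "dist y (z0 + t *\<^sub>R (y - z0)) = (1 - t) * d"
  proof -
    have "y - (z0 + t *\<^sub>R (y - z0)) = (1 - t) *\<^sub>R (y - z0)" by (simp add: algebra_simps)
    then show ?thesis using t by (simp add: dist_norm d_def)
  qed
  moreover have "(1 - t) * d \<le> 1 * d" "1 / 2 * d \<le> (1 - t) * d"
    using t d by (auto intro!: mult_right_mono)
  ultimately have "z0 + t *\<^sub>R (y - z0) \<in> K" by (auto simp: K_def)
  then have "g t \<ge> 0" unfolding g_def by (rule wK)
  then show False using e(2)[OF t(1,2)] wz by (simp add: g_def)
qed

section \<open>Passage from the Hessian hypotheses to the two alternatives\<close>

theorem theorem6p2:
  fixes u :: "real^'n \<Rightarrow> real" and n k :: nat and p :: real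
  assumes n: "n = CARD('n)" and k: "k \<ge> 2" and nk: "n > 4 * k"
    and p: "p = real k * (real n + 2) / (real n - 2 * real k)"
    and C2: "C2 u"
    and nonneg: "\<And>x. u x \<ge> 0"
    and cone: "\<And>x. - hessian u x \<in> closed_Gamma k"
    and eqn: "\<And>x. \<sigma> k (- hessian u x) = u x powr p"
    and growth: "\<exists>C>0. \<forall>\<^sub>F R in at_top.
      (LINT x:ball 0 R|lborel.
         u x powr ((real n * (real k + 1) - 2 * real k) / (real n - 2 * real k)))
      \<le> C * R\<^sup>2 * ln R"
  shows "(\<forall>x. u x = 0) \<or>
    (\<exists>x0 a0 b0. a0 > 0 \<and> b0 > 0 \<and>
       real (n choose k) * a0 * ((real n - 2 * real k) / real k * b0) ^ k = 1 \<and>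
       (\<forall>x. u x = (a0 + b0 * (norm (x - x0))\<^sup>2) powr (- ((real n - 2 * real k) / (2 * real k)))))"
proof -
  define A where "A x = - hessian u x" for x
  have sym: "transpose (A x) = A x" for x using cone[of x] by (simp add: closed_Gamma_def A_def)
  have sg_nonneg: "sg (A x) j \<ge> 0" if "1 \<le> j" "j \<le> k" for x j
  proof -
    have "\<sigma> j (A x) \<ge> 0" using cone[of x] that unfolding closed_Gamma_def A_def by blast
    then show ?thesis by (simp only: sigma_eq_sg[OF sym])
  qed
  have sg_k: "sg (A x) k = u x powr p" for x
    using eqn[of x] sigma_eq_sg[OF sym, of k x] by (simp add: A_def)
  have du: "(u has_derivative (\<lambda>h. grad u x \<bullet> h)) (at x)" for x
  proof -
    have d: "(u has_derivative frechet_derivative u (at x)) (at x)"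
      using C2 by (simp add: C2_def frechet_derivative_works[symmetric])
    have "frechet_derivative u (at x) h = grad u x \<bullet> h" for h
    proof -
      have "frechet_derivative u (at x) h = frechet_derivative u (at x) (\<Sum>i\<in>UNIV. h $ i *\<^sub>R axis i 1)"
        using basis_expansion[of h] by (simp add: scalar_mult_eq_scaleR)
      also have "\<dots> = (\<Sum>i\<in>UNIV. h $ i * frechet_derivative u (at x) (axis i 1))"
        by (simp add: linear_sum[OF has_derivative_linear[OF d]] linear_scale[OF has_derivative_linear[OF d]])
      finally show ?thesis by (simp add: grad_def inner_vec_def mult.commute)
    qed
    then show ?thesis by (intro has_derivative_eq_rhs[OF d] ext)
  qed
  have dDu: "(grad u has_derivative (\<lambda>h. - (A x *v h))) (at x)" for x
  proof -
    have "(grad u has_derivative (\<lambda>h. hessian u x *v h)) (at x)"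
      using C2 unfolding C2_def hessian_def by (simp add: jacobian_works[symmetric])
    then show ?thesis by (simp add: A_def matvec.minus_left)
  qed
  show ?thesis
  proof (cases "\<exists>z. u z = 0")
    case True
    \<comment> \<open>The trace is the first symmetric function, nonnegative on the closed cone, so
      \<open>u\<close> is superharmonic.\<close>
    have "trace (A x) \<ge> 0" for x using sg_nonneg[of 1 x] k by (simp add: sg_def)
    then have "\<forall>x. u x = 0" using superharmonic_pos_or_zero[OF nonneg du dDu] True by blast
    then show ?thesis ..
  next
    case False
    then have u_pos: "u x > 0" for x using nonneg[of x] by (metis less_le)
    have "continuous_on UNIV A" using C2 unfolding A_def C2_def by (intro continuous_on_minus) simp
    moreover have "A x \<in> cone k" for x
      by (rule coneI[OF sym sg_nonneg]) (use u_pos[of x] in \<open>auto simp: sg_k\<close>)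
    ultimately interpret hessian_solution u "grad u" A k
      using u_pos du dDu k nk sg_k by unfold_locales (simp_all add: n p)
    have Nn: "real n = N" by (simp add: N_def n)
    have "\<exists>C>0. \<forall>\<^sub>F R in at_top. (LINT x:ball 0 R|lborel. u x powr \<gamma>) \<le> C * R\<^sup>2 * ln R"
      using growth unfolding gamma_eq Nn .
    then show ?thesis using bubble[OF Q_eq_0] unfolding Nn by (simp add: n)
  qed
qed

end
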